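(* Fix a closed disk $K\subseteq\mathbb{C}$ centered at $\frac1\alpha\sum_{j=1}^d\alpha_j\lambda_j$. Then, for sufficiently large $t>0$, $$U_t(z)=\max_{j=1,\dots,d+1}G\big(z,u_t^j(z)\big),\qquad z\in K,$$ and $\operatorname{supp}(\mu_t)\cap K$ consists of a single smooth curve that converges, as $t\to\infty$, in the Hausdorff metric to a horizontal segment through the center of mass $\frac1\alpha\sum_{j=1}^d\alpha_j\lambda_j$.
   Context: $d\in\mathbb{N}$, $\lambda_1,\dots,\lambda_d\in\mathbb{C}$ are distinct, $\alpha_1,\dots,\alpha_d\in\mathbb{N}=\{1,2,\dots\}$, $\alpha=\sum_j\alpha_j$, $P(z)=\prod_{j=1}^d(z-\lambda_j)^{\alpha_j}$, $P^n$ is the $n$-th power of $P$, and $P_t^n=e^{-\frac{t}{2\alpha n}\partial_z^2}P^n=\sum_{k\ge0}\frac{1}{k!}(-\frac{t}{2\alpha n})^k\partial_z^{2k}P^n$. For $t>0$, $\mu_t$ is the weak limit as $n\to\infty$ of $\mu_{n,t}=\frac1{\alpha n}\sum_{\lambda:P_t^n(\lambda)=0}\delta_\lambda$ (zeros counted with multiplicity); this limit exists and is a compactly supported probability measure on $\mathbb{C}$. $U_t(z)=\int_{\mathbb{C}}\log|z-\xi|\,d\mu_t(\xi)$ is its logarithmic potential. $$G(z,u)=\frac1\alpha\sum_{j=1}^d\alpha_j\log|u-\lambda_j|+\operatorname{Re}\Big(\frac{(z-u)^2}{2t}\Big).$$ $u_t^1(z),\dots,u_t^{d+1}(z)$ are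 the saddle points, i.e. the solutions $u$ (counted with multiplicity) of $u+\frac t\alpha\sum_{j=1}^d\frac{\alpha_j}{u-\lambda_j}=z$, equivalently the roots of $Q_{z,t}(u)=\frac t\alpha\sum_{j}\alpha_j\prod_{k\ne j}(u-\lambda_k)-(z-u)\prod_{j}(u-\lambda_j)$. *)

theory Defs
  imports "HOL-Probability.Probability" "HOL-Computational_Algebra.Polynomial"
begin

text \<open>
  The data are \<open>d\<close>, the roots \<open>lam 1, \<dots>, lam d\<close> and their multiplicities \<open>a 1, \<dots>, a d\<close>;
  values outside \<open>{1..d}\<close> are irrelevant.
\<close>

definition total_mult :: "nat \<Rightarrow> (nat \<Rightarrow> nat) \<Rightarrow> nat" where
  "total_mult d a = (\<Sum>j\<in>{1..d}. a j)"

definition center_of_mass :: "nat \<Rightarrow> (nat \<Rightarrow> complex) \<Rightarrow> (nat \<Rightarrow> nat) \<Rightarrow> complex" where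
  "center_of_mass d lam a = (\<Sum>j\<in>{1..d}. of_nat (a j) * lam j) / of_nat (total_mult d a)"

definition base_poly :: "nat \<Rightarrow> (nat \<Rightarrow> complex) \<Rightarrow> (nat \<Rightarrow> nat) \<Rightarrow> complex poly" where
  "base_poly d lam a = (\<Prod>j\<in>{1..d}. [:- lam j, 1:] ^ a j)"

text \<open>
  The operator \<open>exp (- s \<partial>\<^sup>2)\<close>. The exponential series is cut off at \<open>k = degree p\<close>, beyond
  which all derivatives \<open>\<partial>\<^sup>2\<^sup>k p\<close> vanish.
\<close>
definition heat_flow :: "real \<Rightarrow> complex poly \<Rightarrow> complex poly" where
  "heat_flow s p =
     (\<Sum>k\<le>degree p. smult (of_real ((- s) ^ k / fact k)) ((pderiv ^^ (2 * k)) p))"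

definition evolved_power ::
    "nat \<Rightarrow> (nat \<Rightarrow> complex) \<Rightarrow> (nat \<Rightarrow> nat) \<Rightarrow> real \<Rightarrow> nat \<Rightarrow> complex poly" where
  "evolved_power d lam a t n =
     heat_flow (t / (2 * real (total_mult d a) * real n)) (base_poly d lam a ^ n)"

text \<open>
  The measure \<open>1/(\<alpha> n) \<Sum> \<delta>\<^sub>\<lambda>\<close>, a root \<open>\<lambda>\<close> being weighted by its multiplicity. The push-forward
  along the inclusion turns the discrete measure on the roots into a Borel measure on the plane.
\<close>
definition zero_measure ::
    "nat \<Rightarrow> (nat \<Rightarrow> complex) \<Rightarrow> (nat \<Rightarrow> nat) \<Rightarrow> real \<Rightarrow> nat \<Rightarrow> complex measure" where
  "zero_measure d lam a t n =
     (let p = evolved_power d lam a t n in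
      distr
        (point_measure {l. poly p l = 0}
           (\<lambda>l. ennreal (real (order l p) / (real (total_mult d a) * real n))))
        borel (\<lambda>l. l))"

text \<open>The library's \<open>weak_conv_m\<close> covers measures on the real line only.\<close>
definition weakly_converges ::
    "(nat \<Rightarrow> 'a::topological_space measure) \<Rightarrow> 'a measure \<Rightarrow> bool" where
  "weakly_converges M N \<longleftrightarrow>
     (\<forall>f :: 'a \<Rightarrow> real. continuous_on UNIV f \<and> bounded (range f) \<longrightarrow>
        (\<lambda>n. integral\<^sup>L (M n) f) \<longlonglongrightarrow> integral\<^sup>L N f)"

definition measure_support :: "'a::topological_space measure \<Rightarrow> 'a set" where
  "measure_support M = {x. \<forall>U. open U \<and> x \<in> U \<longrightarrow> emeasure M U > 0}"

text \<open>
  The integral of \<open>log \<bar>z - \<xi>\<bar>\<close> with values in the extended reals, written as the integral of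
  the positive part minus that of the negative part (\<open>ennreal\<close> sends negative reals to 0).
  The singularity needs care: \<open>ln 0 = 0\<close> in HOL, whereas here \<open>log 0 = -\<infinity>\<close>.
  By the convention \<open>\<infinity> - \<infinity> = \<infinity>\<close>, a finite value means that both parts are finite.
\<close>
definition log_potential :: "complex measure \<Rightarrow> complex \<Rightarrow> ereal" where
  "log_potential M z =
     enn2ereal (\<integral>\<^sup>+ \<xi>. ennreal (ln (cmod (z - \<xi>))) \<partial>M)
     - enn2ereal (\<integral>\<^sup>+ \<xi>. (if \<xi> = z then \<infinity> else ennreal (- ln (cmod (z - \<xi>)))) \<partial>M)"

text \<open>
  Used only at saddle points, which differ from all \<open>lam j\<close> (lemma \<open>saddle_poly_root_iff\<close>
  below), so the HOL value of \<open>ln 0\<close> plays no role.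
\<close>
definition phase ::
    "nat \<Rightarrow> (nat \<Rightarrow> complex) \<Rightarrow> (nat \<Rightarrow> nat) \<Rightarrow> real \<Rightarrow> complex \<Rightarrow> complex \<Rightarrow> real" where
  "phase d lam a t z u =
     (\<Sum>j\<in>{1..d}. real (a j) * ln (cmod (u - lam j))) / real (total_mult d a)
     + Re ((z - u)\<^sup>2 / of_real (2 * t))"

definition saddle_poly ::
    "nat \<Rightarrow> (nat \<Rightarrow> complex) \<Rightarrow> (nat \<Rightarrow> nat) \<Rightarrow> real \<Rightarrow> complex \<Rightarrow> complex poly" where
  "saddle_poly d lam a t z =
     smult (of_real (t / real (total_mult d a)))
       (\<Sum>j\<in>{1..d}. smult (of_nat (a j)) (\<Prod>k\<in>{1..d} - {j}. [:- lam k, 1:]))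
     - [:z, - 1:] * (\<Prod>j\<in>{1..d}. [:- lam j, 1:])"

text \<open>The saddle points \<open>u\<^sub>t\<^sup>1(z), \<dots>, u\<^sub>t\<^sup>d\<^sup>+\<^sup>1(z)\<close>, as a multiset.\<close>
definition saddle_points ::
    "nat \<Rightarrow> (nat \<Rightarrow> complex) \<Rightarrow> (nat \<Rightarrow> nat) \<Rightarrow> real \<Rightarrow> complex \<Rightarrow> complex multiset" where
  "saddle_points d lam a t z = proots (saddle_poly d lam a t z)"

text \<open>
  A smooth curve is the image of a simple, non-closed, regular \<open>C\<^sup>\<infinity>\<close> path; \<open>g n\<close> is the \<open>n\<close>-th
  derivative of the path (one-sided at the end points).
\<close>
definition smooth_curve :: "complex set \<Rightarrow> bool" where
  "smooth_curve S \<longleftrightarrow>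
     (\<exists>g :: nat \<Rightarrow> real \<Rightarrow> complex.
        (\<forall>n. \<forall>x\<in>{0..1}. (g n has_vector_derivative g (Suc n) x) (at x within {0..1})) \<and>
        (\<forall>x\<in>{0..1}. g 1 x \<noteq> 0) \<and>
        arc (g 0) \<and> path_image (g 0) = S)"

text \<open>The Hausdorff distance; meaningful for nonempty bounded sets.\<close>
definition hausdorff_distance :: "'a::metric_space set \<Rightarrow> 'a set \<Rightarrow> real" where
  "hausdorff_distance A B = max (SUP x\<in>A. infdist x B) (SUP y\<in>B. infdist y A)"

lemma poly_saddle_poly:
  "poly (saddle_poly d lam a t z) u =
     of_real (t / real (total_mult d a)) *
       (\<Sum>j\<in>{1..d}. of_nat (a j) * (\<Prod>k\<in>{1..d} - {j}. u - lam k))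
     - (z - u) * (\<Prod>j\<in>{1..d}. u - lam j)"
  by (simp add: saddle_poly_def poly_sum poly_prod algebra_simps)

lemma saddle_poly_root_iff:
  assumes "inj_on lam {1..d}" "\<And>j. j \<in> {1..d} \<Longrightarrow> a j \<ge> 1" "d \<ge> 1" "t > 0"
  shows "poly (saddle_poly d lam a t z) u = 0 \<longleftrightarrow>
    u \<notin> lam ` {1..d} \<and>
    u + of_real (t / real (total_mult d a)) * (\<Sum>j\<in>{1..d}. of_nat (a j) / (u - lam j)) = z"
proof (cases "u \<in> lam ` {1..d}")
  case True
  then obtain i where i: "i \<in> {1..d}" "u = lam i" by blast
  have zero: "(\<Prod>k\<in>{1..d} - {j}. u - lam k) = 0" if "j \<in> {1..d} - {i}" for j
    using that i by (intro prod_zero) auto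
  have "(\<Sum>j\<in>{1..d} - {i}. of_nat (a j) * (\<Prod>k\<in>{1..d} - {j}. u - lam k)) = 0"
    by (intro sum.neutral ballI) (simp only: zero mult_zero_right)
  moreover have "(\<Sum>j\<in>{1..d}. of_nat (a j) * (\<Prod>k\<in>{1..d} - {j}. u - lam k))
      = of_nat (a i) * (\<Prod>k\<in>{1..d} - {i}. u - lam k)
        + (\<Sum>j\<in>{1..d} - {i}. of_nat (a j) * (\<Prod>k\<in>{1..d} - {j}. u - lam k))"
    by (rule sum.remove) (use i in simp_all)
  ultimately have sum_eq: "(\<Sum>j\<in>{1..d}. of_nat (a j) * (\<Prod>k\<in>{1..d} - {j}. u - lam k))
      = of_nat (a i) * (\<Prod>k\<in>{1..d} - {i}. u - lam k)"
    by (metis add_0_right)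
  have "u \<noteq> lam k" if "k \<in> {1..d} - {i}" for k
    using inj_onD[OF assms(1), of i k] that i(1) unfolding i(2) by blast
  hence "(\<Prod>k\<in>{1..d} - {i}. u - lam k) \<noteq> 0"
    unfolding prod_zero_iff[OF finite_Diff[OF finite_atLeastAtMost]] by (metis eq_iff_diff_eq_0)
  moreover have ai: "a i \<noteq> 0" using assms(2)[OF i(1)] by linarith
  moreover have "total_mult d a \<noteq> 0"
    unfolding total_mult_def sum_eq_0_iff[OF finite_atLeastAtMost] using ai i(1) by metis
  moreover have "(\<Prod>j\<in>{1..d}. u - lam j) = 0"
    by (rule prod_zero) (use i in auto)
  ultimately have "poly (saddle_poly d lam a t z) u \<noteq> 0"
    unfolding poly_saddle_poly sum_eq using \<open>t > 0\<close> by (simp del: prod_zero_iff)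
  thus ?thesis using True by blast
next
  case False
  define w where "w = (\<Prod>j\<in>{1..d}. u - lam j)"
  have w: "w \<noteq> 0" using False by (auto simp: w_def)
  have "(\<Prod>k\<in>{1..d} - {j}. u - lam k) = w / (u - lam j)" if "j \<in> {1..d}" for j
  proof -
    have "w = (u - lam j) * (\<Prod>k\<in>{1..d} - {j}. u - lam k)"
      unfolding w_def by (rule prod.remove) (use that in auto)
    moreover have "u - lam j \<noteq> 0" using that False by auto
    ultimately show ?thesis by simp
  qed
  hence "(\<Sum>j\<in>{1..d}. of_nat (a j) * (\<Prod>k\<in>{1..d} - {j}. u - lam k))
      = (\<Sum>j\<in>{1..d}. of_nat (a j) / (u - lam j)) * w"
    unfolding sum_distrib_right by (intro sum.cong) auto
  hence "poly (saddle_poly d lam a t z) u =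
      (u + of_real (t / real (total_mult d a)) * (\<Sum>j\<in>{1..d}. of_nat (a j) / (u - lam j)) - z) * w"
    unfolding poly_saddle_poly w_def[symmetric] by (simp add: algebra_simps)
  thus ?thesis using w False by auto
qed

end

theory Submission
  imports Defs "HOL-Complex_Analysis.Complex_Analysis" "HOL-Computational_Algebra.Fundamental_Theorem_Algebra"
begin

text \<open>
  In the variables \<open>v = (u - c) / \<surd>t\<close>, \<open>\<zeta> = (z - c) / \<surd>t\<close>, \<open>\<kappa>\<^sub>j = (\<lambda>\<^sub>j - c) / \<surd>t\<close> the polynomial \<open>P\<^sub>t\<^sup>n(z)\<close>
  is, up to a constant, the integral of \<open>\<Prod> (v - \<kappa>\<^sub>j)\<^bsup>n \<alpha>\<^sub>j\<^esup> exp (N (\<zeta> - v)\<^sup>2 / 2)\<close>, \<open>N = \<alpha> n\<close>, over a vertical line.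
  For large \<open>t\<close> all \<open>\<kappa>\<^sub>j\<close> and \<open>\<zeta>\<close> are tiny, the integrand resembles \<open>v\<^sup>N exp (N v\<^sup>2 / 2)\<close>, and only the
  saddle points close to \<open>\<plusminus>\<i>\<close> matter. Laplace's method on each half line determines both contributions
  up to factors polynomial in \<open>N\<close>, so away from the curve where the two phases agree there are no zeros,
  and \<open>log \<bar>P\<^sub>t\<^sup>n\<bar> / N\<close> tends to the larger phase. Jensen's inequality controls the zeros far away, which
  turns this limit into the value of \<open>U\<^sub>t\<close>; on the curve itself one approaches from one side.

  The difference of the two phases is a multiple of \<open>Im \<Phi>\<close> for a holomorphic \<open>\<Phi>\<close> with
  \<open>\<Phi>(z) = z - c + O(1 / \<surd>t)\<close>. The curve is therefore the preimage of the real axis under a conformal map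
  close to a translation, and it is all of the support because the maximum of the phases has a kink there.
\<close>

section \<open>The saddle point close to \<open>\<i>\<close>\<close>

text \<open>The zeros are never located individually: on the curve the two half-line contributions
  may cancel, and their asymptotics say nothing there. All information comes from regions where one
  contribution dominates. Hence the bounds are uniform in the point, and the support has to be
  recovered from the potential.

  The line is cut at the real axis because there the integrand is at most about
  \<open>exp (- 3/4 * N)\<close>, against about \<open>exp (- 1/2 * N)\<close> at the saddle points.
  Each half can therefore be moved sideways to its own saddle point independently of the other.

  The choice of the origin matters to second order. The difference of the two critical values gets
  multiplied by \<open>\<surd>t\<close>, so an error linear in the \<open>kap j\<close> would
  displace the curve by a distance that does not tend to 0. The center of mass is the point for
  which this linear term cancels.\<close>

text \<open>
  \<open>S\<close> is the saddle map, \<open>f\<close> the exponent and \<open>sp \<zeta>\<close> the saddle point close to \<open>\<i>\<close>, all in the scaled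
  variables. The one close to \<open>-\<i>\<close> is reduced to it by the reflection \<open>(kap, \<zeta>, v) \<mapsto> (-kap, -\<zeta>, -v)\<close>.
  The bound on \<open>\<eta>\<close> makes errors of size \<open>13 \<eta>\<close> smaller than the gap \<open>(1/200)\<^sup>2 / 8\<close> that Laplace's
  method gains outside of the interval of radius \<open>1/100\<close> around the saddle point.
\<close>

locale saddle =
  fixes J :: "'j set" and a :: "'j \<Rightarrow> nat" and kap :: "'j \<Rightarrow> complex" and \<eta> :: real
  assumes finJ: "finite J" and apos: "(\<Sum>j\<in>J. a j) > 0"
    and eta_pos: "0 < \<eta>" and eta_small: "\<eta> \<le> 1 / 10000000"
    and kap_le: "\<And>j. j \<in> J \<Longrightarrow> norm (kap j) \<le> \<eta>"
begin

definition w :: "'j \<Rightarrow> real" where "w j = a j / (\<Sum>j\<in>J. a j)"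

definition S :: "complex \<Rightarrow> complex" where
  "S v = v + (\<Sum>j\<in>J. w j / (v - kap j))"

definition f :: "complex \<Rightarrow> complex \<Rightarrow> complex" where
  "f \<zeta> v = (\<Sum>j\<in>J. w j * Ln (v - kap j)) + (\<zeta> - v)\<^sup>2 / 2"

definition sp :: "complex \<Rightarrow> complex" where
  "sp \<zeta> = (THE v. v \<in> cball \<i> (1/50) \<and> S v = \<zeta>)"

text \<open>The critical value at the saddle point near \<open>\<i>\<close>; its real part is the
  exponential growth rate of the upper half of the line integral.\<close>

definition F :: "complex \<Rightarrow> complex" where
  "F \<zeta> = f \<zeta> (sp \<zeta>)"

lemma w_nonneg: "w j \<ge> 0"
  by (simp add: w_def sum_nonneg)

lemma sum_w: "(\<Sum>j\<in>J. w j) = 1"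
proof -
  have "(\<Sum>j\<in>J. w j) = real (\<Sum>j\<in>J. a j) / (\<Sum>j\<in>J. a j)"
    unfolding w_def of_nat_sum by (rule sum_divide_distrib[symmetric])
  then show ?thesis using apos by (simp del: of_nat_sum)
qed

text \<open>The weights \<open>w\<close> add up to 1, so a bound for each summand carries over to
  the average without loss. This is how everything is compared with the model case where all
  \<open>kap j\<close> are 0.\<close>

lemma norm_weighted_le:
  fixes g h :: "'j \<Rightarrow> complex"
  assumes "\<And>j. j \<in> J \<Longrightarrow> norm (g j - h j) \<le> C"
  shows "norm ((\<Sum>j\<in>J. w j * g j) - (\<Sum>j\<in>J. w j * h j)) \<le> C"
proof -
  have "(\<Sum>j\<in>J. w j * g j) - (\<Sum>j\<in>J. w j * h j) = (\<Sum>j\<in>J. w j * (g j - h j))"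
    by (simp add: sum_subtractf algebra_simps)
  also have "norm \<dots> \<le> (\<Sum>j\<in>J. norm (w j * (g j - h j)))" by (rule norm_sum)
  also have "\<dots> \<le> (\<Sum>j\<in>J. w j * C)"
    using assms w_nonneg by (intro sum_mono) (simp add: norm_mult mult_left_mono)
  also have "\<dots> = C" by (simp add: sum_distrib_right[symmetric] sum_w)
  finally show ?thesis .
qed

lemma weighted_const: "(\<Sum>j\<in>J. complex_of_real (w j) * x) = x"
  using sum_w by (simp add: sum_distrib_right[symmetric] flip: of_real_sum)

lemma near_i:
  assumes "v \<in> cball \<i> (1/50)" "j \<in> J"
  shows "norm (v - kap j - \<i>) \<le> 3/100" "v - kap j \<notin> \<real>\<^sub>\<le>\<^sub>0" "v - kap j \<noteq> 0" "norm (v - kap j) \<ge> 97/100"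
proof -
  have "norm (v - \<i>) \<le> 1/50" using assms by (simp add: dist_norm norm_minus_commute)
  then show 1: "norm (v - kap j - \<i>) \<le> 3/100"
    using kap_le[OF assms(2)] eta_small norm_triangle_ineq4[of "v - \<i>" "kap j"]
    by (simp add: algebra_simps)
  have "\<bar>Im (v - kap j - \<i>)\<bar> \<le> 3/100" using 1 abs_Im_le_cmod order_trans by blast
  then have "- (3/100) \<le> Im (v - kap j - \<i>)" by linarith
  then have "Im (v - kap j) > 0" by simp
  then show "v - kap j \<notin> \<real>\<^sub>\<le>\<^sub>0" "v - kap j \<noteq> 0" by (auto simp: complex_nonpos_Reals_iff)
  show "norm (v - kap j) \<ge> 97/100"
    using 1 norm_triangle_ineq2[of \<i> "- (v - kap j - \<i>)"] by (simp add: norm_minus_commute)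
qed

lemma S_deriv:
  assumes "\<And>j. j \<in> J \<Longrightarrow> v \<noteq> kap j"
  shows "(S has_field_derivative (1 - (\<Sum>j\<in>J. w j / (v - kap j)\<^sup>2))) (at v)"
proof -
  have "((\<lambda>v. \<Sum>j\<in>J. w j / (v - kap j)) has_field_derivative (\<Sum>j\<in>J. - (w j / (v - kap j)\<^sup>2))) (at v)"
    by (rule DERIV_sum) (use assms in \<open>auto intro!: derivative_eq_intros simp: power2_eq_square\<close>)
  from DERIV_add[OF DERIV_ident this] show ?thesis
    unfolding S_def sum_negf by simp
qed

text \<open>In the model case \<open>S v = v + 1 / v\<close>, whose derivative at
  \<open>\<i>\<close> is \<open>1 - 1 / \<i>\<^sup>2 = 2\<close>.\<close>

lemma S'_bound:
  assumes "v \<in> cball \<i> (1/50)"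
  shows "norm ((1 - (\<Sum>j\<in>J. w j / (v - kap j)\<^sup>2)) - 2) \<le> 1/10"
proof -
  have b: "norm (1 / (v - kap j)\<^sup>2 - (- 1)) \<le> 1/10" if "j \<in> J" for j
  proof -
    define x where "x = v - kap j"
    have x: "norm (x - \<i>) \<le> 3/100" "x \<noteq> 0" "norm x \<ge> 97/100"
      using near_i[OF assms that] by (auto simp: x_def)
    have x2: "norm (x + \<i>) \<le> 203/100"
      using x(1) norm_triangle_ineq[of "x - \<i>" "2 * \<i>"] by (simp add: algebra_simps norm_mult)
    have "1 / x\<^sup>2 - (- 1) = (x - \<i>) * (x + \<i>) / x\<^sup>2"
      using x(2) by (simp add: field_simps power2_eq_square)
    also have "norm \<dots> = norm (x - \<i>) * norm (x + \<i>) / (norm x)\<^sup>2"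
      by (simp add: norm_mult norm_divide norm_power)
    also have "\<dots> \<le> (3/100) * (203/100) / (97/100)\<^sup>2"
      using x x2 by (intro frac_le mult_mono power_mono) auto
    also have "\<dots> \<le> 1/10" by (simp add: power2_eq_square)
    finally show ?thesis by (simp add: x_def)
  qed
  have "norm ((\<Sum>j\<in>J. w j * (1 / (v - kap j)\<^sup>2)) - (\<Sum>j\<in>J. w j * (- 1 :: complex))) \<le> 1/10"
    by (rule norm_weighted_le) (rule b)
  then show ?thesis unfolding weighted_const by (subst norm_minus_commute) (simp add: add.commute)
qed

text \<open>Mean value inequality for \<open>S v - 2 * v\<close>. This one estimate yields existence
  and uniqueness of the saddle point, injectivity of \<open>S\<close>, and the quadratic expansion
  of \<open>f\<close> at the saddle point.\<close>

lemma S_lipschitz: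
  assumes "v \<in> cball \<i> (1/50)" "v' \<in> cball \<i> (1/50)"
  shows "norm ((S v - 2 * v) - (S v' - 2 * v')) \<le> 1/10 * norm (v - v')"
proof (rule field_differentiable_bound[of "cball \<i> (1/50)"
      _ "\<lambda>v. (1 - (\<Sum>j\<in>J. w j / (v - kap j)\<^sup>2)) - 2"])
  show "((\<lambda>z. S z - 2 * z) has_field_derivative (1 - (\<Sum>j\<in>J. w j / (z - kap j)\<^sup>2)) - 2) (at z within cball \<i> (1/50))"
    if "z \<in> cball \<i> (1/50)" for z
    by (rule has_field_derivative_at_within)
       (use near_i(3)[OF that] in \<open>auto intro!: derivative_eq_intros S_deriv\<close>)
qed (use assms S'_bound in auto)

lemma norm_inverse_diff_le:
  assumes "norm v \<ge> 1/10" "j \<in> J"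
  shows "norm (1 / (v - kap j) - 1 / v) \<le> 11/10 * \<eta> / (norm v)\<^sup>2"
proof -
  have k: "norm (kap j) \<le> \<eta>" using kap_le assms by auto
  have n: "norm (v - kap j) \<ge> 10/11 * norm v"
    using norm_triangle_ineq2[of v "kap j"] assms(1) k eta_small by linarith
  have v: "norm v > 0" using assms(1) by linarith
  then have "norm (v - kap j) > 0" using n by linarith
  then have "v - kap j \<noteq> 0" "v \<noteq> 0" using v by (auto simp del: right_minus_eq)
  then have "1 / (v - kap j) - 1 / v = kap j / ((v - kap j) * v)" by (simp add: field_simps)
  also have "norm \<dots> = norm (kap j) / (norm (v - kap j) * norm v)"
    by (simp add: norm_divide norm_mult)
  also have "\<dots> \<le> \<eta> / (10/11 * norm v * norm v)"
    using k n v eta_pos by (intro frac_le mult_right_mono mult_pos_pos) auto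
  finally show ?thesis by (simp add: power2_eq_square)
qed

lemma S_approx:
  assumes "norm v \<ge> 1/10"
  shows "norm (S v - (v + 1 / v)) \<le> 11/10 * \<eta> / (norm v)\<^sup>2"
proof -
  have "norm ((\<Sum>j\<in>J. w j * (1 / (v - kap j))) - (\<Sum>j\<in>J. w j * (1 / v))) \<le> 11/10 * \<eta> / (norm v)\<^sup>2"
    by (rule norm_weighted_le) (rule norm_inverse_diff_le[OF assms])
  then show ?thesis unfolding weighted_const by (simp add: S_def)
qed

lemma S_near_i: "norm (S \<i>) \<le> 11/10 * \<eta>"
  using S_approx[of \<i>] by simp

text \<open>Newton's iteration with the derivative frozen at 2: the map contracts with factor 1/20
  and moves \<open>\<i>\<close> by at most \<open>21/20 * \<eta>\<close>, so it preserves the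
  disk.\<close>

lemma sp_ex1:
  assumes "norm \<zeta> \<le> \<eta>"
  shows "\<exists>!v. v \<in> cball \<i> (1/50) \<and> S v = \<zeta>"
proof -
  let ?T = "\<lambda>v. v - (S v - \<zeta>) / 2"
  have lip: "dist (?T x) (?T y) \<le> 1/20 * dist x y"
    if "x \<in> cball \<i> (1/50)" "y \<in> cball \<i> (1/50)" for x y
  proof -
    have "?T x - ?T y = - ((S x - 2 * x) - (S y - 2 * y)) / 2" by (simp add: field_simps)
    then have "dist (?T x) (?T y) = norm ((S x - 2 * x) - (S y - 2 * y)) / 2"
      unfolding dist_norm by (simp only: norm_divide norm_minus_cancel) simp
    then show ?thesis using S_lipschitz[OF that] by (simp add: dist_norm)
  qed
  have "\<exists>!v\<in>cball \<i> (1/50). ?T v = v"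
  proof (rule Banach_fix[where c = "1/20"])
    show "?T ` cball \<i> (1/50) \<subseteq> cball \<i> (1/50)"
    proof safe
      fix x assume x: "x \<in> cball \<i> (1/50)"
      have "dist (?T x) \<i> \<le> dist (?T x) (?T \<i>) + dist (?T \<i>) \<i>" by (rule dist_triangle)
      moreover have "dist (?T x) (?T \<i>) \<le> 1/20 * (1/50)"
        using lip[OF x, of \<i>] x by (simp add: dist_commute)
      moreover have "dist (?T \<i>) \<i> \<le> 21/20 * \<eta>"
        using norm_triangle_ineq4[of "S \<i>" \<zeta>] S_near_i assms
        by (simp add: dist_norm norm_divide norm_minus_commute)
      ultimately show "?T x \<in> cball \<i> (1/50)" using eta_small
        by (simp add: dist_commute)
    qed
  qed (use lip in \<open>auto simp: complete_eq_closed\<close>)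
  moreover have "?T v = v \<longleftrightarrow> S v = \<zeta>" for v by auto
  ultimately show ?thesis by (simp only: )
qed

lemma sp:
  assumes "norm \<zeta> \<le> \<eta>"
  shows "sp \<zeta> \<in> cball \<i> (1/50)" "S (sp \<zeta>) = \<zeta>"
  using theI'[OF sp_ex1[OF assms]] by (auto simp: sp_def)

lemma sp_unique:
  assumes "norm \<zeta> \<le> \<eta>" "v \<in> cball \<i> (1/50)" "S v = \<zeta>"
  shows "v = sp \<zeta>"
  using sp_ex1[OF assms(1)] sp[OF assms(1)] assms by blast

text \<open>Since \<open>S\<close> is 2 times the identity up to slope 1/10, the residual
  \<open>\<zeta> - S \<i>\<close>, at most \<open>21/10 * \<eta>\<close> in modulus, is divided by
  19/10.\<close>

lemma sp_close:
  assumes "norm \<zeta> \<le> \<eta>"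
  shows "norm (sp \<zeta> - \<i>) \<le> 2 * \<eta>"
proof -
  have "norm ((S (sp \<zeta>) - 2 * sp \<zeta>) - (S \<i> - 2 * \<i>)) \<le> 1/10 * norm (sp \<zeta> - \<i>)"
    using sp[OF assms] by (intro S_lipschitz) auto
  moreover have "norm (2 * (sp \<zeta> - \<i>)) \<le>
      norm ((S (sp \<zeta>) - 2 * sp \<zeta>) - (S \<i> - 2 * \<i>)) + norm (\<zeta> - S \<i>)"
    using norm_triangle_ineq4[of "\<zeta> - S \<i>" "(S (sp \<zeta>) - 2 * sp \<zeta>) - (S \<i> - 2 * \<i>)"] sp(2)[OF assms]
    by (simp add: algebra_simps)
  moreover have "norm (\<zeta> - S \<i>) \<le> 21/10 * \<eta>"
    using norm_triangle_ineq4[of \<zeta> "S \<i>"] S_near_i assms by linarith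
  moreover have "norm (2 * (sp \<zeta> - \<i>)) = 2 * norm (sp \<zeta> - \<i>)" by (simp only: norm_mult norm_numeral)
  ultimately show ?thesis using eta_pos by linarith
qed

lemma S_inj: "inj_on S (cball \<i> (1/50))"
proof (rule inj_onI)
  fix x y assume h: "x \<in> cball \<i> (1/50)" "y \<in> cball \<i> (1/50)" "S x = S y"
  have "(S x - 2 * x) - (S y - 2 * y) = - (2 * (x - y))" using h(3) by (simp add: algebra_simps)
  then have "norm ((S x - 2 * x) - (S y - 2 * y)) = 2 * norm (x - y)"
    by (simp only: norm_minus_cancel norm_mult norm_numeral)
  then show "x = y" using S_lipschitz[OF h(1,2)] by simp
qed

text \<open>The saddle point is the inverse of the injective holomorphic map \<open>S\<close>;
  \<open>sp_close\<close> keeps it in the interior of the disk of injectivity.\<close>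

lemma sp_holomorphic: "sp holomorphic_on ball 0 \<eta>"
proof -
  let ?B = "ball \<i> (1/50)"
  have "S holomorphic_on ?B"
    unfolding holomorphic_on_open[OF open_ball]
  proof safe
    fix v assume "v \<in> ?B"
    then have "v \<in> cball \<i> (1/50)" by auto
    then have "v \<noteq> kap j" if "j \<in> J" for j using near_i(3)[of v j] that by auto
    from S_deriv[OF this] show "\<exists>f'. (S has_field_derivative f') (at v)" by blast
  qed
  moreover have "inj_on S ?B" by (rule inj_on_subset[OF S_inj]) auto
  ultimately obtain g where g: "g holomorphic_on S ` ?B" "\<And>z. z \<in> ?B \<Longrightarrow> g (S z) = z"
    by (rule holomorphic_has_inverse[OF _ open_ball]) blast
  have *: "sp z \<in> ?B" "S (sp z) = z" if "z \<in> ball 0 \<eta>" for z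
    using sp_close[of z] sp(2)[of z] eta_small that by (auto simp: dist_norm norm_minus_commute)
  have "g holomorphic_on ball 0 \<eta>"
  proof (rule holomorphic_on_subset[OF g(1)], rule subsetI)
    fix z :: complex assume "z \<in> ball 0 \<eta>"
    from *[OF this] show "z \<in> S ` ?B" by (intro image_eqI[of z S "sp z"]) simp_all
  qed
  moreover have "g z = sp z" if "z \<in> ball 0 \<eta>" for z
    using *[OF that] g(2)[of "sp z"] by simp
  ultimately show ?thesis by (rule holomorphic_transform)
qed

lemma sum_Ln_deriv:
  assumes "v \<in> cball \<i> (1/50)"
  shows "((\<lambda>v. \<Sum>j\<in>J. w j * Ln (v - kap j)) has_field_derivative
    (\<Sum>j\<in>J. w j * (1 / (v - kap j)))) (at v)"
proof (rule DERIV_sum)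
  fix j assume "j \<in> J"
  then have "v - kap j \<notin> \<real>\<^sub>\<le>\<^sub>0" by (rule near_i(2)[OF assms])
  from has_field_derivative_Ln[OF this]
  have "((\<lambda>v. Ln (v - kap j)) has_field_derivative (1 / (v - kap j))) (at v)"
    using DERIV_shift[of Ln "inverse (v - kap j)" v "- kap j"] by (simp add: inverse_eq_divide)
  then show "((\<lambda>v. w j * Ln (v - kap j)) has_field_derivative (w j * (1 / (v - kap j)))) (at v)"
    by (rule DERIV_cmult)
qed

lemma f_deriv_v:
  assumes "v \<in> cball \<i> (1/50)"
  shows "(f \<zeta> has_field_derivative (S v - \<zeta>)) (at v)"
proof -
  note sum_Ln_deriv[OF assms]
  moreover have "((\<lambda>v. (\<zeta> - v)\<^sup>2 / 2) has_field_derivative (v - \<zeta>)) (at v)"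
  proof -
    have "((\<lambda>v. \<zeta> - v) has_field_derivative (0 - 1)) (at v)" by (rule DERIV_diff[OF DERIV_const DERIV_ident])
    from DERIV_cdivide[OF DERIV_power[OF this, of 2], of 2] show ?thesis by (simp add: diff_divide_distrib)
  qed
  ultimately have "((\<lambda>v. (\<Sum>j\<in>J. w j * Ln (v - kap j)) + (\<zeta> - v)\<^sup>2 / 2) has_field_derivative
      (\<Sum>j\<in>J. w j * (1 / (v - kap j))) + (v - \<zeta>)) (at v)" by (rule DERIV_add)
  moreover have "f \<zeta> = (\<lambda>v. (\<Sum>j\<in>J. w j * Ln (v - kap j)) + (\<zeta> - v)\<^sup>2 / 2)"
    by (simp add: f_def fun_eq_iff)
  moreover have "(\<Sum>j\<in>J. w j * (1 / (v - kap j))) + (v - \<zeta>) = S v - \<zeta>" by (simp add: S_def)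
  ultimately show ?thesis by (simp only:)
qed

text \<open>Because \<open>f\<close> is stationary in \<open>v\<close> at the saddle point, the
  motion of the saddle point does not contribute; only the explicit dependence on
  \<open>\<zeta>\<close> is left.\<close>

lemma F_deriv:
  assumes "norm \<zeta> < \<eta>"
  shows "(F has_field_derivative (\<zeta> - sp \<zeta>)) (at \<zeta>)"
proof -
  let ?L = "\<lambda>v. \<Sum>j\<in>J. w j * Ln (v - kap j)"
  have z: "\<zeta> \<in> ball 0 \<eta>" using assms by simp
  note s = sp[OF less_imp_le[OF assms]]
  obtain s' where s': "(sp has_field_derivative s') (at \<zeta>)"
    using sp_holomorphic z unfolding holomorphic_on_open[OF open_ball] by blast
  note L = DERIV_chain2[OF sum_Ln_deriv[OF s(1)] s']
  have "((\<lambda>\<zeta>. (\<zeta> - sp \<zeta>)\<^sup>2 / 2) has_field_derivative ((\<zeta> - sp \<zeta>) * (1 - s'))) (at \<zeta>)"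
    using DERIV_cdivide[OF DERIV_power[OF DERIV_diff[OF DERIV_ident s'], of 2], of 2] by (simp add: mult.commute)
  from DERIV_add[OF L this]
  have "((\<lambda>\<zeta>. ?L (sp \<zeta>) + (\<zeta> - sp \<zeta>)\<^sup>2 / 2) has_field_derivative
      ((\<Sum>j\<in>J. w j * (1 / (sp \<zeta> - kap j))) * s' + (\<zeta> - sp \<zeta>) * (1 - s'))) (at \<zeta>)" .
  moreover have "(\<Sum>j\<in>J. w j * (1 / (sp \<zeta> - kap j))) = \<zeta> - sp \<zeta>"
    using s(2) unfolding S_def by (simp add: eq_diff_eq add.commute)
  moreover have "(\<zeta> - sp \<zeta>) * s' + (\<zeta> - sp \<zeta>) * (1 - s') = \<zeta> - sp \<zeta>" by (simp add: right_diff_distrib)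
  moreover have "F = (\<lambda>\<zeta>. ?L (sp \<zeta>) + (\<zeta> - sp \<zeta>)\<^sup>2 / 2)" by (simp add: F_def f_def fun_eq_iff)
  ultimately show ?thesis by (simp only:)
qed


section \<open>Comparison of the real phases at all critical points\<close>

definition ph :: "complex \<Rightarrow> complex \<Rightarrow> real" where
  "ph \<zeta> v = (\<Sum>j\<in>J. w j * ln (norm (v - kap j))) + Re ((\<zeta> - v)\<^sup>2) / 2"

lemma Re_f:
  assumes "\<And>j. j \<in> J \<Longrightarrow> v \<noteq> kap j"
  shows "Re (f \<zeta> v) = ph \<zeta> v"
proof -
  have "Re (f \<zeta> v) = (\<Sum>j\<in>J. w j * Re (Ln (v - kap j))) + Re ((\<zeta> - v)\<^sup>2) / 2"
    by (simp add: f_def)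
  also have "(\<Sum>j\<in>J. w j * Re (Ln (v - kap j))) = (\<Sum>j\<in>J. w j * ln (norm (v - kap j)))"
    using assms by (intro sum.cong) auto
  finally show ?thesis by (simp add: ph_def)
qed

lemma Re_F: "norm \<zeta> \<le> \<eta> \<Longrightarrow> Re (F \<zeta>) = ph \<zeta> (sp \<zeta>)"
  unfolding F_def using near_i(3)[OF sp(1)] by (intro Re_f) auto

lemma weighted_mono:
  fixes g h :: "'j \<Rightarrow> real"
  assumes "\<And>j. j \<in> J \<Longrightarrow> g j \<le> C"
  shows "(\<Sum>j\<in>J. w j * g j) \<le> C"
proof -
  have "(\<Sum>j\<in>J. w j * g j) \<le> (\<Sum>j\<in>J. w j * C)"
    using assms w_nonneg by (intro sum_mono mult_left_mono) auto
  then show ?thesis by (simp add: sum_distrib_right[symmetric] sum_w)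
qed

text \<open>In the model case at \<open>\<zeta> = 0\<close> the critical value has real part
  \<open>Re ((- \<i>)\<^sup>2) / 2 = - 1/2\<close>. This is the level that contributions away from
  the saddle point have to stay below.\<close>

lemma Re_F_ge:
  assumes "norm \<zeta> \<le> \<eta>"
  shows "Re (F \<zeta>) \<ge> - 1/2 - 8 * \<eta>"
proof -
  let ?v = "sp \<zeta>"
  have v: "norm (?v - \<i>) \<le> 2 * \<eta>" by (rule sp_close[OF assms])
  have "- ln (norm (?v - kap j)) \<le> 4 * \<eta>" if j: "j \<in> J" for j
  proof -
    have "norm (?v - kap j) \<ge> norm \<i> - norm (?v - \<i>) - norm (kap j)"
      using norm_triangle_ineq2[of \<i> "\<i> - ?v"] norm_triangle_ineq2[of ?v "kap j"]
      by (simp add: norm_minus_commute)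
    then have n: "norm (?v - kap j) \<ge> 1 - 3 * \<eta>" using v kap_le[OF j] by simp
    have "- (3 * \<eta>) - 2 * (3 * \<eta>)\<^sup>2 \<le> ln (1 - 3 * \<eta>)"
      using eta_pos eta_small by (intro ln_one_minus_pos_lower_bound) auto
    also have "\<dots> \<le> ln (norm (?v - kap j))" using n eta_small by (subst ln_le_cancel_iff) auto
    finally have "- ln (norm (?v - kap j)) \<le> 3 * \<eta> + 18 * \<eta> * \<eta>" by (simp add: power2_eq_square)
    also have "18 * \<eta> * \<eta> \<le> 1 * \<eta>" using eta_pos eta_small by (intro mult_right_mono) auto
    finally show ?thesis by simp
  qed
  from weighted_mono[of "\<lambda>j. - ln (norm (?v - kap j))", OF this]
  have 1: "(\<Sum>j\<in>J. w j * ln (norm (?v - kap j))) \<ge> - 4 * \<eta>"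
    by (simp add: sum_negf)
  have "norm (\<zeta> - ?v) \<le> norm \<zeta> + norm (\<i> - ?v) + norm \<i>"
    using norm_triangle_ineq[of \<zeta> "(\<i> - ?v) - \<i>"] norm_triangle_ineq4[of "\<i> - ?v" \<i>] by simp
  then have n: "norm (\<zeta> - ?v) \<le> 1 + 3 * \<eta>" using v assms by (simp add: norm_minus_commute)
  have "- Re ((\<zeta> - ?v)\<^sup>2) \<le> norm ((\<zeta> - ?v)\<^sup>2)" using abs_Re_le_cmod[of "(\<zeta> - ?v)\<^sup>2"] by linarith
  also have "\<dots> \<le> (1 + 3 * \<eta>)\<^sup>2" unfolding norm_power using n by (intro power_mono) auto
  also have "\<dots> = 1 + 6 * \<eta> + 9 * \<eta> * \<eta>" by (simp add: power2_eq_square algebra_simps)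
  also have "9 * \<eta> * \<eta> \<le> 1 * \<eta>" using eta_pos eta_small by (intro mult_right_mono) auto
  finally show ?thesis using 1 eta_pos unfolding Re_F[OF assms] ph_def by simp
qed

text \<open>Both sources of error are quadratic. The derivative \<open>S\<close> of
  \<open>f 0\<close> is of size \<open>\<eta>\<close> between \<open>\<i>\<close> and
  \<open>sp 0\<close>, which are themselves \<open>2 * \<eta>\<close> close; and the linear terms in
  \<open>kap j\<close> of the logarithms cancel in the weighted sum by the assumption.\<close>

lemma F_0:
  assumes "(\<Sum>j\<in>J. w j * kap j) = 0"
  shows "norm (F 0 - (Ln \<i> - 1/2)) \<le> 14 * \<eta>\<^sup>2"
proof -
  have e50: "2 * \<eta> \<le> 1/50" using eta_small by simp
  have sub: "cball \<i> (2 * \<eta>) \<subseteq> cball \<i> (1/50)" using e50 by (simp add: subset_cball)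
  have "norm (f 0 (sp 0) - f 0 \<i>) \<le> (6 * \<eta>) * norm (sp 0 - \<i>)"
  proof (rule field_differentiable_bound[of "cball \<i> (2 * \<eta>)" _ S])
    fix z assume z: "z \<in> cball \<i> (2 * \<eta>)"
    with sub have z': "z \<in> cball \<i> (1/50)" by blast
    show "(f 0 has_field_derivative S z) (at z within cball \<i> (2 * \<eta>))"
      using f_deriv_v[OF z', of 0] has_field_derivative_at_within by (metis diff_zero)
    have zi: "norm (z - \<i>) \<le> 2 * \<eta>" using z by (simp add: dist_norm norm_minus_commute)
    have Sz: "((S z - 2 * z) - (S \<i> - 2 * \<i>)) + 2 * (z - \<i>) + S \<i> = S z" by (simp add: algebra_simps)
    have "norm (S z) \<le> norm ((S z - 2 * z) - (S \<i> - 2 * \<i>)) + norm (2 * (z - \<i>)) + norm (S \<i>)"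
      using norm_triangle_ineq[of "((S z - 2 * z) - (S \<i> - 2 * \<i>)) + 2 * (z - \<i>)" "S \<i>"]
        norm_triangle_ineq[of "(S z - 2 * z) - (S \<i> - 2 * \<i>)" "2 * (z - \<i>)"] unfolding Sz by linarith
    also have "norm (2 * (z - \<i>)) = 2 * norm (z - \<i>)" by (simp only: norm_mult norm_numeral)
    finally show "norm (S z) \<le> 6 * \<eta>"
      using S_lipschitz[OF z', of \<i>] S_near_i zi eta_pos by simp
  next
    show "sp 0 \<in> cball \<i> (2 * \<eta>)" using sp_close[of 0] eta_pos by (simp add: dist_norm norm_minus_commute)
    show "\<i> \<in> cball \<i> (2 * \<eta>)" using eta_pos by simp
  qed simp
  also have "\<dots> \<le> (6 * \<eta>) * (2 * \<eta>)" using sp_close[of 0] eta_pos by (intro mult_left_mono) auto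
  finally have 1: "norm (F 0 - f 0 \<i>) \<le> 12 * \<eta>\<^sup>2" by (simp add: F_def power2_eq_square)
  \<comment> \<open>The linear term of \<open>Ln (\<i> - kap j)\<close> is
    \<open>- kap j / \<i>\<close>; removing it leaves a quadratic error.\<close>
  have "norm ((Ln (\<i> - kap j) + kap j / \<i>) - Ln \<i>) \<le> 2 * \<eta>\<^sup>2" if j: "j \<in> J" for j
  proof -
    have "norm ((Ln (\<i> - kap j) + kap j / \<i>) - (Ln (\<i> - 0) + 0 / \<i>)) \<le> 2 * \<eta> * norm (kap j - 0)"
    proof (rule field_differentiable_bound[of "cball 0 \<eta>" "\<lambda>k. Ln (\<i> - k) + k / \<i>"
          "\<lambda>k. - (1 / (\<i> - k)) + 1 / \<i>"])
      fix k :: complex assume "k \<in> cball 0 \<eta>"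
      then have k: "norm k \<le> \<eta>" by simp
      have "Im k < 1" using abs_Im_le_cmod[of k] k eta_small by linarith
      then have im: "\<i> - k \<notin> \<real>\<^sub>\<le>\<^sub>0" "\<i> - k \<noteq> 0" by (auto simp: complex_nonpos_Reals_iff complex_eq_iff)
      have D: "((\<lambda>k. \<i> - k) has_field_derivative (0 - 1)) (at k)" by (rule DERIV_diff[OF DERIV_const DERIV_ident])
      have "((\<lambda>k. Ln (\<i> - k)) has_field_derivative (- (1 / (\<i> - k)))) (at k)"
        using DERIV_chain2[OF has_field_derivative_Ln[OF im(1)] D] by (simp add: inverse_eq_divide)
      then show "((\<lambda>k. Ln (\<i> - k) + k / \<i>) has_field_derivative (- (1 / (\<i> - k)) + 1 / \<i>)) (at k within cball 0 \<eta>)"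
        by (rule has_field_derivative_at_within[OF DERIV_add[OF _ DERIV_cdivide[OF DERIV_ident]]])
      have "- (1 / (\<i> - k)) + 1 / \<i> = - k / ((\<i> - k) * \<i>)" 
      proof -
        have "- (1 / y) + 1 / x = - (x - y) / (y * x)" if "x \<noteq> 0" "y \<noteq> 0" for x y :: complex
          using that by (simp add: field_simps)
        from this[of \<i> "\<i> - k"] im show ?thesis by simp
      qed
      also have "norm \<dots> = norm k / norm (\<i> - k)" by (simp add: norm_divide norm_mult)
      also have "\<dots> \<le> \<eta> / (1/2)"
        using norm_triangle_ineq2[of \<i> k] k eta_small eta_pos by (intro frac_le) auto
      finally show "norm (- (1 / (\<i> - k)) + 1 / \<i>) \<le> 2 * \<eta>" by simp
    qed (use kap_le[OF j] eta_pos in auto)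
    also have "\<dots> \<le> 2 * \<eta> * \<eta>" using kap_le[OF j] eta_pos by (intro mult_left_mono) auto
    finally show ?thesis by (simp add: power2_eq_square)
  qed
  from norm_weighted_le[OF this]
  have "norm ((\<Sum>j\<in>J. w j * (Ln (\<i> - kap j) + kap j / \<i>)) - Ln \<i>) \<le> 2 * \<eta>\<^sup>2"
    by (simp only: weighted_const)
  also have "(\<Sum>j\<in>J. w j * (Ln (\<i> - kap j) + kap j / \<i>)) =
      (\<Sum>j\<in>J. w j * Ln (\<i> - kap j)) + (\<Sum>j\<in>J. w j * kap j) / \<i>"
    unfolding distrib_left sum.distrib sum_divide_distrib times_divide_eq_right by (rule refl)
  also have "\<dots> = f 0 \<i> + 1/2" by (simp add: assms f_def)
  finally have "norm (f 0 \<i> - (Ln \<i> - 1/2)) \<le> 2 * \<eta>\<^sup>2" by (simp add: algebra_simps)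
  from norm_triangle_mono[OF 1 this] show ?thesis
    unfolding diff_add_eq_diff_diff_swap add_diff_eq diff_add_cancel by simp
qed

text \<open>Near the origin the logarithms are at most \<open>- ln 5\<close>, hence at most -1,
  while the square adds at most 1/50; the sum stays under the level -1/2 of the main critical value.
  So critical points close to the \<open>kap j\<close> never attain the maximum.\<close>

lemma ph_small:
  assumes "norm v < 1/10" "norm \<zeta> \<le> \<eta>" "\<And>j. j \<in> J \<Longrightarrow> v \<noteq> kap j"
  shows "ph \<zeta> v < Re (F \<zeta>)"
proof -
  have "ln (norm (v - kap j)) \<le> - 1" if j: "j \<in> J" for j
  proof -
    have "norm (v - kap j) \<le> 1/5"
      using norm_triangle_ineq4[of v "kap j"] kap_le[OF j] assms(1) eta_small by simp
    moreover have "norm (v - kap j) > 0" using assms(3)[OF j] by simp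
    ultimately have "ln (norm (v - kap j)) \<le> ln (1/5)" by simp
    moreover have "ln (1/5 :: real) = - ln 5" by (simp add: ln_div)
    moreover have "exp 1 \<le> (5::real)" using exp_le by simp
    then have "1 \<le> ln (5::real)" by (simp add: ln_ge_iff)
    ultimately show ?thesis by linarith
  qed
  from weighted_mono[OF this] have 1: "(\<Sum>j\<in>J. w j * ln (norm (v - kap j))) \<le> - 1" by simp
  have "Re ((\<zeta> - v)\<^sup>2) \<le> norm ((\<zeta> - v)\<^sup>2)" by (rule complex_Re_le_cmod)
  also have "\<dots> \<le> (1/5)\<^sup>2" unfolding norm_power
    using norm_triangle_ineq4[of \<zeta> v] assms eta_small by (intro power_mono) auto
  finally have "Re ((\<zeta> - v)\<^sup>2) \<le> 1/25" by (simp add: power2_eq_square)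
  then show ?thesis using 1 Re_F_ge[OF assms(2)] eta_small unfolding ph_def by linarith
qed

text \<open>Multiplied by \<open>v\<close>, the equation reads
  \<open>(v - \<i>) * (v + \<i>) = \<zeta> * v\<close> up to a small error. A small product of two
  factors whose moduli add up to at least 2 forces one of them to be small.\<close>

lemma critical_points:
  assumes "S v = \<zeta>" "norm \<zeta> \<le> \<eta>"
  shows "v \<in> cball \<i> (1/50) \<or> - v \<in> cball \<i> (1/50) \<or> norm v < 1/10"
proof (cases "norm v < 1/10")
  case False
  then have v: "norm v \<ge> 1/10" "v \<noteq> 0" by auto
  have "norm (v + 1 / v - \<zeta>) \<le> 11/10 * \<eta> / (norm v)\<^sup>2"
    using S_approx[OF v(1)] assms(1) by (simp add: norm_minus_commute)
  then have "norm v * norm (v + 1 / v - \<zeta>) \<le> norm v * (11/10 * \<eta> / (norm v)\<^sup>2)"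
    by (intro mult_left_mono) auto
  also have "\<dots> = 11/10 * \<eta> / norm v" by (simp add: power2_eq_square)
  also have "\<dots> \<le> 11/10 * \<eta> / (1/10)" using v(1) eta_pos by (intro divide_left_mono) auto
  finally have "norm v * norm (v + 1 / v - \<zeta>) \<le> 11 * \<eta>" by simp
  moreover have "v * (v + 1 / v - \<zeta>) = (v - \<i>) * (v + \<i>) - \<zeta> * v"
    using v(2) by (simp add: field_simps)
  ultimately have "norm ((v - \<i>) * (v + \<i>) - \<zeta> * v) \<le> 11 * \<eta>" by (metis norm_mult)
  moreover have "norm (\<zeta> * v) \<le> \<eta> * norm v"
    using assms(2) by (simp add: norm_mult mult_right_mono)
  ultimately have p: "norm (v - \<i>) * norm (v + \<i>) \<le> 11 * \<eta> + \<eta> * norm v"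
    using norm_triangle_ineq2[of "(v - \<i>) * (v + \<i>)" "\<zeta> * v"] by (simp add: norm_mult)
  have l: "norm v - 1 \<le> norm (v - \<i>)" "norm v - 1 \<le> norm (v + \<i>)"
    using norm_triangle_ineq2[of v \<i>] norm_triangle_ineq2[of v "- \<i>"] by auto
  \<comment> \<open>A crude bound on \<open>v\<close> comes first because the error contains
    \<open>\<eta> * norm v\<close>.\<close>
  have v2: "norm v \<le> 2"
  proof (rule ccontr)
    assume n: "\<not> norm v \<le> 2"
    then have "1 * (norm v - 1) \<le> norm (v - \<i>) * norm (v + \<i>)"
      using l by (intro mult_mono) auto
    moreover have "\<eta> * norm v \<le> 1/10000000 * norm v" using eta_small by (intro mult_right_mono) auto
    ultimately show False using p n eta_small by simp
  qed
  then have "\<eta> * norm v \<le> \<eta> * 2" using eta_pos by (intro mult_left_mono) auto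
  then have q: "norm (v - \<i>) * norm (v + \<i>) \<le> 1/50" using p eta_small by simp
  have "norm (v - \<i>) + norm (v + \<i>) \<ge> 2"
    using norm_triangle_ineq4[of "v + \<i>" "v - \<i>"] by (simp add: norm_mult)
  then consider "norm (v - \<i>) \<ge> 1" | "norm (v + \<i>) \<ge> 1" by linarith
  then show ?thesis
  proof cases
    case 1
    then have "1 * norm (v + \<i>) \<le> norm (v - \<i>) * norm (v + \<i>)" by (intro mult_right_mono) auto
    then have "norm (v + \<i>) \<le> 1/50" using q by linarith
    moreover have "dist \<i> (- v) = norm (v + \<i>)" by (simp add: dist_norm add.commute)
    ultimately show ?thesis by simp
  next
    case 2
    then have "norm (v - \<i>) * 1 \<le> norm (v - \<i>) * norm (v + \<i>)" by (intro mult_left_mono) auto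
    then have "norm (v - \<i>) \<le> 1/50" using q by linarith
    then show ?thesis by (simp add: dist_norm norm_minus_commute)
  qed
qed auto

lemma reflect: "saddle J a (\<lambda>j. - kap j) \<eta>"
  by unfold_locales (use finJ apos eta_pos eta_small kap_le in auto)

abbreviation "G1 \<zeta> \<equiv> Re (F \<zeta>)"
abbreviation "G2 \<zeta> \<equiv> Re (saddle.F J a (\<lambda>j. - kap j) (- \<zeta>))"

text \<open>The reflection preserves \<open>ph\<close> and turns critical points near
  \<open>- \<i>\<close> into critical points near \<open>\<i>\<close> of the reflected data.
  Uniqueness identifies every critical point near \<open>\<plusminus>\<i>\<close> with one of the
  two main ones; all others lie near the origin.\<close>

lemma Max_ph:
  assumes "norm \<zeta> \<le> \<eta>"
    and fin: "finite X" and X: "X = {v. (\<forall>j\<in>J. v \<noteq> kap j) \<and> S v = \<zeta>}"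
  shows "Max (ph \<zeta> ` X) = max (G1 \<zeta>) (G2 \<zeta>)"
proof -
  interpret R: saddle J a "\<lambda>j. - kap j" \<eta> by (rule reflect)
  have RS: "R.S (- v) = - S v" for v
  proof -
    have "- v + kap j = - (v - kap j)" for j by simp
    then have "w j / (- v + kap j) = - (w j / (v - kap j))" for j by (simp only: minus_divide_right)
    then show ?thesis by (simp add: R.S_def S_def sum_negf)
  qed
  have Rph: "R.ph (- \<zeta>) (- v) = ph \<zeta> v" for v
  proof -
    have "- v - - kap j = - (v - kap j)" for j by simp
    then have "norm (- v - - kap j) = norm (v - kap j)" for j by (simp only: norm_minus_cancel)
    moreover have "(- \<zeta> - - v)\<^sup>2 = (\<zeta> - v)\<^sup>2" by (simp add: power2_eq_square algebra_simps)
    ultimately show ?thesis unfolding R.ph_def ph_def by (simp only:)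
  qed
  have z: "norm (- \<zeta>) \<le> \<eta>" using assms by simp
  have 1: "sp \<zeta> \<in> X" "ph \<zeta> (sp \<zeta>) = G1 \<zeta>"
    using near_i(3)[OF sp(1)] sp(2) assms(1) Re_F[OF assms(1)] unfolding X by auto
  have 2: "- R.sp (- \<zeta>) \<in> X"
  proof -
    have "- R.sp (- \<zeta>) \<noteq> kap j" if "j \<in> J" for j
      using R.near_i(3)[OF R.sp(1)[OF z] that] by (metis diff_self minus_minus)
    moreover have "S (- R.sp (- \<zeta>)) = \<zeta>"
      using R.sp(2)[OF z] RS[of "- R.sp (- \<zeta>)"] by (metis minus_minus)
    ultimately show ?thesis unfolding X by blast
  qed
  have 3: "ph \<zeta> (- R.sp (- \<zeta>)) = G2 \<zeta>"
    using Rph[of "- R.sp (- \<zeta>)"] R.Re_F[OF z] by simp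
  have "ph \<zeta> v \<le> max (G1 \<zeta>) (G2 \<zeta>)" if "v \<in> X" for v
  proof -
    have v: "\<And>j. j \<in> J \<Longrightarrow> v \<noteq> kap j" "S v = \<zeta>" using that X by auto
    from critical_points[OF v(2) assms(1)] show ?thesis
    proof (elim disjE)
      assume "v \<in> cball \<i> (1/50)"
      then have "v = sp \<zeta>" using sp_unique[OF assms(1)] v by blast
      then show ?thesis using 1 by simp
    next
      assume "- v \<in> cball \<i> (1/50)"
      then have "- v = R.sp (- \<zeta>)" using R.sp_unique[OF z] RS[of v] v by simp
      then have "v = - R.sp (- \<zeta>)" by (metis minus_minus)
      then show ?thesis using 3 by simp
    next
      assume "norm v < 1/10"
      from ph_small[OF this assms(1) v(1)] show ?thesis by simp
    qed
  qed
  then have "Max (ph \<zeta> ` X) \<le> max (G1 \<zeta>) (G2 \<zeta>)"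
    using 1(1) fin by (intro Max.boundedI) auto
  moreover have "ph \<zeta> (sp \<zeta>) \<le> Max (ph \<zeta> ` X)" using 1(1) fin by (intro Max_ge) auto
  moreover have "ph \<zeta> (- R.sp (- \<zeta>)) \<le> Max (ph \<zeta> ` X)" using 2 fin by (intro Max_ge) auto
  ultimately show ?thesis unfolding 1(2) 3 by simp
qed

end

section \<open>Laplace's method on a half line\<close>

lemma gaussian_integral:
  fixes c m :: real
  assumes "c > 0"
  shows "integrable lborel (\<lambda>y. exp (- (c * (y - m)\<^sup>2)))"
    and "(LINT y|lborel. exp (- (c * (y - m)\<^sup>2))) = sqrt (pi / c)"
proof -
  have s: "(1 / sqrt (2 * c))\<^sup>2 = 1 / (2 * c)" using assms by (simp add: power_divide)
  have eq: "(\<lambda>y. exp (- (c * (y - m)\<^sup>2))) = (\<lambda>y. sqrt (pi / c) * normal_density m (1 / sqrt (2 * c)) y)"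
  proof
    fix y
    have "2 * pi * (1 / (2 * c)) = pi / c" "- (y - m)\<^sup>2 / (2 * (1 / (2 * c))) = - (c * (y - m)\<^sup>2)"
      using assms by (simp_all add: field_simps)
    then show "exp (- (c * (y - m)\<^sup>2)) = sqrt (pi / c) * normal_density m (1 / sqrt (2 * c)) y"
      unfolding normal_density_def s using assms by simp
  qed
  show "integrable lborel (\<lambda>y. exp (- (c * (y - m)\<^sup>2)))"
    unfolding eq using assms by simp
  show "(LINT y|lborel. exp (- (c * (y - m)\<^sup>2))) = sqrt (pi / c)"
    unfolding eq using assms by simp
qed

text \<open>On the convex half plane \<open>Re z \<le> B\<close> the derivative of
  \<open>exp\<close> has modulus at most \<open>exp B\<close>.\<close>

lemma norm_exp_diff_le:
  fixes x y :: complex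
  assumes "Re x \<le> B" "Re y \<le> B"
  shows "norm (exp x - exp y) \<le> exp B * norm (x - y)"
proof (rule field_differentiable_bound[of "{z. Re z \<le> B}" exp exp])
  show "convex {z. Re z \<le> B}" by (rule convex_halfspace_Re_le)
  fix z :: complex
  show "(exp has_field_derivative exp z) (at z within {z. Re z \<le> B})"
    by (rule has_field_derivative_at_within[OF DERIV_exp])
  assume "z \<in> {z. Re z \<le> B}"
  then show "norm (exp z) \<le> exp B" by simp
qed (use assms in auto)

context saddle
begin

definition N :: "nat \<Rightarrow> real" where "N n = real (n * (\<Sum>j\<in>J. a j))"

text \<open>Integer powers make the integrand entire, so contours move without any choice of branch;
  the logarithms in \<open>f\<close> enter only near the saddle point.\<close>

definition E :: "nat \<Rightarrow> complex \<Rightarrow> complex \<Rightarrow> complex" where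
  "E n \<zeta> v = (\<Prod>j\<in>J. (v - kap j) ^ (n * a j)) * exp (complex_of_real (N n) * (\<zeta> - v)\<^sup>2 / 2)"

definition half_int :: "nat \<Rightarrow> complex \<Rightarrow> real \<Rightarrow> complex" where
  "half_int n \<zeta> x = (LINT y:{0..}|lborel. E n \<zeta> (Complex x y))"

lemma N_w: "N n * w j = real (n * a j)"
proof -
  have "real (\<Sum>j\<in>J. a j) \<noteq> 0" using apos by (simp del: of_nat_sum)
  then show ?thesis by (simp add: N_def w_def del: of_nat_sum)
qed

lemma sum_na: "(\<Sum>j\<in>J. n * a j) = n * (\<Sum>j\<in>J. a j)"
  by (simp add: sum_distrib_left)

lemma N_ge: "N n \<ge> real n"
proof -
  have "n * 1 \<le> n * (\<Sum>j\<in>J. a j)" using apos by (intro mult_left_mono) auto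
  then show ?thesis unfolding N_def by (simp del: of_nat_sum of_nat_mult)
qed

lemma E_holomorphic: "E n \<zeta> holomorphic_on A"
  unfolding E_def[abs_def] by (intro holomorphic_intros) auto

lemma continuous_E_line: "continuous_on A (\<lambda>y. E n \<zeta> (Complex x y))"
proof -
  have "continuous_on UNIV (E n \<zeta>)" by (rule holomorphic_on_imp_continuous_on[OF E_holomorphic])
  then show ?thesis
    by (rule continuous_on_compose2) (auto simp: Complex_eq intro!: continuous_intros)
qed

text \<open>By \<open>ln y \<le> y - 1\<close> the model exponent
  \<open>ln y - y\<^sup>2 / 2\<close> is at most \<open>- 1/2 - (y - 1)\<^sup>2 / 2\<close>. Half of
  the square is given up to absorb errors of size \<open>\<eta> * y\<close>.\<close>

abbreviation tail :: "nat \<Rightarrow> real \<Rightarrow> real" where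
  "tail n y \<equiv> exp (N n * (- 1/2 - (y - 1)\<^sup>2 / 4 + 5 * \<eta>))"

lemma E_bound:
  assumes "\<bar>x\<bar> \<le> 2 * \<eta>" "y \<ge> 0" "norm \<zeta> \<le> \<eta>"
  shows "norm (E n \<zeta> (Complex x y)) \<le> tail n y"
proof -
  let ?v = "Complex x y" and ?b = "y + 3 * \<eta> - 1"
  have nv: "norm (?v - kap j) \<le> exp ?b" if "j \<in> J" for j
  proof -
    have "norm (?v - kap j) \<le> norm ?v + norm (kap j)" by (rule norm_triangle_ineq4)
    also have "norm ?v \<le> \<bar>x\<bar> + \<bar>y\<bar>" using cmod_le[of ?v] by simp
    also have "\<bar>x\<bar> + \<bar>y\<bar> + norm (kap j) \<le> 1 + ?b" using assms kap_le[OF that] by simp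
    also have "1 + ?b \<le> exp ?b" by (rule exp_ge_add_one_self)
    finally show ?thesis by simp
  qed
  have "norm (\<Prod>j\<in>J. (?v - kap j) ^ (n * a j)) = (\<Prod>j\<in>J. norm (?v - kap j) ^ (n * a j))"
    by (simp add: prod_norm norm_power flip: prod_norm)
  also have "\<dots> \<le> (\<Prod>j\<in>J. exp ?b ^ (n * a j))"
    using nv by (intro prod_mono) (auto intro: power_mono)
  also have "\<dots> = exp ?b ^ (n * (\<Sum>j\<in>J. a j))" unfolding sum_na[symmetric] by (rule power_sum[symmetric])
  also have "\<dots> = exp (N n * ?b)" unfolding N_def by (rule exp_of_nat_mult[symmetric])
  finally have 1: "norm (\<Prod>j\<in>J. (?v - kap j) ^ (n * a j)) \<le> exp (N n * ?b)" .
  have re: "Re ((\<zeta> - ?v)\<^sup>2) = (Re \<zeta> - x)\<^sup>2 - (Im \<zeta> - y)\<^sup>2" by (simp add: power2_eq_square)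
  have z: "\<bar>Re \<zeta>\<bar> \<le> \<eta>" "\<bar>Im \<zeta>\<bar> \<le> \<eta>"
    using abs_Re_le_cmod[of \<zeta>] abs_Im_le_cmod[of \<zeta>] assms by linarith+
  have "\<bar>Re \<zeta> - x\<bar> \<le> 3 * \<eta>" using z assms by linarith
  then have "(Re \<zeta> - x)\<^sup>2 \<le> (3 * \<eta>)\<^sup>2" using eta_pos by (metis abs_ge_zero power2_abs power_mono)
  also have "\<dots> = 9 * \<eta> * \<eta>" by (simp add: power2_eq_square)
  also have "\<dots> \<le> 1/10 * \<eta>" using eta_pos eta_small by (intro mult_right_mono) auto
  finally have A: "(Re \<zeta> - x)\<^sup>2 \<le> 1/10 * \<eta>" .
  have "Im \<zeta> * y \<le> \<eta> * y" using z assms by (intro mult_right_mono) auto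
  then have B: "(Im \<zeta> - y)\<^sup>2 \<ge> y\<^sup>2 - 2 * \<eta> * y"
    using zero_le_power2[of "Im \<zeta>"] power2_diff[of "Im \<zeta>" y] by linarith
  \<comment> \<open>This is \<open>(y - 2)\<^sup>2 \<ge> 0\<close>; it converts the linear growth
    \<open>\<eta> * y\<close> into a multiple of \<open>(y - 1)\<^sup>2\<close>.\<close>
  have "y \<le> 3/2 + (y - 1)\<^sup>2 / 2" using zero_le_power2[of "y - 2"] by (simp add: power2_eq_square field_simps)
  then have "\<eta> * y \<le> \<eta> * (3/2 + (y - 1)\<^sup>2 / 2)" using eta_pos by (intro mult_left_mono) auto
  moreover have "\<eta> * (y - 1)\<^sup>2 \<le> 1/2 * (y - 1)\<^sup>2" using eta_small by (intro mult_right_mono) auto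
  ultimately have C: "\<eta> * y \<le> 3/2 * \<eta> + (y - 1)\<^sup>2 / 4" by (simp add: algebra_simps)
  have "?b + Re ((\<zeta> - ?v)\<^sup>2) / 2 \<le> y + 3 * \<eta> - 1 + (1/10 * \<eta> - (y\<^sup>2 - 2 * \<eta> * y)) / 2"
    using A B unfolding re by (simp add: field_simps)
  also have "\<dots> = - 1/2 - (y - 1)\<^sup>2 / 2 + 3 * \<eta> + \<eta> / 20 + \<eta> * y"
    by (simp add: power2_eq_square field_simps)
  also have "\<dots> \<le> - 1/2 - (y - 1)\<^sup>2 / 4 + 5 * \<eta>" using C eta_pos by (simp add: field_simps)
  finally have ex: "?b + Re ((\<zeta> - ?v)\<^sup>2) / 2 \<le> - 1/2 - (y - 1)\<^sup>2 / 4 + 5 * \<eta>" .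
  have "norm (E n \<zeta> ?v) = norm (\<Prod>j\<in>J. (?v - kap j) ^ (n * a j)) * exp (N n * (Re ((\<zeta> - ?v)\<^sup>2) / 2))"
    unfolding E_def norm_mult norm_exp_eq_Re by simp
  also have "\<dots> \<le> exp (N n * ?b) * exp (N n * (Re ((\<zeta> - ?v)\<^sup>2) / 2))"
    using 1 by (intro mult_right_mono) auto
  also have "\<dots> = exp (N n * (?b + Re ((\<zeta> - ?v)\<^sup>2) / 2))" by (simp add: exp_add[symmetric] algebra_simps)
  also have "\<dots> \<le> tail n y"
    using mult_left_mono[OF ex, of "N n"] N_ge[of n] by simp
  finally show ?thesis .
qed

lemma E_integrable:
  assumes "\<bar>x\<bar> \<le> 2 * \<eta>" "norm \<zeta> \<le> \<eta>" "n > 0" "A \<in> sets borel" "A \<subseteq> {0..}"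
  shows "set_integrable lborel A (\<lambda>y. E n \<zeta> (Complex x y))"
proof -
  have Np: "N n > 0" using N_ge[of n] assms by linarith
  have "integrable lborel (\<lambda>y. exp (- (N n / 4 * (y - 1)\<^sup>2)))"
    using gaussian_integral(1)[of "N n / 4" 1] Np by simp
  then have "integrable lborel (\<lambda>y. exp (N n * (- 1/2 + 5 * \<eta>)) * exp (- (N n / 4 * (y - 1)\<^sup>2)))"
    by (rule integrable_mult_right)
  moreover have "exp (N n * (- 1/2 + 5 * \<eta>)) * exp (- (N n / 4 * (y - 1)\<^sup>2)) =
      tail n y" for y
    by (simp add: exp_add[symmetric] algebra_simps)
  ultimately have int: "integrable lborel (\<lambda>y. tail n y)"
    by (simp only:)
  have meas: "(\<lambda>y. E n \<zeta> (Complex x y)) \<in> borel_measurable borel"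
    by (rule borel_measurable_continuous_onI[OF continuous_E_line])
  show ?thesis unfolding set_integrable_def
  proof (rule Bochner_Integration.integrable_bound[OF int])
    show "(\<lambda>y. indicat_real A y *\<^sub>R E n \<zeta> (Complex x y)) \<in> borel_measurable lborel"
      using meas assms(4) by measurable
    show "AE y in lborel. norm (indicat_real A y *\<^sub>R E n \<zeta> (Complex x y)) \<le>
        norm (tail n y)"
      using E_bound[OF assms(1) _ assms(2), of _ n] assms(5) by (auto simp: indicator_def)
  qed
qed

text \<open>A primitive of the integrand has the same limit at \<open>\<i>\<infinity>\<close> along both lines, so the integrals differ by
  one over a horizontal segment on the real axis, where the integrand is exponentially small.\<close>

lemma half_int_shift:
  assumes x: "\<bar>x\<bar> \<le> 2 * \<eta>" and x': "\<bar>x'\<bar> \<le> 2 * \<eta>" and z: "norm \<zeta> \<le> \<eta>" and n: "n > 0"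
  shows "norm (half_int n \<zeta> x - half_int n \<zeta> x') \<le> exp (N n * (- 3/4 + 5 * \<eta>)) * \<bar>x - x'\<bar>"
proof -
  have Np: "N n > 0" using N_ge[of n] n by linarith
  obtain A where A: "\<And>v. (A has_field_derivative E n \<zeta> v) (at v)"
    using holomorphic_convex_primitive'[of UNIV "E n \<zeta>"] E_holomorphic by auto
  have bnd: "norm (A (Complex s b) - A (Complex s' b)) \<le> tail n b * \<bar>s - s'\<bar>"
    if "\<bar>s\<bar> \<le> 2 * \<eta>" "\<bar>s'\<bar> \<le> 2 * \<eta>" "b \<ge> 0" for s s' b
  proof -
    let ?C = "{v. \<bar>Re v\<bar> \<le> 2 * \<eta> \<and> Im v = b}"
    have "norm (A (Complex s b) - A (Complex s' b)) \<le> tail n b *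
        norm (Complex s b - Complex s' b)"
    proof (rule field_differentiable_bound[of ?C A "E n \<zeta>"])
      have "?C = {v. Re v \<le> 2 * \<eta>} \<inter> {v. Re v \<ge> - 2 * \<eta>} \<inter> {v. Im v = b}" by auto
      moreover have "convex \<dots>"
        by (intro convex_Int convex_halfspace_Re_le convex_halfspace_Re_ge) (auto simp: convex_def algebra_simps simp flip: distrib_right)
      ultimately show "convex ?C" by simp
      show "(A has_field_derivative E n \<zeta> v) (at v within ?C)" for v
        by (rule has_field_derivative_at_within[OF A])
      show "norm (E n \<zeta> v) \<le> tail n b" if "v \<in> ?C" for v
        using E_bound[of "Re v" "Im v" \<zeta> n] that \<open>b \<ge> 0\<close> z by simp
    qed (use that in auto)
    moreover have "norm (Complex s b - Complex s' b) = \<bar>s - s'\<bar>" by (simp add: cmod_def)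
    ultimately show ?thesis by simp
  qed
  have lim: "((\<lambda>b. - \<i> * (A (Complex s b) - A (Complex s 0))) \<longlongrightarrow> half_int n \<zeta> s) at_top" if s: "\<bar>s\<bar> \<le> 2 * \<eta>" for s
  proof -
    have "((\<lambda>b. LINT y:{0..b}|lborel. E n \<zeta> (Complex s y)) \<longlongrightarrow> half_int n \<zeta> s) at_top"
      unfolding half_int_def
      by (rule tendsto_set_lebesgue_integral_at_top) (use E_integrable[OF s z n] in auto)
    moreover have "(LINT y:{0..b}|lborel. E n \<zeta> (Complex s y)) = - \<i> * (A (Complex s b) - A (Complex s 0))"
      if "b \<ge> 0" for b
    proof -
      have "((\<lambda>y. E n \<zeta> (Complex s y)) has_integral (- \<i> * A (Complex s b) - (- \<i>) * A (Complex s 0))) {0..b}"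
      proof (rule fundamental_theorem_of_calculus[OF that])
        fix y assume "y \<in> {0..b}"
        have "((\<lambda>y. Complex s y) has_vector_derivative \<i>) (at y within {0..b})"
          unfolding Complex_eq by (auto intro!: derivative_eq_intros)
        from field_vector_diff_chain_within[OF this has_field_derivative_at_within[OF A]]
        have "((\<lambda>y. A (Complex s y)) has_vector_derivative (\<i> * E n \<zeta> (Complex s y))) (at y within {0..b})"
          by (simp add: o_def)
        from has_vector_derivative_mult_right[OF this, of "- \<i>"]
        show "((\<lambda>y. - \<i> * A (Complex s y)) has_vector_derivative E n \<zeta> (Complex s y)) (at y within {0..b})"
          by simp
      qed
      then have "integral {0..b} (\<lambda>y. E n \<zeta> (Complex s y)) = - \<i> * (A (Complex s b) - A (Complex s 0))"
        by (simp add: integral_unique algebra_simps)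
      moreover have "set_integrable lborel {0..b} (\<lambda>y. E n \<zeta> (Complex s y))"
        by (rule E_integrable[OF s z n]) auto
      ultimately show ?thesis using set_borel_integral_eq_integral(2) by metis
    qed
    then have "\<forall>\<^sub>F b in at_top. (LINT y:{0..b}|lborel. E n \<zeta> (Complex s y)) = - \<i> * (A (Complex s b) - A (Complex s 0))"
      using eventually_ge_at_top[of "0::real"] by (rule eventually_mono[rotated])
    ultimately show ?thesis by (rule Lim_transform_eventually)
  qed
  let ?d = "\<lambda>b. A (Complex x b) - A (Complex x' b)"
  have d0: "(?d \<longlongrightarrow> 0) at_top"
  proof (rule Lim_null_comparison)
    show "\<forall>\<^sub>F b in at_top. norm (?d b) \<le> tail n b * \<bar>x - x'\<bar>"
      using eventually_ge_at_top[of 0] by eventually_elim (rule bnd[OF x x'])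
    have "filterlim (\<lambda>b::real. - 1/2 - (b - 1)\<^sup>2 / 4 + 5 * \<eta>) at_bot at_top" by real_asymp
    then have "filterlim (\<lambda>b. N n * (- 1/2 - (b - 1)\<^sup>2 / 4 + 5 * \<eta>)) at_bot at_top"
      by (rule filterlim_tendsto_pos_mult_at_bot[OF tendsto_const Np])
    from filterlim_compose[OF exp_at_bot this]
    show "((\<lambda>b. tail n b * \<bar>x - x'\<bar>) \<longlongrightarrow> 0) at_top"
      by (rule tendsto_mult_left_zero)
  qed
  have L1: "((\<lambda>b. - \<i> * (A (Complex x b) - A (Complex x 0)) - - \<i> * (A (Complex x' b) - A (Complex x' 0))) \<longlongrightarrow>
      half_int n \<zeta> x - half_int n \<zeta> x') at_top"
    by (intro tendsto_diff lim x x')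
  have eq: "- \<i> * (A (Complex x b) - A (Complex x 0)) - - \<i> * (A (Complex x' b) - A (Complex x' 0)) =
      - \<i> * ?d b + \<i> * ?d 0" for b by (simp add: algebra_simps)
  have "((\<lambda>b. - \<i> * ?d b + \<i> * ?d 0) \<longlongrightarrow> - \<i> * 0 + \<i> * ?d 0) at_top"
    by (intro tendsto_intros d0)
  from tendsto_unique[OF trivial_limit_at_top_linorder L1[unfolded eq] this]
  have "half_int n \<zeta> x - half_int n \<zeta> x' = \<i> * ?d 0" by simp
  then have "norm (half_int n \<zeta> x - half_int n \<zeta> x') = norm (?d 0)" by (simp add: norm_mult)
  \<comment> \<open>At height 0 the exponent of \<open>tail\<close> is
    \<open>- 1/2 - 1/4 + 5 * \<eta>\<close>.\<close>
  then show ?thesis using bnd[OF x x', of 0] by simp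
qed


text \<open>\<open>N n * w j\<close> is the natural number \<open>n * a j\<close>, so the branch of
  the logarithm disappears after exponentiation.\<close>

lemma exp_f_eq_E:
  assumes "v \<in> cball \<i> (1/50)"
  shows "E n \<zeta> v = exp (N n * f \<zeta> v)"
proof -
  have "exp (N n * (\<Sum>j\<in>J. w j * Ln (v - kap j))) = exp (\<Sum>j\<in>J. of_nat (n * a j) * Ln (v - kap j))"
  proof -
    have "complex_of_real (N n) * (complex_of_real (w j) * x) = of_nat (n * a j) * x" for j x
      using N_w[of n j] by (metis mult.assoc of_real_mult of_real_of_nat_eq)
    then show ?thesis by (simp only: sum_distrib_left)
  qed
  also have "\<dots> = (\<Prod>j\<in>J. exp (Ln (v - kap j)) ^ (n * a j))"
    using finJ by (simp only: exp_sum exp_of_nat_mult)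
  also have "\<dots> = (\<Prod>j\<in>J. (v - kap j) ^ (n * a j))"
    using near_i(3)[OF assms] by (intro prod.cong) auto
  finally show ?thesis
    unfolding E_def f_def distrib_left exp_add by simp
qed

text \<open>The second derivative of \<open>f\<close> in \<open>v\<close> is close to 2, so along
  the vertical direction \<open>f\<close> decreases like \<open>s\<^sup>2\<close>. After subtracting
  \<open>(u - ?v)\<^sup>2\<close> the derivative is the increment of \<open>S u - 2 * u\<close>, at
  most \<open>\<bar>s\<bar> / 10\<close> on the disk of radius \<open>\<bar>s\<bar>\<close>.\<close>

lemma taylor_saddle:
  assumes z: "norm \<zeta> \<le> \<eta>" and s: "\<bar>s\<bar> \<le> 1/100"
  shows "norm (f \<zeta> (sp \<zeta> + \<i> * s) - F \<zeta> + complex_of_real (s\<^sup>2)) \<le> s\<^sup>2 / 10"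
    and "sp \<zeta> + \<i> * s \<in> cball \<i> (1/50)"
proof -
  let ?v = "sp \<zeta>"
  have inb: "?v + \<i> * complex_of_real r \<in> cball \<i> (1/50)" if "\<bar>r\<bar> \<le> 1/100" for r
    using norm_triangle_ineq[of "?v - \<i>" "\<i> * r"] sp_close[OF z] eta_small that
    by (simp add: dist_norm norm_minus_commute[of \<i>] norm_mult algebra_simps)
  show "sp \<zeta> + \<i> * s \<in> cball \<i> (1/50)" using inb[OF s] .
  let ?u = "?v + \<i> * complex_of_real s" and ?C = "cball ?v \<bar>s\<bar>"
  let ?H = "\<lambda>u. f \<zeta> u - (u - ?v)\<^sup>2"
  have sub: "u \<in> cball \<i> (1/50)" if "u \<in> ?C" for u
    using norm_triangle_ineq[of "?v - \<i>" "u - ?v"] sp_close[OF z] eta_small s that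
    by (simp add: dist_norm norm_minus_commute)
  have "norm (?H ?u - ?H ?v) \<le> (\<bar>s\<bar> / 10) * norm (?u - ?v)"
  proof (rule field_differentiable_bound[of ?C ?H "\<lambda>u. (S u - \<zeta>) - 2 * (u - ?v)"])
    fix u assume u: "u \<in> ?C"
    have "((\<lambda>u. (u - ?v)\<^sup>2) has_field_derivative 2 * (u - ?v)) (at u)"
      by (auto intro!: derivative_eq_intros)
    from DERIV_diff[OF f_deriv_v[OF sub[OF u]] this]
    show "(?H has_field_derivative (S u - \<zeta>) - 2 * (u - ?v)) (at u within ?C)"
      by (rule has_field_derivative_at_within)
    have eq: "(S u - \<zeta>) - 2 * (u - ?v) = (S u - 2 * u) - (S ?v - 2 * ?v)"
      using sp(2)[OF z] by (simp add: algebra_simps)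
    show "norm ((S u - \<zeta>) - 2 * (u - ?v)) \<le> \<bar>s\<bar> / 10"
      using S_lipschitz[OF sub[OF u] sp(1)[OF z]] u unfolding eq by (simp add: dist_norm norm_minus_commute)
  qed (auto simp: dist_norm norm_mult)
  then show "norm (f \<zeta> (sp \<zeta> + \<i> * s) - F \<zeta> + complex_of_real (s\<^sup>2)) \<le> s\<^sup>2 / 10"
    by (simp add: F_def norm_mult power2_eq_square algebra_simps abs_mult_self_eq flip: abs_mult)
qed

abbreviation peak :: "nat \<Rightarrow> complex \<Rightarrow> real" where "peak n \<zeta> \<equiv> exp (N n * Re (F \<zeta>))"

text \<open>The error is itself Gaussian with the small factor 1/8. After integration it has the
  same order in \<open>N n\<close> as the main term, and only this factor keeps it below.\<close>

lemma local_bound: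
  assumes z: "norm \<zeta> \<le> \<eta>" and s: "\<bar>s\<bar> \<le> 1/100"
  shows "norm (E n \<zeta> (sp \<zeta> + \<i> * s) - exp (N n * F \<zeta>) * exp (- (N n * s\<^sup>2)))
      \<le> peak n \<zeta> * (1/8 * exp (- (N n / 2 * s\<^sup>2)))"
    and "norm (E n \<zeta> (sp \<zeta> + \<i> * s)) \<le> peak n \<zeta>"
proof -
  define g where "g = f \<zeta> (sp \<zeta> + \<i> * s) - F \<zeta>"
  have N0: "N n \<ge> 0" using N_ge[of n] by simp
  have E: "E n \<zeta> (sp \<zeta> + \<i> * s) = exp (N n * F \<zeta>) * exp (N n * g)"
    unfolding exp_f_eq_E[OF taylor_saddle(2)[OF z s]] g_def by (simp add: exp_add[symmetric] algebra_simps)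
  have g: "norm (g + complex_of_real (s\<^sup>2)) \<le> s\<^sup>2 / 10" using taylor_saddle(1)[OF z s] by (simp add: g_def)
  then have "Re (g + complex_of_real (s\<^sup>2)) \<le> s\<^sup>2 / 10" using complex_Re_le_cmod order_trans by blast
  then have Reg: "Re g \<le> - (9/10 * s\<^sup>2)" by simp
  let ?x = "N n * s\<^sup>2"
  have x0: "?x \<ge> 0" using N0 by simp
  have B: "Re (N n * g) \<le> - (9/10 * ?x)" using mult_left_mono[OF Reg N0] by simp
  have "norm (exp (N n * g) - exp (- complex_of_real ?x)) \<le> exp (- (9/10 * ?x)) * norm (N n * g - - complex_of_real ?x)"
    using B x0 by (intro norm_exp_diff_le) auto
  also have "N n * g - - complex_of_real ?x = N n * (g + complex_of_real (s\<^sup>2))" by (simp add: algebra_simps)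
  also have "norm \<dots> = N n * norm (g + complex_of_real (s\<^sup>2))" using N0 by (simp add: norm_mult)
  also have "exp (- (9/10 * ?x)) * (N n * norm (g + complex_of_real (s\<^sup>2))) \<le> exp (- (9/10 * ?x)) * (N n * (s\<^sup>2 / 10))"
    using g N0 by (intro mult_left_mono) auto
  also have "\<dots> = exp (- (9/10 * ?x)) * (1/4 * (4/10 * ?x))" by simp
  \<comment> \<open>The polynomial factor is traded for decay: \<open>x \<le> exp (x - 1)\<close>
    and \<open>exp 1 \<ge> 2\<close> bound \<open>4/10 * ?x\<close>, and the rate drops from 9/10 to
    1/2.\<close>
  also have "\<dots> \<le> exp (- (9/10 * ?x)) * (1/4 * (1/2 * exp (4/10 * ?x)))"
  proof (intro mult_left_mono)
    have "4/10 * ?x \<le> exp (4/10 * ?x - 1)" using exp_ge_add_one_self[of "4/10 * ?x - 1"] by simp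
    also have "\<dots> = exp (4/10 * ?x) / exp 1" by (simp add: exp_diff)
    also have "\<dots> \<le> exp (4/10 * ?x) / 2" using exp_ge_add_one_self[of "1::real"] by (intro divide_left_mono) auto
    finally show "4/10 * ?x \<le> 1/2 * exp (4/10 * ?x)" by simp
  qed auto
  also have "\<dots> = 1/8 * exp (- (N n / 2 * s\<^sup>2))" by (simp add: exp_add[symmetric])
  finally have 1: "norm (exp (N n * g) - exp (- complex_of_real ?x)) \<le> 1/8 * exp (- (N n / 2 * s\<^sup>2))" .
  have "E n \<zeta> (sp \<zeta> + \<i> * s) - exp (N n * F \<zeta>) * exp (- (N n * s\<^sup>2)) =
      exp (N n * F \<zeta>) * (exp (N n * g) - exp (- complex_of_real ?x))"
    unfolding E by (simp add: right_diff_distrib exp_of_real[symmetric])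
  also have "norm \<dots> = peak n \<zeta> * norm (exp (N n * g) - exp (- complex_of_real ?x))"
    unfolding norm_mult norm_exp_eq_Re by simp
  finally show "norm (E n \<zeta> (sp \<zeta> + \<i> * s) - exp (N n * F \<zeta>) * exp (- (N n * s\<^sup>2)))
      \<le> peak n \<zeta> * (1/8 * exp (- (N n / 2 * s\<^sup>2)))"
    using 1 by simp
  have "norm (E n \<zeta> (sp \<zeta> + \<i> * s)) = peak n \<zeta> * exp (Re (N n * g))"
    unfolding E norm_mult norm_exp_eq_Re by simp
  also have "\<dots> \<le> peak n \<zeta> * 1" using B x0 by (intro mult_left_mono) auto
  finally show "norm (E n \<zeta> (sp \<zeta> + \<i> * s)) \<le> peak n \<zeta>" by simp
qed

text \<open>At distance 1/100 from the saddle point, \<open>\<bar>y - 1\<bar> \<ge> 1/200\<close>.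
  One half of \<open>(y - 1)\<^sup>2 / 4\<close> stays as Gaussian decay. The other half is at least
  \<open>(1/200)\<^sup>2 / 8\<close>, more than \<open>3 / 10^6\<close>; it pays for the errors
  \<open>5 * \<eta>\<close> of \<open>tail\<close> and \<open>8 * \<eta>\<close> of
  \<open>Re_F_ge\<close> and for the gain \<open>1/10^6\<close>.\<close>

lemma outer_bound:
  assumes z: "norm \<zeta> \<le> \<eta>" and y: "y \<ge> 0" "\<bar>y - Im (sp \<zeta>)\<bar> \<ge> 1/100"
  shows "norm (E n \<zeta> (Complex (Re (sp \<zeta>)) y))
      \<le> exp (N n * (Re (F \<zeta>) - 1/10^6)) * exp (- (N n / 8 * (y - 1)\<^sup>2))"
proof -
  have N0: "N n \<ge> 0" using N_ge[of n] by simp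
  have c: "norm (sp \<zeta> - \<i>) \<le> 2 * \<eta>" by (rule sp_close[OF z])
  have re: "\<bar>Re (sp \<zeta>)\<bar> \<le> 2 * \<eta>" and im: "\<bar>Im (sp \<zeta>) - 1\<bar> \<le> 2 * \<eta>"
    using abs_Re_le_cmod[of "sp \<zeta> - \<i>"] abs_Im_le_cmod[of "sp \<zeta> - \<i>"] c by auto
  have "\<bar>y - 1\<bar> \<ge> 1/200" using y im eta_small by linarith
  then have "(1/200)\<^sup>2 \<le> (y - 1)\<^sup>2" by (metis abs_of_nonneg power2_abs power_mono zero_le_divide_1_iff zero_le_numeral)
  then have "- 1/2 - (y - 1)\<^sup>2 / 4 + 5 * \<eta> \<le> (Re (F \<zeta>) - 1/10^6) + - (1/8 * (y - 1)\<^sup>2)"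
    using Re_F_ge[OF z] eta_small by (simp add: power2_eq_square)
  from mult_left_mono[OF this N0]
  have "N n * (- 1/2 - (y - 1)\<^sup>2 / 4 + 5 * \<eta>) \<le> N n * (Re (F \<zeta>) - 1/10^6) + - (N n / 8 * (y - 1)\<^sup>2)"
    by (simp add: algebra_simps)
  then have "tail n y \<le> exp (N n * (Re (F \<zeta>) - 1/10^6)) * exp (- (N n / 8 * (y - 1)\<^sup>2))"
    by (simp add: exp_add[symmetric])
  then show ?thesis using E_bound[OF re y(1) z, of n] by linarith
qed


lemma Complex_sp: "Complex (Re (sp \<zeta>)) y = sp \<zeta> + \<i> * complex_of_real (y - Im (sp \<zeta>))"
  by (simp add: complex_eq_iff)

text \<open>Near the saddle point the integral is compared with a Gaussian one; the rest of the half
  line is exponentially smaller. Rough constants suffice because logarithms will be divided by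
  \<open>N n\<close>.\<close>

lemma half_int_at_saddle:
  assumes z: "norm \<zeta> \<le> \<eta>" and n: "n > 0"
  defines "H \<equiv> half_int n \<zeta> (Re (sp \<zeta>))" and "e \<equiv> peak n \<zeta>"
  shows "norm H \<le> 7 * e"
    and "N n \<ge> 10000 \<Longrightarrow> norm H \<ge> e * (3/10 / sqrt (N n) - 6 * exp (- (N n / 10^6)))"
proof -
  let ?x = "Re (sp \<zeta>)" and ?Y = "Im (sp \<zeta>)"
  let ?B = "{?Y - 1/100..?Y + 1/100}"
  let ?C = "{0..} - ?B"
  let ?E = "\<lambda>y. E n \<zeta> (Complex ?x y)"
  have N1: "N n \<ge> 1" using N_ge[of n] n by linarith
  have c: "norm (sp \<zeta> - \<i>) \<le> 2 * \<eta>" by (rule sp_close[OF z])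
  have re: "\<bar>?x\<bar> \<le> 2 * \<eta>" and im: "\<bar>?Y - 1\<bar> \<le> 2 * \<eta>"
    using abs_Re_le_cmod[of "sp \<zeta> - \<i>"] abs_Im_le_cmod[of "sp \<zeta> - \<i>"] c by auto
  have Bsub: "?B \<subseteq> {0..}" using im eta_small by auto
  note iB = E_integrable[OF re z n, of ?B, OF _ Bsub]
  note iC = E_integrable[OF re z n, of ?C]
  have "{0..} = ?B \<union> ?C" using Bsub by auto
  then have split: "H = (LINT y:?B|lborel. ?E y) + (LINT y:?C|lborel. ?E y)"
    unfolding H_def half_int_def
    using set_integral_Un[of ?B ?C lborel ?E] iB iC by (metis Diff_disjoint Diff_subset borel_closed closed_atLeast
      closed_atLeastAtMost sets.Diff)
  have C: "norm (LINT y:?C|lborel. ?E y) \<le> 6 * (e * exp (- (N n / 10^6)))"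
  proof -
    have "norm (LINT y:?C|lborel. ?E y) \<le>
        (LINT y|lborel. exp (N n * (Re (F \<zeta>) - 1/10^6)) * exp (- (N n / 8 * (y - 1)\<^sup>2)))"
      unfolding set_lebesgue_integral_def
    proof (rule Bochner_Integration.integral_norm_bound_integral)
      show "integrable lborel (\<lambda>y. indicat_real ?C y *\<^sub>R ?E y)"
        using iC unfolding set_integrable_def by auto
      show "integrable lborel (\<lambda>y. exp (N n * (Re (F \<zeta>) - 1/10^6)) * exp (- (N n / 8 * (y - 1)\<^sup>2)))"
        using gaussian_integral(1)[of "N n / 8" 1] N1 by (intro integrable_mult_right) auto
      show "norm (indicat_real ?C y *\<^sub>R ?E y) \<le> exp (N n * (Re (F \<zeta>) - 1/10^6)) * exp (- (N n / 8 * (y - 1)\<^sup>2))" for y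
      proof (cases "y \<in> ?C")
        case True
        then have "y \<ge> 0" "\<bar>y - ?Y\<bar> \<ge> 1/100" unfolding Diff_iff atLeastAtMost_iff atLeast_iff by linarith+
        from outer_bound[OF z this, of n] True show ?thesis by simp
      qed simp
    qed
    also have "\<dots> = exp (N n * (Re (F \<zeta>) - 1/10^6)) * sqrt (pi / (N n / 8))"
      using gaussian_integral(2)[of "N n / 8" 1] N1 by simp
    also have "sqrt (pi / (N n / 8)) \<le> 6"
    proof -
      have "pi / (N n / 8) \<le> 4 / (1/8)" using pi_less_4 N1 by (intro frac_le) auto
      also have "\<dots> \<le> 6\<^sup>2" by simp
      finally show ?thesis by (intro real_le_lsqrt) auto
    qed
    also have "exp (N n * (Re (F \<zeta>) - 1/10^6)) * 6 = 6 * (e * exp (- (N n / 10^6)))"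
      unfolding e_def by (simp add: exp_add[symmetric] algebra_simps)
    finally show ?thesis by simp
  qed
  have s: "\<bar>y - ?Y\<bar> \<le> 1/100" if "y \<in> ?B" for y using that unfolding atLeastAtMost_iff abs_le_iff by linarith
  have e0: "e > 0" by (simp add: e_def)
  have "norm (LINT y:?B|lborel. ?E y) \<le> (LINT y:?B|lborel. e)"
    unfolding set_lebesgue_integral_def
  proof (rule Bochner_Integration.integral_norm_bound_integral)
    show "integrable lborel (\<lambda>y. indicat_real ?B y *\<^sub>R ?E y)"
      using iB unfolding set_integrable_def by auto
    show "norm (indicat_real ?B y *\<^sub>R ?E y) \<le> indicat_real ?B y *\<^sub>R e" for y
      using local_bound(2)[OF z s, of y n] unfolding Complex_sp e_def by (auto simp: indicator_def)
  qed auto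
  also have "\<dots> = 1/50 * e" by (simp add: set_lebesgue_integral_def)
  finally have B1: "norm (LINT y:?B|lborel. ?E y) \<le> 1/50 * e" .
  have "e * exp (- (N n / 10^6)) \<le> e * 1" using e0 N1 by (intro mult_left_mono) auto
  then show "norm H \<le> 7 * e"
    unfolding split using norm_triangle_ineq[of "LINT y:?B|lborel. ?E y" "LINT y:?C|lborel. ?E y"] B1 C e0 by linarith
  assume N4: "N n \<ge> 10000"
  have sq: "sqrt (N n) \<ge> 100" using N4 by (intro real_le_rsqrt) simp
  let ?g = "\<lambda>y. exp (- (N n * (y - ?Y)\<^sup>2))"
  have gi: "integrable lborel ?g" using gaussian_integral(1) N1 by simp
  have gB: "integrable lborel (\<lambda>y. indicat_real ?B y *\<^sub>R ?g y)"
    using integrable_mult_indicator[OF _ gi, of ?B] by simp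
  \<comment> \<open>On the interval of half length \<open>1 / sqrt (N n)\<close>, contained in
    \<open>?B\<close> because \<open>N n \<ge> 10000\<close>, the Gaussian is at least
    \<open>exp (- 1) \<ge> 1/3\<close>.\<close>
  have G: "(LINT y:?B|lborel. ?g y) \<ge> 2/3 / sqrt (N n)"
  proof -
    let ?D = "{?Y - 1 / sqrt (N n)..?Y + 1 / sqrt (N n)}"
    have "(LINT y:?D|lborel. 1/3 :: real) \<le> (LINT y:?B|lborel. ?g y)"
      unfolding set_lebesgue_integral_def
    proof (rule integral_mono[OF _ gB])
      fix y :: real
      show "indicat_real ?D y *\<^sub>R (1/3) \<le> indicat_real ?B y *\<^sub>R ?g y"
      proof (cases "y \<in> ?D")
        case True
        have d: "1 / sqrt (N n) \<le> 1/100" using sq N1 by (intro divide_left_mono) auto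
        have a: "\<bar>y - ?Y\<bar> \<le> 1 / sqrt (N n)" using True unfolding atLeastAtMost_iff abs_le_iff by linarith
        then have "(y - ?Y)\<^sup>2 \<le> (1 / sqrt (N n))\<^sup>2" by (metis abs_ge_zero power2_abs power_mono)
        then have "N n * (y - ?Y)\<^sup>2 \<le> 1" using N1 by (simp add: power_divide field_simps)
        then have "exp (- 1) \<le> ?g y" by simp
        moreover have "exp (- 1) \<ge> (1/3 :: real)" using exp_le by (simp add: exp_minus field_simps)
        ultimately have "1/3 \<le> ?g y" by linarith
        moreover have "y \<in> ?B" using a d unfolding atLeastAtMost_iff abs_le_iff by linarith
        ultimately show ?thesis using True by simp
      qed auto
    next
      show "integrable lborel (\<lambda>y. indicat_real ?D y *\<^sub>R (1/3 :: real))"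
        by (intro integrable_scaleR_left integrable_real_indicator) (auto simp: emeasure_lborel_Icc_eq)
    qed
    also have "(LINT y:?D|lborel. 1/3 :: real) = 2/3 / sqrt (N n)"
      using N1 by (simp add: set_lebesgue_integral_def)
    finally show ?thesis .
  qed
  let ?G = "(LINT y:?B|lborel. ?g y)"
  have "norm ((LINT y:?B|lborel. ?E y) - exp (N n * F \<zeta>) * ?G) \<le> (LINT y|lborel. e * (1/8 * exp (- (N n / 2 * (y - ?Y)\<^sup>2))))"
  proof -
    have eq: "(LINT y:?B|lborel. ?E y) - exp (N n * F \<zeta>) * ?G =
        (LINT y|lborel. indicat_real ?B y *\<^sub>R ?E y - exp (N n * F \<zeta>) * complex_of_real (indicat_real ?B y *\<^sub>R ?g y))"
      unfolding set_lebesgue_integral_def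
      using iB gB by (subst Bochner_Integration.integral_diff)
        (auto simp: set_integrable_def simp del: of_real_mult of_real_exp)
    show ?thesis unfolding eq
    proof (rule Bochner_Integration.integral_norm_bound_integral)
      show "integrable lborel (\<lambda>y. indicat_real ?B y *\<^sub>R ?E y - exp (N n * F \<zeta>) * complex_of_real (indicat_real ?B y *\<^sub>R ?g y))"
        using iB gB by (intro Bochner_Integration.integrable_diff integrable_mult_right integrable_of_real) (auto simp: set_integrable_def)
      show "integrable lborel (\<lambda>y. e * (1/8 * exp (- (N n / 2 * (y - ?Y)\<^sup>2))))"
        using gaussian_integral(1)[of "N n / 2" ?Y] N1 by (intro integrable_mult_right) auto
      show "norm (indicat_real ?B y *\<^sub>R ?E y - exp (N n * F \<zeta>) * complex_of_real (indicat_real ?B y *\<^sub>R ?g y))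
          \<le> e * (1/8 * exp (- (N n / 2 * (y - ?Y)\<^sup>2)))" for y
      proof (cases "y \<in> ?B")
        case True
        show ?thesis using local_bound(1)[OF z s[OF True], of n] True unfolding Complex_sp e_def by simp
      qed (use e0 in simp)
    qed
  qed
  also have "\<dots> = e / 8 * sqrt (pi / (N n / 2))"
    using gaussian_integral(2)[of "N n / 2" ?Y] N1 by simp
  \<comment> \<open>29/10 exceeds \<open>sqrt 8\<close>, hence \<open>sqrt (2 * pi)\<close>, and is
    small enough for \<open>2/3 - 29/80\<close> to exceed 3/10.\<close>
  also have "\<dots> \<le> e / 8 * (29/10 / sqrt (N n))"
  proof (intro mult_left_mono)
    have "pi / (N n / 2) \<le> 8 / N n" using pi_less_4 N1 by (simp add: field_simps)
    also have "\<dots> \<le> (29/10)\<^sup>2 / N n" using N1 by (intro divide_right_mono) (auto simp: power2_eq_square)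
    also have "\<dots> = (29/10 / sqrt (N n))\<^sup>2" using N1 by (simp add: power_divide)
    finally show "sqrt (pi / (N n / 2)) \<le> 29/10 / sqrt (N n)" using N1 by (intro real_le_lsqrt) auto
  qed (use e0 in auto)
  finally have D: "norm ((LINT y:?B|lborel. ?E y) - exp (N n * F \<zeta>) * ?G) \<le> e / 8 * (29/10 / sqrt (N n))" .
  have "norm (exp (N n * F \<zeta>) * complex_of_real ?G) = e * \<bar>?G\<bar>"
    unfolding norm_mult norm_exp_eq_Re e_def by simp
  moreover have "e * (2/3 / sqrt (N n)) \<le> e * \<bar>?G\<bar>" using G e0 by (intro mult_left_mono) auto
  ultimately have "norm (LINT y:?B|lborel. ?E y) \<ge> e * (2/3 / sqrt (N n)) - e / 8 * (29/10 / sqrt (N n))"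
    using D norm_triangle_ineq2[of "exp (N n * F \<zeta>) * complex_of_real ?G" "LINT y:?B|lborel. ?E y"]
    by (simp add: norm_minus_commute)
  also have "e * (2/3 / sqrt (N n)) - e / 8 * (29/10 / sqrt (N n)) = e / sqrt (N n) * (2/3 - 29/80)"
    by (simp add: algebra_simps)
  finally have "norm (LINT y:?B|lborel. ?E y) \<ge> e / sqrt (N n) * (2/3 - 29/80)" .
  moreover have "e / sqrt (N n) * (2/3 - 29/80) \<ge> e / sqrt (N n) * (3/10)" using e0 N1 by (intro mult_left_mono) auto
  ultimately have "norm (LINT y:?B|lborel. ?E y) \<ge> e * (3/10 / sqrt (N n))" by (simp add: mult.commute)
  then show "norm H \<ge> e * (3/10 / sqrt (N n) - 6 * exp (- (N n / 10^6)))"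
    unfolding split using C norm_triangle_ineq2[of "LINT y:?B|lborel. ?E y" "- (LINT y:?C|lborel. ?E y)"]
    by (simp add: algebra_simps)
qed

text \<open>The polynomial is an integral over the line through \<open>\<zeta>\<close>, not through
  the saddle point, so the half line starts at \<open>Re \<zeta>\<close> and is shifted
  afterwards.\<close>

definition Iup :: "nat \<Rightarrow> complex \<Rightarrow> complex" where
  "Iup n \<zeta> = half_int n \<zeta> (Re \<zeta>)"

lemma Iup_saddle_diff:
  assumes z: "norm \<zeta> \<le> \<eta>" and n: "n > 0"
  shows "norm (Iup n \<zeta> - half_int n \<zeta> (Re (sp \<zeta>))) \<le> peak n \<zeta> * exp (- (N n / 10^6))"
proof -
  have N0: "N n \<ge> 0" using N_ge[of n] by simp
  have c: "norm (sp \<zeta> - \<i>) \<le> 2 * \<eta>" by (rule sp_close[OF z])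
  have re: "\<bar>Re (sp \<zeta>)\<bar> \<le> 2 * \<eta>" "\<bar>Re \<zeta>\<bar> \<le> 2 * \<eta>" "\<bar>Re \<zeta> - Re (sp \<zeta>)\<bar> \<le> 1"
    using abs_Re_le_cmod[of "sp \<zeta> - \<i>"] abs_Re_le_cmod[of \<zeta>] c z eta_small eta_pos by auto
  have "norm (Iup n \<zeta> - half_int n \<zeta> (Re (sp \<zeta>))) \<le> exp (N n * (- 3/4 + 5 * \<eta>)) * \<bar>Re \<zeta> - Re (sp \<zeta>)\<bar>"
    unfolding Iup_def by (rule half_int_shift[OF re(2,1) z n])
  also have "\<dots> \<le> exp (N n * (- 3/4 + 5 * \<eta>)) * 1" using re(3) by (intro mult_left_mono) auto
  also have "\<dots> \<le> exp (N n * (Re (F \<zeta>) - 1/10^6))"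
    using Re_F_ge[OF z] eta_small N0 by (simp add: mult_left_mono)
  also have "\<dots> = peak n \<zeta> * exp (- (N n / 10^6))"
    by (simp add: exp_add[symmetric] algebra_simps)
  finally show ?thesis .
qed

lemma Iup_upper:
  assumes "norm \<zeta> \<le> \<eta>" "n > 0"
  shows "norm (Iup n \<zeta>) \<le> 8 * peak n \<zeta>"
proof -
  have "peak n \<zeta> * exp (- (N n / 10^6)) \<le> peak n \<zeta> * 1"
    using N_ge[of n] by (intro mult_left_mono) auto
  then show ?thesis
    using Iup_saddle_diff[OF assms] half_int_at_saddle(1)[OF assms]
      norm_triangle_ineq2[of "Iup n \<zeta>" "half_int n \<zeta> (Re (sp \<zeta>))"] by linarith
qed

text \<open>The threshold for \<open>n\<close> must not depend on \<open>\<zeta>\<close>, because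
  zeros will be excluded from whole disks at once.\<close>

lemma Iup_lower:
  "\<forall>\<^sub>F n in sequentially. \<forall>\<zeta>. norm \<zeta> \<le> \<eta> \<longrightarrow>
     norm (Iup n \<zeta>) \<ge> peak n \<zeta> * (1/5 / sqrt (N n))"
proof -
  have Ninf: "filterlim N at_top sequentially"
    by (rule filterlim_at_top_mono[OF filterlim_real_sequentially]) (auto intro: always_eventually N_ge)
  have "\<forall>\<^sub>F x::real in at_top. 7 * exp (- (x / 10^6)) \<le> 1/10 / sqrt x" by real_asymp
  then have "\<forall>\<^sub>F n in sequentially. 7 * exp (- (N n / 10^6)) \<le> 1/10 / sqrt (N n)"
    using Ninf by (rule eventually_compose_filterlim)
  moreover have "\<forall>\<^sub>F n in sequentially. N n \<ge> 10000"
    using Ninf by (simp add: filterlim_at_top)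
  ultimately show ?thesis using eventually_gt_at_top[of 0]
  proof eventually_elim
    case (elim n)
    show ?case
    proof (intro allI impI)
      fix \<zeta> :: complex assume z: "norm \<zeta> \<le> \<eta>"
      let ?e = "peak n \<zeta>"
      have "?e * (7 * exp (- (N n / 10^6))) \<le> ?e * (1/10 / sqrt (N n))"
        using elim(1) by (intro mult_left_mono) auto
      then show "norm (Iup n \<zeta>) \<ge> ?e * (1/5 / sqrt (N n))"
        using Iup_saddle_diff[OF z elim(3)] half_int_at_saddle(2)[OF z elim(3,2)]
          norm_triangle_ineq2[of "half_int n \<zeta> (Re (sp \<zeta>))" "Iup n \<zeta>"]
        by (simp add: norm_minus_commute algebra_simps)
    qed
  qed
qed


lemma E_reflect: "E n \<zeta> (- v) = (- 1) ^ (n * (\<Sum>j\<in>J. a j)) * saddle.E J a (\<lambda>j. - kap j) n (- \<zeta>) v"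
proof -
  interpret R: saddle J a "\<lambda>j. - kap j" \<eta> by (rule reflect)
  have "(\<Prod>j\<in>J. (- v - kap j) ^ (n * a j)) = (\<Prod>j\<in>J. (- 1) ^ (n * a j) * (v - - kap j) ^ (n * a j))"
  proof (rule prod.cong[OF refl])
    fix j
    have "- v - kap j = (- 1) * (v - - kap j)" by simp
    then show "(- v - kap j) ^ (n * a j) = (- 1) ^ (n * a j) * (v - - kap j) ^ (n * a j)"
      by (simp only: power_mult_distrib)
  qed
  also have "\<dots> = (- 1) ^ (n * (\<Sum>j\<in>J. a j)) * (\<Prod>j\<in>J. (v - - kap j) ^ (n * a j))"
    unfolding prod.distrib sum_na[symmetric] power_sum ..
  moreover have "(\<zeta> - - v)\<^sup>2 = (- \<zeta> - v)\<^sup>2" by (simp add: power2_eq_square algebra_simps)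
  ultimately show ?thesis unfolding E_def R.E_def R.N_def N_def by simp
qed

text \<open>Reflection in the origin maps the lower half of the line to the upper half of the line
  through \<open>- \<zeta>\<close> for the data \<open>- kap\<close>. The sign that appears has
  modulus 1 and cannot affect estimates of moduli.\<close>

lemma line_integral:
  assumes z: "norm \<zeta> \<le> \<eta>" and n: "n > 0"
  shows "(LINT y|lborel. E n \<zeta> (\<zeta> + \<i> * complex_of_real y)) =
    Iup n \<zeta> + (- 1) ^ (n * (\<Sum>j\<in>J. a j)) * saddle.Iup J a (\<lambda>j. - kap j) n (- \<zeta>)"
proof -
  interpret R: saddle J a "\<lambda>j. - kap j" \<eta> by (rule reflect)
  let ?s = "(- 1 :: complex) ^ (n * (\<Sum>j\<in>J. a j))"
  let ?g = "\<lambda>y. E n \<zeta> (Complex (Re \<zeta>) y)"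
  have z': "norm (- \<zeta>) \<le> \<eta>" and re: "\<bar>Re \<zeta>\<bar> \<le> 2 * \<eta>" "\<bar>Re (- \<zeta>)\<bar> \<le> 2 * \<eta>"
    using z abs_Re_le_cmod[of \<zeta>] eta_pos by auto
  have neg: "?g (- y) = ?s * R.E n (- \<zeta>) (Complex (Re (- \<zeta>)) y)" for y
  proof -
    have "Complex (Re \<zeta>) (- y) = - Complex (Re (- \<zeta>)) y" by (simp add: complex_eq_iff)
    then show ?thesis using E_reflect by (simp only:)
  qed
  have "(LINT y|lborel. E n \<zeta> (\<zeta> + \<i> * complex_of_real y)) = (LINT y|lborel. ?g (Im \<zeta> + 1 * y))"
    by (intro Bochner_Integration.integral_cong arg_cong[of _ _ "E n \<zeta>"]) (auto simp: complex_eq_iff)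
  also have "\<dots> = (LINT y|lborel. ?g y)"
    using lborel_integral_real_affine[of 1 ?g "Im \<zeta>"] by simp
  finally have 1: "(LINT y|lborel. E n \<zeta> (\<zeta> + \<i> * complex_of_real y)) = (LINT y|lborel. ?g y)" .
  \<comment> \<open>The half line is open here so that its reflection is disjoint from
    \<open>{0..}\<close>; the point 0 is a null set and is put back afterwards.\<close>
  let ?h = "\<lambda>y. indicat_real {0<..} y *\<^sub>R (?s * R.E n (- \<zeta>) (Complex (Re (- \<zeta>)) y))"
  have up: "integrable lborel (\<lambda>y. indicat_real {0..} y *\<^sub>R ?g y)"
    using E_integrable[OF re(1) z n, of "{0..}"] by (simp add: set_integrable_def)
  have "integrable lborel (\<lambda>y. indicat_real {0<..} y *\<^sub>R R.E n (- \<zeta>) (Complex (Re (- \<zeta>)) y))"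
    using R.E_integrable[OF re(2) z' n, of "{0<..}"] Ioi_le_Ico[of "0::real"]
    by (simp add: set_integrable_def)
  from integrable_mult_right[OF this, of ?s] have hi: "integrable lborel ?h"
    by (simp only: mult_scaleR_right)
  have hneg: "?h (- y) = indicat_real {..<0} y *\<^sub>R ?g y" for y
    using neg[of "- y"] by (auto simp: indicator_def)
  have lo: "integrable lborel (\<lambda>y. indicat_real {..<0} y *\<^sub>R ?g y)"
    using lborel_integrable_real_affine[OF hi, of "- 1" 0] unfolding hneg[symmetric] by simp
  have lo_eq: "(LINT y|lborel. indicat_real {..<0} y *\<^sub>R ?g y) = (LINT y|lborel. ?h y)"
    using lborel_integral_real_affine[of "- 1" ?h 0] unfolding hneg[symmetric] by simp
  have "(LINT y|lborel. ?h y) = (LINT y|lborel. ?s * (indicat_real {0..} y *\<^sub>R R.E n (- \<zeta>) (Complex (Re (- \<zeta>)) y)))"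
  proof (rule integral_cong_AE)
    show "?h \<in> borel_measurable lborel" using hi by (rule borel_measurable_integrable)
    have "integrable lborel (\<lambda>y. indicat_real {0..} y *\<^sub>R R.E n (- \<zeta>) (Complex (Re (- \<zeta>)) y))"
      using R.E_integrable[OF re(2) z' n, of "{0..}"] by (simp add: set_integrable_def)
    then show "(\<lambda>y. ?s * (indicat_real {0..} y *\<^sub>R R.E n (- \<zeta>) (Complex (Re (- \<zeta>)) y))) \<in> borel_measurable lborel"
      by (intro borel_measurable_integrable integrable_mult_right)
    show "AE y in lborel. ?h y = ?s * (indicat_real {0..} y *\<^sub>R R.E n (- \<zeta>) (Complex (Re (- \<zeta>)) y))"
      using AE_lborel_singleton[of "0::real"] by eventually_elim (auto simp: indicator_def)
  qed
  also have "\<dots> = ?s * R.Iup n (- \<zeta>)"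
    unfolding R.Iup_def R.half_int_def set_lebesgue_integral_def by (rule integral_mult_right_zero)
  finally have 2: "(LINT y|lborel. ?h y) = ?s * R.Iup n (- \<zeta>)" .
  have "(LINT y|lborel. ?g y) = (LINT y|lborel. indicat_real {0..} y *\<^sub>R ?g y + indicat_real {..<0} y *\<^sub>R ?g y)"
    by (intro Bochner_Integration.integral_cong) (auto simp: indicator_def)
  also have "\<dots> = (LINT y|lborel. indicat_real {0..} y *\<^sub>R ?g y) + (LINT y|lborel. indicat_real {..<0} y *\<^sub>R ?g y)"
    by (rule Bochner_Integration.integral_add[OF up lo])
  also have "(LINT y|lborel. indicat_real {0..} y *\<^sub>R ?g y) = Iup n \<zeta>"
    unfolding Iup_def half_int_def set_lebesgue_integral_def ..
  finally show ?thesis unfolding 1 lo_eq 2 .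
qed

end

section \<open>The heat flow as a Gaussian average\<close>

lemma higher_pderiv_shift:
  fixes p :: "'a::idom poly"
  shows "(pderiv ^^ k) (p \<circ>\<^sub>p [:z, 1:]) = ((pderiv ^^ k) p) \<circ>\<^sub>p [:z, 1:]"
proof (induction k)
  case (Suc k)
  have "pderiv [:z, 1:] = 1" by (simp add: pderiv_pCons)
  then show ?case using Suc by (simp add: pderiv_pcompose)
qed simp

lemma poly_taylor:
  fixes p :: "complex poly"
  shows "poly p (z + h) = (\<Sum>k\<le>degree p. poly ((pderiv ^^ k) p) z / fact k * h ^ k)"
proof -
  let ?q = "p \<circ>\<^sub>p [:z, 1:]"
  have "coeff ?q k = poly ((pderiv ^^ k) p) z / fact k" for k
  proof -
    have "poly ((pderiv ^^ k) p) z = coeff ((pderiv ^^ k) ?q) 0"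
      by (simp add: higher_pderiv_shift poly_pcompose flip: poly_0_coeff_0)
    then show ?thesis by (simp add: coeff_higher_pderiv flip: pochhammer_fact)
  qed
  moreover have "poly p (z + h) = poly ?q h" by (simp add: poly_pcompose add.commute)
  moreover have "degree ?q = degree p" by (simp add: degree_pcompose)
  ultimately show ?thesis by (simp add: poly_altdef)
qed

abbreviation gaussian_power :: "complex \<Rightarrow> nat \<Rightarrow> real \<Rightarrow> complex" where
  "gaussian_power c k x \<equiv> of_real (std_normal_density x) * (c * of_real x) ^ k"

abbreviation heat_kernel :: "real \<Rightarrow> complex poly \<Rightarrow> complex \<Rightarrow> real \<Rightarrow> complex" where
  "heat_kernel s p z x \<equiv> of_real (std_normal_density x) * poly p (z + \<i> * of_real (sqrt (2 * s)) * of_real x)"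

lemma gaussian_moment:
  fixes c :: complex
  shows "integrable lborel (gaussian_power c k)"
    and "even k \<Longrightarrow> (LINT x|lborel. gaussian_power c k x)
      = c ^ k * fact k / (2 ^ (k div 2) * fact (k div 2))"
    and "odd k \<Longrightarrow> (LINT x|lborel. gaussian_power c k x) = 0"
proof -
  have eq: "gaussian_power c k x =
      c ^ k * complex_of_real (std_normal_density x * x ^ k)" for x
    by (simp add: power_mult_distrib)
  have i: "integrable lborel (\<lambda>x. std_normal_density x * x ^ k)" by (rule integrable_std_normal_moment)
  show "integrable lborel (gaussian_power c k)"
    unfolding eq by (intro integrable_mult_right integrable_of_real i)
  have int: "(LINT x|lborel. gaussian_power c k x) =
      c ^ k * complex_of_real (LINT x|lborel. std_normal_density x * x ^ k)"
    unfolding eq integral_mult_right_zero integral_complex_of_real ..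
  show "(LINT x|lborel. gaussian_power c k x)
      = c ^ k * fact k / (2 ^ (k div 2) * fact (k div 2))" if e: "even k"
  proof -
    obtain m where m: "k = 2 * m" using e by blast
    show ?thesis unfolding int unfolding m integral_std_normal_moment_even by simp
  qed
  show "(LINT x|lborel. gaussian_power c k x) = 0" if o: "odd k"
  proof -
    obtain m where m: "k = 2 * m + 1" using o by (elim oddE)
    show ?thesis unfolding int unfolding m integral_std_normal_moment_odd by simp
  qed
qed

text \<open>Taylor expansion of \<open>p\<close> at \<open>z\<close>, averaged over a standard
  normal \<open>x\<close>: odd moments vanish, the moment of order \<open>2 * k\<close> is
  \<open>fact (2 * k) / (2 ^ k * fact k)\<close>, and the even powers of
  \<open>\<i> * sqrt (2 * s)\<close> are \<open>(- 2 * s) ^ k\<close>. The products are the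
  coefficients of the exponential series.\<close>

lemma heat_flow_integral:
  assumes "s \<ge> 0"
  shows "integrable lborel (heat_kernel s p z)"
    and "poly (heat_flow s p) z =
      (LINT x|lborel. heat_kernel s p z x)"
proof -
  let ?c = "\<i> * complex_of_real (sqrt (2 * s))" and ?d = "degree p"
  let ?t = "\<lambda>k. poly ((pderiv ^^ k) p) z / fact k"
  let ?m = "gaussian_power ?c"
  have eq: "heat_kernel s p z x =
      (\<Sum>k\<le>?d. ?t k * ?m k x)" for x
    unfolding poly_taylor sum_distrib_left by (intro sum.cong) auto
  show "integrable lborel (heat_kernel s p z)"
    unfolding eq by (intro Bochner_Integration.integrable_sum integrable_mult_right gaussian_moment)
  have z0: "?t k = 0" if "k > ?d" for k
  proof -
    have "(pderiv ^^ k) p = 0"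
      by (rule poly_eqI) (use that in \<open>simp add: coeff_higher_pderiv coeff_eq_0\<close>)
    then show ?thesis by simp
  qed
  let ?I = "\<lambda>k. LINT x|lborel. ?m k x"
  have "(LINT x|lborel. heat_kernel s p z x) =
      (\<Sum>k\<le>?d. ?t k * ?I k)"
    unfolding eq by (subst Bochner_Integration.integral_sum)
      (auto intro!: integrable_mult_right gaussian_moment(1) sum.cong simp del: of_real_mult)
  \<comment> \<open>The range is doubled so that its even indices are \<open>2 * k\<close> with
    \<open>k \<le> ?d\<close>, matching the truncation in \<open>heat_flow\<close>; the added terms
    vanish.\<close>
  also have "\<dots> = (\<Sum>k\<le>2 * ?d. ?t k * ?I k)"
    by (rule sum.mono_neutral_left) (auto simp: z0)
  also have "\<dots> = (\<Sum>k | k \<le> 2 * ?d \<and> even k. ?t k * ?I k)"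
    by (rule sum.mono_neutral_right) (auto simp: gaussian_moment(3))
  also have "\<dots> = (\<Sum>k\<le>?d. ?t (2 * k) * ?I (2 * k))"
    by (rule sum.reindex_bij_witness[of _ "\<lambda>k. 2 * k" "\<lambda>k. k div 2"]) auto
  also have "\<dots> = (\<Sum>k\<le>?d. poly (smult (of_real ((- s) ^ k / fact k)) ((pderiv ^^ (2 * k)) p)) z)"
  proof (rule sum.cong[OF refl])
    fix k
    have c2: "?c ^ (2 * k) = complex_of_real ((- 2 * s) ^ k)"
    proof -
      have "?c\<^sup>2 = - complex_of_real ((sqrt (2 * s))\<^sup>2)" by (simp add: power_mult_distrib)
      also have "\<dots> = complex_of_real (- 2 * s)" using assms by simp
      finally show ?thesis by (simp add: power_mult)
    qed
    have "?I (2 * k) = complex_of_real ((- 2 * s) ^ k) * fact (2 * k) / (2 ^ k * fact k)"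
      using gaussian_moment(2)[of "2 * k" ?c] unfolding c2 by simp
    also have "\<dots> = complex_of_real ((- s) ^ k / fact k) * fact (2 * k)"
    proof -
      have "(- 2 * s) ^ k = 2 ^ k * (- s) ^ k" by (simp flip: power_mult_distrib)
      then show ?thesis by (simp add: field_simps)
    qed
    finally show "?t (2 * k) * ?I (2 * k) = poly (smult (of_real ((- s) ^ k / fact k)) ((pderiv ^^ (2 * k)) p)) z"
      by simp
  qed
  also have "\<dots> = poly (heat_flow s p) z" by (simp add: heat_flow_def poly_sum)
  finally show "poly (heat_flow s p) z =
      (LINT x|lborel. heat_kernel s p z x)" ..
qed

lemma heat_flow_coeff:
  assumes "i \<ge> degree p"
  shows "coeff (heat_flow s p) i = coeff p i"
proof -
  have "coeff (heat_flow s p) i = (\<Sum>k\<le>degree p. of_real ((- s) ^ k / fact k) * coeff ((pderiv ^^ (2 * k)) p) i)"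
    by (simp add: heat_flow_def coeff_sum)
  also have "\<dots> = (\<Sum>k\<in>{0}. of_real ((- s) ^ k / fact k) * coeff ((pderiv ^^ (2 * k)) p) i)"
    by (rule sum.mono_neutral_right) (use assms in \<open>auto simp: coeff_higher_pderiv coeff_eq_0\<close>)
  finally show ?thesis by simp
qed

lemma degree_heat_flow: "degree (heat_flow s p) = degree p"
proof (rule antisym)
  show "degree (heat_flow s p) \<le> degree p"
    by (rule degree_le) (simp add: heat_flow_coeff coeff_eq_0)
  show "degree p \<le> degree (heat_flow s p)"
  proof (cases "degree p = 0")
    case False
    then have "coeff p (degree p) \<noteq> 0" by auto
    then show ?thesis using heat_flow_coeff[of p "degree p" s] by (intro le_degree) simp
  qed simp
qed

lemma lead_coeff_heat_flow: "lead_coeff (heat_flow s p) = lead_coeff p"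
  by (simp add: degree_heat_flow heat_flow_coeff)

lemma gaussian_exp_abs:
  fixes b :: real
  shows "integrable lborel (\<lambda>x. std_normal_density x * (exp (b * x) + exp (- b * x)))"
    and "(LINT x|lborel. std_normal_density x * (exp (b * x) + exp (- b * x))) = 2 * exp (b\<^sup>2 / 2)"
proof -
  have eq: "std_normal_density x * (exp (b * x) + exp (- b * x)) =
      exp (b\<^sup>2 / 2) * normal_density b 1 x + exp (b\<^sup>2 / 2) * normal_density (- b) 1 x" for x
  proof -
    have "exp (- x\<^sup>2 / 2) * exp (c * x) = exp (c\<^sup>2 / 2) * exp (- (x - c)\<^sup>2 / 2)" for c
      unfolding exp_add[symmetric] by (rule arg_cong[of _ _ exp]) (simp add: power2_eq_square field_simps)
    from this[of b] this[of "- b"] show ?thesis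
      by (simp add: normal_density_def distrib_left add_divide_distrib)
  qed
  show "integrable lborel (\<lambda>x. std_normal_density x * (exp (b * x) + exp (- b * x)))"
    unfolding eq by (intro Bochner_Integration.integrable_add integrable_mult_right) auto
  show "(LINT x|lborel. std_normal_density x * (exp (b * x) + exp (- b * x))) = 2 * exp (b\<^sup>2 / 2)"
    unfolding eq by (subst Bochner_Integration.integral_add) (auto intro!: integrable_mult_right)
qed

text \<open>If \<open>p\<close> grows no faster than a product of \<open>m\<close> linear factors,
  \<open>1 + x \<le> exp x\<close> turns the average into an exponential moment of a Gaussian. The
  additional exponent decreases like \<open>1 / M\<^sup>2\<close>, so the heat flow barely matters
  on large circles.\<close>

lemma norm_heat_flow_le:
  assumes s: "s \<ge> 0" and M: "M > 0"
    and p: "\<And>h. norm (poly p (z + h)) \<le> (M + norm h) ^ m"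
  shows "norm (poly (heat_flow s p) z) \<le> 2 * M ^ m * exp (s * m\<^sup>2 / M\<^sup>2)"
proof -
  let ?b = "sqrt (2 * s) * m / M"
  have "norm (poly (heat_flow s p) z) \<le> (LINT x|lborel. M ^ m * (std_normal_density x * (exp (?b * x) + exp (- ?b * x))))"
    unfolding heat_flow_integral(2)[OF s]
  proof (rule Bochner_Integration.integral_norm_bound_integral)
    show "integrable lborel (heat_kernel s p z)"
      by (rule heat_flow_integral(1)[OF s])
    show "integrable lborel (\<lambda>x. M ^ m * (std_normal_density x * (exp (?b * x) + exp (- ?b * x))))"
      by (intro integrable_mult_right gaussian_exp_abs)
    fix x :: real
    let ?r = "sqrt (2 * s) * \<bar>x\<bar>"
    have r: "norm (\<i> * of_real (sqrt (2 * s)) * complex_of_real x) = ?r" using s by (simp add: norm_mult)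
    have r0: "?r \<ge> 0" using s by simp
    have "norm (poly p (z + \<i> * of_real (sqrt (2 * s)) * complex_of_real x)) \<le> (M + ?r) ^ m"
      using p[of "\<i> * of_real (sqrt (2 * s)) * complex_of_real x"] unfolding r .
    also have "M + ?r = M * (1 + ?r / M)" using M by (simp add: field_simps)
    also have "\<dots> ^ m = M ^ m * (1 + ?r / M) ^ m" by (rule power_mult_distrib)
    also have "\<dots> \<le> M ^ m * exp (?r / M) ^ m"
      using M r0 exp_ge_add_one_self[of "?r / M"] by (intro mult_left_mono power_mono) (auto intro: add_nonneg_nonneg divide_nonneg_pos)
    also have "exp (?r / M) ^ m = exp (?b * \<bar>x\<bar>)" by (simp flip: exp_of_nat_mult)
    also have "\<dots> \<le> exp (?b * x) + exp (- ?b * x)" by (cases "x \<ge> 0") auto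
    finally have "norm (poly p (z + \<i> * of_real (sqrt (2 * s)) * complex_of_real x)) \<le> M ^ m * (exp (?b * x) + exp (- ?b * x))"
      using M by (simp add: mult_left_mono)
    from mult_left_mono[OF this normal_density_nonneg[of 0 1 x]]
    show "norm (heat_kernel s p z x) \<le>
        M ^ m * (std_normal_density x * (exp (?b * x) + exp (- ?b * x)))"
      by (simp add: norm_mult mult.left_commute)
  qed
  also have "\<dots> = M ^ m * (2 * exp (?b\<^sup>2 / 2))" unfolding integral_mult_right_zero gaussian_exp_abs(2) ..
  also have "?b\<^sup>2 / 2 = s * m\<^sup>2 / M\<^sup>2" using s by (simp add: power_mult_distrib power_divide)
  finally show ?thesis by (simp add: mult.commute mult.left_commute)
qed

text \<open>Replacing the factors \<open>z - x\<close> with \<open>x\<close> inside the circle by Blaschke-reflected ones leaves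
  the modulus on the circle unchanged, so that Jensen's formula degenerates to the maximum principle.\<close>

lemma prod_max_roots_le:
  fixes X :: "complex multiset"
  assumes L: "L > 0" and B: "\<And>z. dist z0 z = L \<Longrightarrow> norm (\<Prod>x\<in>#X. z - x) \<le> B"
  shows "(\<Prod>x\<in>#X. max L (norm (z0 - x))) \<le> B"
proof -
  define g where "g x z = (if norm (x - z0) < L then (L\<^sup>2 - cnj (x - z0) * (z - z0)) / L else z - x)" for x z
  let ?h = "\<lambda>z. \<Prod>x\<in>#X. g x z"
  have hol: "?h holomorphic_on A" for A
  proof (induction X)
    case (add x X)
    have "g x holomorphic_on A" unfolding g_def[abs_def] by (cases "norm (x - z0) < L") (auto intro!: holomorphic_intros)
    with add show ?case by (auto intro!: holomorphic_intros)
  qed auto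
  have "norm (?h z0) \<le> B"
  proof (rule maximum_modulus_frontier[of ?h "ball z0 L"])
    show "?h holomorphic_on interior (ball z0 L)" by (rule hol)
    show "continuous_on (closure (ball z0 L)) ?h" by (rule holomorphic_on_imp_continuous_on[OF hol])
    fix z assume "z \<in> frontier (ball z0 L)"
    then have d: "dist z0 z = L" using L by (simp add: frontier_ball)
    have gn: "norm (g x z) = norm (z - x)" for x
    proof (cases "norm (x - z0) < L")
      case True
      have "(z - z0) * cnj (z - z0) = L\<^sup>2"
        using d unfolding complex_norm_square[symmetric] by (simp add: dist_norm norm_minus_commute)
      then have "L\<^sup>2 - cnj (x - z0) * (z - z0) = (z - z0) * cnj (z - x)" by (simp add: algebra_simps)
      moreover have "norm ((z - z0) * cnj (z - x)) = L * norm (z - x)"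
        using d by (simp add: norm_mult dist_norm norm_minus_commute del: complex_cnj_diff)
      ultimately show ?thesis using True L by (simp add: g_def norm_divide)
    qed (simp add: g_def)
    have "norm (?h z) = norm (\<Prod>x\<in>#X. z - x)" by (induction X) (simp_all add: norm_mult gn)
    then show "norm (?h z) \<le> B" using B[OF d] by simp
  qed (use L in auto)
  \<comment> \<open>For \<open>x\<close> inside the circle the reflected factor has the value
    \<open>L\<^sup>2 / L\<close> at the center.\<close>
  moreover have "norm (g x z0) = max L (norm (z0 - x))" for x
    using L by (auto simp: g_def norm_minus_commute max_def norm_divide power2_eq_square norm_mult)
  then have "norm (?h z0) = (\<Prod>x\<in>#X. max L (norm (z0 - x)))" by (induction X) (simp_all add: norm_mult)
  ultimately show ?thesis by simp
qed

section \<open>Logarithmic potentials of limits of root measures\<close>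

text \<open>The complement of the support is covered by those members of a countable basis that are
  null sets.\<close>

lemma AE_measure_support:
  fixes M :: "'a::second_countable_topology measure"
  assumes "sets M = sets borel"
  shows "AE x in M. x \<in> measure_support M"
proof -
  obtain B :: "'a set set" where B: "countable B" "topological_basis B"
    using ex_countable_basis by blast
  let ?B = "{b \<in> B. emeasure M b = 0}"
  have op: "b \<in> sets M" if "b \<in> B" for b
    using topological_basis_open[OF B(2) that] assms by simp
  have "(\<Union>b\<in>?B. b) \<in> null_sets M"
    using B(1) op by (intro null_sets_UN') (auto intro: countable_subset)
  moreover have "{x \<in> space M. x \<notin> measure_support M} \<subseteq> (\<Union>b\<in>?B. b)"
  proof
    fix x assume "x \<in> {x \<in> space M. x \<notin> measure_support M}"
    then obtain U where U: "open U" "x \<in> U" "emeasure M U = 0"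
      by (auto simp: measure_support_def)
    obtain b where b: "b \<in> B" "x \<in> b" "b \<subseteq> U"
      using topological_basisE[OF B(2) U(1,2)] by blast
    have "emeasure M b \<le> emeasure M U" using b U assms by (intro emeasure_mono) auto
    then show "x \<in> (\<Union>b\<in>?B. b)" using b U by auto
  qed
  ultimately show ?thesis by (rule AE_I')
qed

text \<open>The exceptional value at \<open>\<xi> = z\<close> is invisible once \<open>z\<close>
  carries no mass, and integrability makes both parts finite.\<close>

lemma log_potential_eq:
  assumes "sets M = sets borel" and ae: "AE \<xi> in M. \<xi> \<noteq> z"
    and int: "integrable M (\<lambda>\<xi>. ln (cmod (z - \<xi>)))"
  shows "log_potential M z = ereal (LINT \<xi>|M. ln (cmod (z - \<xi>)))"
proof -
  let ?f = "\<lambda>\<xi>. ln (cmod (z - \<xi>))"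
  have 1: "(\<integral>\<^sup>+ \<xi>. (if \<xi> = z then \<infinity> else ennreal (- ?f \<xi>)) \<partial>M) = (\<integral>\<^sup>+ \<xi>. ennreal (- ?f \<xi>) \<partial>M)"
    using ae by (intro nn_integral_cong_AE) auto
  have fin: "(\<integral>\<^sup>+ \<xi>. ennreal (?f \<xi>) \<partial>M) \<noteq> \<infinity>" "(\<integral>\<^sup>+ \<xi>. ennreal (- ?f \<xi>) \<partial>M) \<noteq> \<infinity>"
    using int by (simp_all add: real_integrable_def)
  then have e: "enn2ereal (\<integral>\<^sup>+ \<xi>. ennreal (?f \<xi>) \<partial>M) = ereal (enn2real (\<integral>\<^sup>+ \<xi>. ennreal (?f \<xi>) \<partial>M))"
    "enn2ereal (\<integral>\<^sup>+ \<xi>. ennreal (- ?f \<xi>) \<partial>M) = ereal (enn2real (\<integral>\<^sup>+ \<xi>. ennreal (- ?f \<xi>) \<partial>M))"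
    by (metis enn2ereal_ennreal enn2real_nonneg ennreal_enn2real infinity_ennreal_def less_top)+
  show ?thesis unfolding log_potential_def 1 real_lebesgue_integral_def[OF int] e by simp
qed

text \<open>Since \<open>(a + h) * (a - h) = a\<^sup>2 - h\<^sup>2\<close>, the linear terms cancel
  and only \<open>ln (norm (1 - (h / a)\<^sup>2))\<close> is left.\<close>

lemma ln_second_difference:
  fixes a h :: complex
  assumes "norm h \<le> norm a / 2" "a \<noteq> 0"
  shows "\<bar>ln (norm (a + h)) + ln (norm (a - h)) - 2 * ln (norm a)\<bar> \<le> 4 * (norm h)\<^sup>2 / (norm a)\<^sup>2"
proof -
  define q where "q = (norm h)\<^sup>2 / (norm a)\<^sup>2"
  have a0: "norm a > 0" using assms by simp
  have "(norm h)\<^sup>2 \<le> (norm a / 2)\<^sup>2" using assms by (intro power_mono) auto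
  then have q: "0 \<le> q" "q \<le> 1/4" using a0 by (auto simp: q_def power_divide field_simps)
  have nz: "a + h \<noteq> 0" "a - h \<noteq> 0" using assms a0 by (auto simp: add_eq_0_iff)
  have eq: "(a + h) * (a - h) / a\<^sup>2 = 1 - (h / a)\<^sup>2" using assms by (simp add: power2_eq_square field_simps)
  have "ln (norm (a + h)) + ln (norm (a - h)) - 2 * ln (norm a) = ln (norm ((a + h) * (a - h) / a\<^sup>2))"
    using nz assms(2) by (simp add: norm_mult norm_divide norm_power ln_mult ln_div ln_realpow)
  also have "\<dots> = ln (norm (1 - (h / a)\<^sup>2))" unfolding eq ..
  finally have 1: "ln (norm (a + h)) + ln (norm (a - h)) - 2 * ln (norm a) = ln (norm (1 - (h / a)\<^sup>2))" .
  have nq: "norm ((h / a)\<^sup>2) = q" by (simp add: q_def norm_power norm_divide power_divide)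
  have lo: "1 - q \<le> norm (1 - (h / a)\<^sup>2)" and up: "norm (1 - (h / a)\<^sup>2) \<le> 1 + q"
    using norm_triangle_ineq2[of 1 "(h / a)\<^sup>2"] norm_triangle_ineq4[of 1 "(h / a)\<^sup>2"] nq by auto
  have "- q - 2 * q\<^sup>2 \<le> ln (1 - q)" using q by (intro ln_one_minus_pos_lower_bound) auto
  also have "\<dots> \<le> ln (norm (1 - (h / a)\<^sup>2))" using lo q by (subst ln_le_cancel_iff) auto
  finally have "- q - 2 * q\<^sup>2 \<le> ln (norm (1 - (h / a)\<^sup>2))" .
  moreover have "q\<^sup>2 \<le> q * 1" unfolding power2_eq_square using q by (intro mult_left_mono) auto
  moreover have "ln (norm (1 - (h / a)\<^sup>2)) \<le> ln (1 + q)" using up lo q by (subst ln_le_cancel_iff) auto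
  moreover have "ln (1 + q) \<le> q" using q(1) by (rule ln_add_one_self_le_self)
  ultimately have "\<bar>ln (norm (1 - (h / a)\<^sup>2))\<bar> \<le> 4 * q" using q by linarith
  then show ?thesis unfolding 1 by (simp add: q_def)
qed

abbreviation lnd :: "complex \<Rightarrow> complex \<Rightarrow> real" where
  "lnd z \<equiv> \<lambda>\<xi>. ln (norm (z - \<xi>))"

text \<open>The assumption \<open>tails\<close> is uniform integrability of the logarithm at infinity, which weak convergence
  against bounded functions does not provide.\<close>

locale root_limit = prob_space \<mu> for \<mu> :: "complex measure" +
  fixes X :: "nat \<Rightarrow> complex multiset"
  assumes sets_eq: "sets \<mu> = sets borel"
    and compact_support: "compact (measure_support \<mu>)"
    and size_pos: "\<forall>\<^sub>F n in sequentially. size (X n) > 0"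
    and weak: "\<And>f. continuous_on UNIV f \<Longrightarrow> bounded (range f) \<Longrightarrow>
      (\<lambda>n. (\<Sum>x\<in>#X n. f x) / size (X n)) \<longlonglongrightarrow> (LINT \<xi>|\<mu>. f \<xi> :: real)"
    and tails: "\<And>z0. \<exists>T. (T \<longlongrightarrow> (0::real)) at_top \<and>
      (\<forall>L>0. \<forall>\<^sub>F n in sequentially. (\<Sum>x\<in>#X n. ln (max L (norm (z0 - x)))) / size (X n) \<le> ln L + T L)"
begin

abbreviation pot :: "complex \<Rightarrow> real" where
  "pot z \<equiv> LINT \<xi>|\<mu>. ln (norm (z - \<xi>))"

lemma space_eq: "space \<mu> = UNIV"
  using sets_eq_imp_space_eq[OF sets_eq] by simp

lemma measurable_mu: "f \<in> borel_measurable borel \<Longrightarrow> f \<in> borel_measurable \<mu>"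
  using measurable_cong_sets[OF sets_eq refl] by blast

lemma AE_support: "AE \<xi> in \<mu>. \<xi> \<in> measure_support \<mu>"
  by (rule AE_measure_support[OF sets_eq])

text \<open>A continuous tent function, positive exactly on the ball, has integral 0 in the
  limit.\<close>

lemma root_free_null:
  assumes r: "r > 0" and free: "\<forall>\<^sub>F n in sequentially. \<forall>x\<in>#X n. x \<notin> ball z0 r"
  shows "AE \<xi> in \<mu>. \<xi> \<notin> ball z0 r"
proof -
  let ?f = "\<lambda>\<xi>. max 0 (r - dist z0 \<xi>)"
  have cont: "continuous_on UNIV ?f" by (intro continuous_intros)
  have bd: "\<bar>?f \<xi>\<bar> \<le> r" for \<xi> using r by auto
  then have bdd: "bounded (range ?f)" by (intro boundedI[of _ r]) auto
  have "\<forall>\<^sub>F n in sequentially. (\<Sum>x\<in>#X n. ?f x) / size (X n) = 0"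
    using free
  proof eventually_elim
    case (elim n)
    have "(\<Sum>x\<in>#X n. ?f x) = (\<Sum>x\<in>#X n. 0)"
      by (intro arg_cong[of _ _ sum_mset] image_mset_cong) (use elim in \<open>auto simp: not_less\<close>)
    then show ?case by simp
  qed
  then have "(\<lambda>n. (\<Sum>x\<in>#X n. ?f x) / size (X n)) \<longlonglongrightarrow> 0"
    by (rule tendsto_eventually)
  from LIMSEQ_unique[OF weak[OF cont bdd] this] have int0: "(LINT \<xi>|\<mu>. ?f \<xi>) = 0" .
  have meas: "?f \<in> borel_measurable \<mu>"
    by (rule measurable_mu[OF borel_measurable_continuous_onI[OF cont]])
  have "integrable \<mu> ?f"
    by (rule integrable_const_bound[OF _ meas, of r]) (use bd in auto)
  from integral_nonneg_eq_0_iff_AE[OF this] int0 have "AE \<xi> in \<mu>. ?f \<xi> = 0" by auto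
  then show ?thesis by eventually_elim (auto simp: max_def split: if_splits)
qed

lemma support_bounded:
  obtains L where "L \<ge> 1" "\<And>\<xi>. \<xi> \<in> measure_support \<mu> \<Longrightarrow> norm (z0 - \<xi>) \<le> L"
proof -
  have "bounded (measure_support \<mu>)" using compact_support by (rule compact_imp_bounded)
  then obtain e where e: "\<And>\<xi>. \<xi> \<in> measure_support \<mu> \<Longrightarrow> dist z0 \<xi> \<le> e"
    unfolding bounded_any_center[where a = z0] by blast
  have "norm (z0 - \<xi>) \<le> max 1 e" if "\<xi> \<in> measure_support \<mu>" for \<xi>
    using e[OF that] by (simp add: dist_norm)
  then show ?thesis by (intro that[of "max 1 e"]) auto
qed

text \<open>Weak convergence needs bounded continuous test functions. Cutting the logarithm below at
  \<open>ln r\<close> changes nothing since the ball contains no roots; the part above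
  \<open>ln L\<close> is controlled by \<open>tails\<close> and disappears as \<open>L\<close>
  grows.\<close>

lemma potential_root_free:
  assumes r: "r > 0" and free: "\<forall>\<^sub>F n in sequentially. \<forall>x\<in>#X n. x \<notin> ball z0 r"
    and lim: "(\<lambda>n. (\<Sum>x\<in>#X n. ln (norm (z0 - x))) / size (X n)) \<longlonglongrightarrow> V"
  shows "integrable \<mu> (lnd z0)" "pot z0 = V"
proof -
  obtain L0 where L0: "L0 \<ge> 1" "\<And>\<xi>. \<xi> \<in> measure_support \<mu> \<Longrightarrow> norm (z0 - \<xi>) \<le> L0"
    using support_bounded by blast
  define \<phi> where "\<phi> L \<xi> = ln (min L (max r (norm (z0 - \<xi>))))" for L \<xi>
  have c\<phi>: "continuous_on UNIV (\<phi> L)" if "L > 0" for L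
    unfolding \<phi>_def using r that by (intro continuous_intros) (auto simp: min_def max_def)
  have b\<phi>: "\<bar>\<phi> L \<xi>\<bar> \<le> \<bar>ln r\<bar> + \<bar>ln L\<bar>" if "L \<ge> r" for L \<xi>
  proof -
    have "ln r \<le> \<phi> L \<xi>" "\<phi> L \<xi> \<le> ln L" unfolding \<phi>_def using r that by (subst ln_le_cancel_iff; auto)+
    then show ?thesis by linarith
  qed
  have bdd: "bounded (range (\<phi> L))" if "L \<ge> r" for L
    using b\<phi>[OF that] by (intro boundedI[of _ "\<bar>ln r\<bar> + \<bar>ln L\<bar>"]) auto
  have meas: "\<phi> L \<in> borel_measurable \<mu>" if "L > 0" for L
    by (rule measurable_mu[OF borel_measurable_continuous_onI[OF c\<phi>[OF that]]])
  have int\<phi>: "integrable \<mu> (\<phi> L)" if "L \<ge> r" "L > 0" for L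
    by (rule integrable_const_bound[where B = "\<bar>ln r\<bar> + \<bar>ln L\<bar>"]) (use b\<phi> meas that in auto)
  have ae: "AE \<xi> in \<mu>. ln (norm (z0 - \<xi>)) = \<phi> L \<xi>" if "L \<ge> L0" for L
    using AE_support root_free_null[OF r free]
  proof eventually_elim
    case (elim \<xi>)
    then have "r \<le> norm (z0 - \<xi>)" "norm (z0 - \<xi>) \<le> L" using L0(2)[of \<xi>] that by (auto simp: dist_norm)
    then show ?case by (simp add: \<phi>_def)
  qed
  have lm: "(lnd z0) \<in> borel_measurable \<mu>"
    by (rule measurable_mu) measurable
  let ?L1 = "max L0 r"
  have eqI: "pot z0 = (LINT \<xi>|\<mu>. \<phi> L \<xi>)" if "L \<ge> ?L1" for L
    using that L0(1) by (intro integral_cong_AE lm meas ae) auto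
  show "integrable \<mu> (lnd z0)"
    using integrable_cong_AE[OF lm meas[of ?L1] ae[of ?L1]] int\<phi>[of ?L1] L0(1) by simp
  obtain T where T: "(T \<longlongrightarrow> (0::real)) at_top"
    "\<And>L. L > 0 \<Longrightarrow> \<forall>\<^sub>F n in sequentially. (\<Sum>x\<in>#X n. ln (max L (norm (z0 - x)))) / size (X n) \<le> ln L + T L"
    using tails[of z0] by blast
  let ?I = "LINT \<xi>|\<mu>. ln (norm (z0 - \<xi>))"
  have bounds: "?I \<le> V \<and> V \<le> ?I + T L" if L: "L \<ge> ?L1" for L
  proof -
    have L': "L > 0" "L \<ge> r" using L L0(1) by auto
    note w = weak[OF c\<phi>[OF L'(1)] bdd[OF L'(2)]]
    have "\<forall>\<^sub>F n in sequentially. (\<Sum>x\<in>#X n. \<phi> L x) / size (X n) \<le> (\<Sum>x\<in>#X n. ln (norm (z0 - x))) / size (X n)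
       \<and> (\<Sum>x\<in>#X n. ln (norm (z0 - x))) / size (X n) \<le> (\<Sum>x\<in>#X n. \<phi> L x) / size (X n) + T L"
      using free T(2)[OF L'(1)] size_pos
    proof eventually_elim
      case (elim n)
      have out: "norm (z0 - x) \<ge> r" if "x \<in># X n" for x using elim(1) that by (auto simp: dist_norm)
      have "(\<Sum>x\<in>#X n. \<phi> L x) \<le> (\<Sum>x\<in>#X n. ln (norm (z0 - x)))"
      proof (rule sum_mset_mono)
        fix x assume "x \<in># X n"
        from out[OF this] r L' show "\<phi> L x \<le> ln (norm (z0 - x))" unfolding \<phi>_def by (subst ln_le_cancel_iff) auto
      qed
      \<comment> \<open>Splits the logarithm at the level \<open>L\<close>: two numbers have the
        same sum as their \<open>min\<close> and their \<open>max\<close>.\<close>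
      moreover have "(\<Sum>x\<in>#X n. ln (norm (z0 - x))) + (\<Sum>x\<in>#X n. ln L) =
          (\<Sum>x\<in>#X n. \<phi> L x) + (\<Sum>x\<in>#X n. ln (max L (norm (z0 - x))))"
        unfolding sum_mset.distrib[symmetric]
      proof (rule arg_cong[of _ _ sum_mset], rule image_mset_cong)
        fix x assume "x \<in># X n"
        from out[OF this] show "ln (norm (z0 - x)) + ln L = \<phi> L x + ln (max L (norm (z0 - x)))"
          unfolding \<phi>_def by (auto simp: min_def max_def)
      qed
      moreover have "(\<Sum>x\<in>#X n. ln L) = size (X n) * ln L" by simp
      ultimately show ?case using elim(2,3) by (simp add: field_simps)
    qed
    then have "\<forall>\<^sub>F n in sequentially. (\<Sum>x\<in>#X n. \<phi> L x) / size (X n) \<le> (\<Sum>x\<in>#X n. ln (norm (z0 - x))) / size (X n)"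
      "\<forall>\<^sub>F n in sequentially. (\<Sum>x\<in>#X n. ln (norm (z0 - x))) / size (X n) \<le> (\<Sum>x\<in>#X n. \<phi> L x) / size (X n) + T L"
      by (auto elim: eventually_mono)
    then have "(LINT \<xi>|\<mu>. \<phi> L \<xi>) \<le> V" "V \<le> (LINT \<xi>|\<mu>. \<phi> L \<xi>) + T L"
      using tendsto_le[OF sequentially_bot lim w] tendsto_le[OF sequentially_bot tendsto_add[OF w tendsto_const] lim] by auto
    then show ?thesis using eqI[OF L] by simp
  qed
  have "V \<le> ?I + 0"
  proof (rule tendsto_lowerbound[OF tendsto_add[OF tendsto_const T(1)]])
    show "\<forall>\<^sub>F L in at_top. V \<le> ?I + T L"
      using eventually_ge_at_top[of ?L1] by eventually_elim (use bounds in blast)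
  qed simp
  moreover have "?I \<le> V" using bounds[of ?L1] by blast
  ultimately show "?I = V" by simp
qed

text \<open>Fatou's lemma along \<open>v m\<close> bounds the potential at \<open>z\<close>; then \<open>ln (norm (z - \<xi>))\<close> dominates.\<close>

lemma potential_limit:
  assumes w: "v \<longlonglongrightarrow> z" and ne: "\<And>m. v m \<noteq> z" and c: "c > 0"
    and sep: "\<And>m. AE \<xi> in \<mu>. norm (v m - \<xi>) \<ge> c * norm (z - \<xi>)"
    and aev: "\<And>m. AE \<xi> in \<mu>. \<xi> \<noteq> v m"
    and int: "\<And>m. integrable \<mu> (lnd (v m))"
    and lim: "(\<lambda>m. pot (v m)) \<longlonglongrightarrow> V"
  shows "AE \<xi> in \<mu>. \<xi> \<noteq> z" "integrable \<mu> (lnd z)" "pot z = V"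
proof -
  obtain L0 where L0: "L0 \<ge> 1" "\<And>\<xi>. \<xi> \<in> measure_support \<mu> \<Longrightarrow> norm (z - \<xi>) \<le> L0"
    using support_bounded by blast
  have "bounded (range v)" using convergent_imp_bounded[OF w] .
  then obtain e where e: "\<And>m. dist z (v m) \<le> e" unfolding bounded_any_center[where a = z] by blast
  define L where "L = L0 + e"
  have e0: "e \<ge> 0" using e[of 0] zero_le_dist order_trans by blast
  have L: "L \<ge> 1" "norm (v m - \<xi>) \<le> L" if "\<xi> \<in> measure_support \<mu>" for m \<xi>
    using L0(1) L0(2)[OF that] e0 e[of m] norm_triangle_ineq[of "v m - z" "z - \<xi>"]
    by (auto simp: L_def dist_norm norm_minus_commute)
  have L1: "L \<ge> 1" using L0(1) e0 by (simp add: L_def)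
  have lm: "(lnd u) \<in> borel_measurable \<mu>" for u
    by (rule measurable_mu) measurable
  let ?g = "\<lambda>m \<xi>. ennreal (ln L - ln (norm (v m - \<xi>)))"
  \<comment> \<open>The value \<open>\<infinity>\<close> at \<open>z\<close> is the true limit of
    \<open>?g\<close>, whereas \<open>ln 0\<close> is finite in HOL. With it, finiteness of the
    integral excludes a point mass at \<open>z\<close>.\<close>
  let ?h = "\<lambda>\<xi>. if \<xi> = z then \<infinity> else ennreal (ln L - ln (norm (z - \<xi>)))"
  have lim\<xi>: "(\<lambda>m. norm (v m - \<xi>)) \<longlonglongrightarrow> norm (z - \<xi>)" for \<xi>
    by (intro tendsto_intros w)
  have pw: "(\<lambda>m. ?g m \<xi>) \<longlonglongrightarrow> ?h \<xi>" for \<xi>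
  proof (cases "\<xi> = z")
    case True
    have "(\<lambda>m. norm (v m - z)) \<longlonglongrightarrow> 0" using lim\<xi>[of z] by simp
    moreover have "\<forall>\<^sub>F m in sequentially. norm (v m - z) > 0" using ne by simp
    ultimately have "filterlim (\<lambda>m. norm (v m - z)) (at_right 0) sequentially"
      by (intro tendsto_imp_filterlim_at_right)
    from filterlim_compose[OF ln_at_0 this]
    have "filterlim (\<lambda>m. ln (norm (v m - z))) at_bot sequentially" .
    then have "filterlim (\<lambda>m. - ln (norm (v m - z))) at_top sequentially"
      by (simp add: filterlim_uminus_at_top)
    from filterlim_tendsto_add_at_top[OF tendsto_const[of "ln L"] this]
    have "filterlim (\<lambda>m. ln L - ln (norm (v m - z))) at_top sequentially" by simp
    then have "(\<lambda>m. ?g m z) \<longlonglongrightarrow> \<infinity>" by (simp add: ennreal_tendsto_top_eq_at_top infinity_ennreal_def)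
    then show ?thesis using True by simp
  next
    case False
    have "(\<lambda>m. ln L - ln (norm (v m - \<xi>))) \<longlonglongrightarrow> ln L - ln (norm (z - \<xi>))"
      using False by (intro tendsto_diff tendsto_const tendsto_ln lim\<xi>) simp
    from tendsto_ennrealI[OF this] show ?thesis using False by simp
  qed
  have "(\<integral>\<^sup>+ \<xi>. ?h \<xi> \<partial>\<mu>) = (\<integral>\<^sup>+ \<xi>. liminf (\<lambda>m. ?g m \<xi>) \<partial>\<mu>)"
    using lim_imp_Liminf[OF sequentially_bot pw] by simp
  also have "\<dots> \<le> liminf (\<lambda>m. \<integral>\<^sup>+ \<xi>. ?g m \<xi> \<partial>\<mu>)"
    by (rule nn_integral_liminf) (use lm in measurable)
  also have "(\<lambda>m. \<integral>\<^sup>+ \<xi>. ?g m \<xi> \<partial>\<mu>) = (\<lambda>m. ennreal (ln L - pot (v m)))"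
  proof
    fix m
    have "(\<integral>\<^sup>+ \<xi>. ?g m \<xi> \<partial>\<mu>) = ennreal (LINT \<xi>|\<mu>. ln L - ln (norm (v m - \<xi>)))"
    proof (rule nn_integral_eq_integral)
      show "integrable \<mu> (\<lambda>\<xi>. ln L - ln (norm (v m - \<xi>)))" using int by simp
      show "AE \<xi> in \<mu>. 0 \<le> ln L - ln (norm (v m - \<xi>))"
        using AE_support aev[of m]
      proof eventually_elim
        case (elim \<xi>)
        then show ?case using L(2)[OF elim(1), of m] L1 by (simp add: ln_le_cancel_iff)
      qed
    qed
    then show "(\<integral>\<^sup>+ \<xi>. ?g m \<xi> \<partial>\<mu>) = ennreal (ln L - pot (v m))"
      using int prob_space by simp
  qed
  also have "liminf \<dots> = ennreal (ln L - V)"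
    by (intro lim_imp_Liminf tendsto_ennrealI tendsto_diff tendsto_const lim) simp
  finally have le: "(\<integral>\<^sup>+ \<xi>. ?h \<xi> \<partial>\<mu>) \<le> ennreal (ln L - V)" .
  then have fin: "(\<integral>\<^sup>+ \<xi>. ?h \<xi> \<partial>\<mu>) \<noteq> \<infinity>" by (metis ennreal_less_top infinity_ennreal_def leD)
  have hm: "?h \<in> borel_measurable \<mu>"
    by (rule measurable_mu) measurable
  from nn_integral_PInf_AE[OF hm fin] show aez: "AE \<xi> in \<mu>. \<xi> \<noteq> z" by eventually_elim (auto split: if_splits)
  have "(\<integral>\<^sup>+ \<xi>. ennreal (ln L - ln (norm (z - \<xi>))) \<partial>\<mu>) = (\<integral>\<^sup>+ \<xi>. ?h \<xi> \<partial>\<mu>)"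
    using aez by (intro nn_integral_cong_AE) auto
  then have fin2: "(\<integral>\<^sup>+ \<xi>. ennreal (ln L - ln (norm (z - \<xi>))) \<partial>\<mu>) < \<infinity>" using fin by (simp add: less_top)
  have zL: "AE \<xi> in \<mu>. 0 \<le> ln L - ln (norm (z - \<xi>))"
    using AE_support aez
  proof eventually_elim
    case (elim \<xi>)
    have "norm (z - \<xi>) \<le> L" using L0(2)[OF elim(1)] e0 by (simp add: L_def)
    then show ?case using elim(2) L1 by (simp add: ln_le_cancel_iff)
  qed
  have "integrable \<mu> (\<lambda>\<xi>. ln L - ln (norm (z - \<xi>)))"
    by (rule integrableI_nonneg[OF _ zL fin2]) (use lm in measurable)
  from Bochner_Integration.integrable_diff[OF integrable_const[of "ln L"] this]
  show intz: "integrable \<mu> (lnd z)" by simp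
  \<comment> \<open>The bounded support gives the majorant from above, \<open>sep\<close> the one
    from below at the price of the constant \<open>ln c\<close>.\<close>
  have "(\<lambda>m. pot (v m)) \<longlonglongrightarrow> pot z"
  proof (rule integral_dominated_convergence[where w = "\<lambda>\<xi>. \<bar>ln L\<bar> + \<bar>ln c\<bar> + \<bar>ln (norm (z - \<xi>))\<bar>"])
    show "AE \<xi> in \<mu>. (\<lambda>m. ln (norm (v m - \<xi>))) \<longlonglongrightarrow> ln (norm (z - \<xi>))"
      using aez by eventually_elim (intro tendsto_ln lim\<xi>, simp)
    show "AE \<xi> in \<mu>. norm (ln (norm (v m - \<xi>))) \<le> \<bar>ln L\<bar> + \<bar>ln c\<bar> + \<bar>ln (norm (z - \<xi>))\<bar>" for m
      using AE_support aev[of m] aez sep[of m]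
    proof eventually_elim
      case (elim \<xi>)
      have "ln (norm (v m - \<xi>)) \<le> ln L" using L(2)[OF elim(1), of m] L1 elim(2) by (subst ln_le_cancel_iff) auto
      moreover have "ln (c * norm (z - \<xi>)) \<le> ln (norm (v m - \<xi>))"
        using elim c by (subst ln_le_cancel_iff) auto
      moreover have "ln (c * norm (z - \<xi>)) = ln c + ln (norm (z - \<xi>))" using elim c by (simp add: ln_mult)
      ultimately show ?case by simp
    qed
  qed (use lm intz in auto)
  from LIMSEQ_unique[OF this lim] show "pot z = V" .
qed

text \<open>Away from the support the kernel is smooth uniformly in \<open>\<xi>\<close>, so
  symmetric second differences are quadratic in \<open>h\<close>. This is the test that a kink
  fails.\<close>

lemma potential_second_difference:
  assumes z: "z \<notin> measure_support \<mu>" and R: "R > 0"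
    and pot: "\<And>w. w \<in> ball z R \<Longrightarrow>
      integrable \<mu> (lnd w) \<and> pot w = V w"
  obtains C r where "r > 0" "\<And>h. norm h < r \<Longrightarrow> \<bar>V (z + h) + V (z - h) - 2 * V z\<bar> \<le> C * (norm h)\<^sup>2"
proof -
  obtain U where U: "open U" "z \<in> U" "emeasure \<mu> U = 0"
    using z by (auto simp: measure_support_def)
  obtain d where d: "d > 0" "ball z d \<subseteq> U" using U openE by blast
  have ae: "AE \<xi> in \<mu>. \<xi> \<notin> U" using U sets_eq by (intro AE_not_in) (auto simp: null_sets_def)
  define r where "r = min R (d / 2)"
  have "\<bar>V (z + h) + V (z - h) - 2 * V z\<bar> \<le> 4 / d\<^sup>2 * (norm h)\<^sup>2" if h: "norm h < r" for h
  proof -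
    have "z + h \<in> ball z R" "z - h \<in> ball z R" "z \<in> ball z R" using h R by (auto simp: r_def dist_norm)
    note p = this[THEN pot]
    have "V (z + h) + V (z - h) - 2 * V z =
        (LINT \<xi>|\<mu>. ln (norm (z + h - \<xi>)) + ln (norm (z - h - \<xi>)) - 2 * ln (norm (z - \<xi>)))"
      using p by simp
    also have "\<bar>\<dots>\<bar> \<le> (LINT \<xi>|\<mu>. \<bar>ln (norm (z + h - \<xi>)) + ln (norm (z - h - \<xi>)) - 2 * ln (norm (z - \<xi>))\<bar>)"
      by (rule integral_abs_bound)
    also have "\<dots> \<le> 4 / d\<^sup>2 * (norm h)\<^sup>2"
    proof (rule integral_le_const)
      show "integrable \<mu> (\<lambda>\<xi>. \<bar>ln (norm (z + h - \<xi>)) + ln (norm (z - h - \<xi>)) - 2 * ln (norm (z - \<xi>))\<bar>)"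
        using p by (intro integrable_abs Bochner_Integration.integrable_add Bochner_Integration.integrable_diff integrable_mult_right) auto
      show "AE \<xi> in \<mu>. \<bar>ln (norm (z + h - \<xi>)) + ln (norm (z - h - \<xi>)) - 2 * ln (norm (z - \<xi>))\<bar> \<le> 4 / d\<^sup>2 * (norm h)\<^sup>2"
        using ae
      proof eventually_elim
        case (elim \<xi>)
        then have a: "norm (z - \<xi>) \<ge> d" using d by (auto simp: dist_norm subset_iff not_less[symmetric])
        have "\<bar>ln (norm ((z - \<xi>) + h)) + ln (norm ((z - \<xi>) - h)) - 2 * ln (norm (z - \<xi>))\<bar> \<le>
            4 * (norm h)\<^sup>2 / (norm (z - \<xi>))\<^sup>2"
          using a h d by (intro ln_second_difference) (auto simp: r_def)
        also have "\<dots> \<le> 4 * (norm h)\<^sup>2 / d\<^sup>2"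
        proof (intro divide_left_mono power_mono mult_pos_pos zero_less_power)
          show "0 < norm (z - \<xi>)" using a d by linarith
        qed (use a d in auto)
        finally show ?case by (simp add: algebra_simps)
      qed
    qed
    finally show ?thesis .
  qed
  moreover have "r > 0" using d R by (simp add: r_def)
  ultimately show ?thesis by (intro that)
qed

end

section \<open>Roots of the evolved powers\<close>

lemma sum_mset_eq_sum_count:
  fixes f :: "'a \<Rightarrow> real"
  assumes "finite A" "set_mset X \<subseteq> A"
  shows "(\<Sum>x\<in>#X. f x) = (\<Sum>x\<in>A. real (count X x) * f x)"
  using assms(2)
proof (induction X)
  case (add y X)
  have "(\<Sum>x\<in>A. real (count (add_mset y X) x) * f x) =
      (\<Sum>x\<in>A. real (count X x) * f x + (if x = y then f x else 0))"
    by (intro sum.cong) (auto simp: algebra_simps)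
  also have "\<dots> = (\<Sum>x\<in>A. real (count X x) * f x) + f y"
    using add.prems assms(1) by (simp add: sum.distrib)
  finally show ?case using add by simp
qed simp

lemma base_poly_nonzero: "base_poly d lam a \<noteq> 0"
  by (simp add: base_poly_def)

lemma degree_base_poly_power: "degree (base_poly d lam a ^ n) = n * total_mult d a"
proof -
  have "degree (base_poly d lam a) = (\<Sum>j\<in>{1..d}. degree ([:- lam j, 1:] ^ a j))"
    unfolding base_poly_def by (rule degree_prod_eq_sum_degree) simp
  also have "\<dots> = total_mult d a" by (simp add: total_mult_def degree_power_eq)
  finally show ?thesis using base_poly_nonzero[of d lam a] by (simp add: degree_power_eq)
qed

lemma lead_coeff_base_poly_power: "lead_coeff (base_poly d lam a ^ n) = 1"
  by (simp add: base_poly_def lead_coeff_power lead_coeff_prod)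

lemma poly_base_poly_power: "poly (base_poly d lam a ^ n) z = (\<Prod>j\<in>{1..d}. (z - lam j) ^ (n * a j))"
  by (simp add: base_poly_def poly_prod prod_power_distrib mult.commute flip: power_mult)

lemma degree_evolved_power: "degree (evolved_power d lam a t n) = n * total_mult d a"
  by (simp add: evolved_power_def degree_heat_flow degree_base_poly_power)

lemma lead_coeff_evolved_power: "lead_coeff (evolved_power d lam a t n) = 1"
  by (simp add: evolved_power_def lead_coeff_heat_flow lead_coeff_base_poly_power)

lemma evolved_power_nonzero: "evolved_power d lam a t n \<noteq> 0"
  using lead_coeff_evolved_power[of d lam a t n] by auto

lemma size_roots_evolved_power: "size (proots (evolved_power d lam a t n)) = n * total_mult d a"
  by (simp add: size_proots_complex degree_evolved_power)

lemma poly_evolved_power: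
  "poly (evolved_power d lam a t n) z = (\<Prod>x\<in>#proots (evolved_power d lam a t n). z - x)"
proof -
  let ?p = "evolved_power d lam a t n"
  have "?p = (\<Prod>x\<in>#proots ?p. [:- x, 1:])"
    using complex_poly_decompose_multiset[of ?p] lead_coeff_evolved_power[of d lam a t n] by simp
  then have "poly ?p z = poly (\<Prod>x\<in>#proots ?p. [:- x, 1:]) z" by simp
  also have "\<dots> = (\<Prod>x\<in>#proots ?p. z - x)" by (induction "proots ?p") (simp_all add: poly_prod_mset image_mset.compositionality o_def)
  finally show ?thesis .
qed

lemma integral_zero_measure:
  fixes f :: "complex \<Rightarrow> real"
  assumes f: "continuous_on UNIV f"
  shows "integral\<^sup>L (zero_measure d lam a t n) f =
    (\<Sum>x\<in>#proots (evolved_power d lam a t n). f x) / (total_mult d a * n)"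
proof -
  let ?p = "evolved_power d lam a t n"
  let ?A = "{l. poly ?p l = 0}" and ?N = "real (total_mult d a) * real n"
  have fin: "finite ?A" by (rule poly_roots_finite[OF evolved_power_nonzero])
  have fm: "f \<in> borel_measurable borel" by (rule borel_measurable_continuous_onI[OF f])
  have "integral\<^sup>L (zero_measure d lam a t n) f =
      (LINT l|point_measure ?A (\<lambda>l. ennreal (real (order l ?p) / ?N)). f l)"
    unfolding zero_measure_def Let_def by (rule integral_distr[OF _ fm]) (auto simp: measurable_def space_point_measure sets_point_measure)
  also have "\<dots> = (\<Sum>l\<in>?A. (real (order l ?p) / ?N) *\<^sub>R f l)"
    by (rule lebesgue_integral_point_measure_finite[OF fin]) auto
  also have "\<dots> = (\<Sum>l\<in>?A. real (order l ?p) * f l) / ?N"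
    by (simp add: sum_divide_distrib)
  also have "(\<Sum>l\<in>?A. real (order l ?p) * f l) = (\<Sum>x\<in>#proots ?p. f x)"
    using evolved_power_nonzero[of d lam a t n]
    by (subst sum_mset_eq_sum_count[OF fin]) auto
  finally show ?thesis by simp
qed

text \<open>The heat time is \<open>t\<close> divided by twice the degree, so in
  \<open>norm_heat_flow_le\<close> the square of the degree is reduced to its first power.\<close>

lemma norm_evolved_power_le:
  assumes t: "t > 0" and M: "M > 0" and far: "\<And>j. j \<in> {1..d} \<Longrightarrow> norm (z - lam j) \<le> M"
    and N: "n * total_mult d a > 0"
  shows "norm (poly (evolved_power d lam a t n) z) \<le>
    2 * M ^ (n * total_mult d a) * exp (real (n * total_mult d a) * (t / (2 * M\<^sup>2)))"
proof -
  let ?N = "n * total_mult d a"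
  have "norm (poly (base_poly d lam a ^ n) (z + h)) \<le> (M + norm h) ^ ?N" for h
  proof -
    have "norm (poly (base_poly d lam a ^ n) (z + h)) = (\<Prod>j\<in>{1..d}. norm (z + h - lam j) ^ (n * a j))"
      unfolding poly_base_poly_power by (simp add: norm_power flip: prod_norm)
    also have "\<dots> \<le> (\<Prod>j\<in>{1..d}. (M + norm h) ^ (n * a j))"
    proof (intro prod_mono conjI power_mono)
      fix j assume "j \<in> {1..d}"
      then show "norm (z + h - lam j) \<le> M + norm h"
        using far[of j] norm_triangle_ineq[of "z - lam j" h] by (simp add: algebra_simps)
    qed auto
    also have "\<dots> = (M + norm h) ^ ?N"
      by (simp add: total_mult_def sum_distrib_left flip: power_sum)
    finally show ?thesis .
  qed
  from norm_heat_flow_le[OF _ M this, of "t / (2 * real (total_mult d a) * real n)"]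
  have "norm (poly (evolved_power d lam a t n) z) \<le>
      2 * M ^ ?N * exp (t / (2 * real (total_mult d a) * real n) * (real ?N)\<^sup>2 / M\<^sup>2)"
    using t unfolding evolved_power_def by simp
  also have "t / (2 * real (total_mult d a) * real n) * (real ?N)\<^sup>2 / M\<^sup>2 = real ?N * (t / (2 * M\<^sup>2))"
    using N by (simp add: power2_eq_square)
  finally show ?thesis .
qed

lemma root_limit_evolved:
  assumes d: "d \<ge> 1" and a: "\<And>j. j \<in> {1..d} \<Longrightarrow> a j \<ge> 1" and t: "t > 0"
    and \<mu>: "prob_space \<mu>" "sets \<mu> = sets borel" "compact (measure_support \<mu>)"
      "weakly_converges (zero_measure d lam a t) \<mu>"
  shows "root_limit \<mu> (\<lambda>n. proots (evolved_power d lam a t n))"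
proof -
  let ?X = "\<lambda>n. proots (evolved_power d lam a t n)" and ?\<alpha> = "total_mult d a"
  have al: "?\<alpha> > 0"
  proof -
    have "a 1 \<le> ?\<alpha>" unfolding total_mult_def by (rule member_le_sum) (use d in auto)
    then show ?thesis using a[of 1] d by simp
  qed
  interpret prob_space \<mu> by (rule \<mu>(1))
  show ?thesis
  proof
    show "\<forall>\<^sub>F n in sequentially. 0 < size (?X n)"
      using eventually_gt_at_top[of 0] by eventually_elim (simp add: size_roots_evolved_power al)
    show "(\<lambda>n. (\<Sum>x\<in>#?X n. f x) / real (size (?X n))) \<longlonglongrightarrow> (LINT \<xi>|\<mu>. f \<xi>)"
      if "continuous_on UNIV f" "bounded (range f)" for f :: "complex \<Rightarrow> real"
      using \<mu>(4) that unfolding weakly_converges_def integral_zero_measure[OF that(1)] size_roots_evolved_power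
      by (simp add: integral_zero_measure mult.commute)
    show "\<exists>T. (T \<longlongrightarrow> (0::real)) at_top \<and> (\<forall>L>0. \<forall>\<^sub>F n in sequentially.
        (\<Sum>x\<in>#?X n. ln (max L (norm (z0 - x)))) / real (size (?X n)) \<le> ln L + T L)" for z0
    proof -
      define r where "r = Max ((\<lambda>j. norm (z0 - lam j)) ` {1..d})"
      have r: "norm (z0 - lam j) \<le> r" if "j \<in> {1..d}" for j
        unfolding r_def using that by (intro Max_ge) auto
      have "norm (z0 - lam 1) \<le> r" by (rule r) (use d in auto)
      then have r0: "r \<ge> 0" by (rule order_trans[OF norm_ge_zero])
      \<comment> \<open>The three terms account for the distance of \<open>z0\<close> from the
        points \<open>lam j\<close>, for the heat flow, and, for large \<open>n\<close>, for the
        factor 2 in the growth bound.\<close>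
      define T where "T L = ln (1 + r / L) + t / (2 * (L + r)\<^sup>2) + 1 / L" for L
      have "(T \<longlongrightarrow> 0) at_top" unfolding T_def using r0 by real_asymp
      moreover have "\<forall>\<^sub>F n in sequentially.
        (\<Sum>x\<in>#?X n. ln (max L (norm (z0 - x)))) / real (size (?X n)) \<le> ln L + T L" if L: "L > 0" for L
      proof -
        have "((\<lambda>n. ln 2 / real n) \<longlonglongrightarrow> 0)" by real_asymp
        then have "\<forall>\<^sub>F n in sequentially. ln 2 / real n < 1 / L"
          using L by (intro order_tendstoD) auto
        then show ?thesis using eventually_gt_at_top[of 0]
        proof eventually_elim
          case (elim n)
          let ?N = "n * ?\<alpha>" and ?M = "L + r"
          have N: "?N > 0" "real ?N \<ge> real n" using elim al by auto
          have M: "?M > 0" using L r0 by simp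
          let ?B = "2 * ?M ^ ?N * exp (real ?N * (t / (2 * ?M\<^sup>2)))"
          have pl: "(\<Prod>x\<in>#?X n. max L (norm (z0 - x))) \<le> ?B"
          proof (rule prod_max_roots_le[OF L])
            fix z assume z: "dist z0 z = L"
            have "norm (poly (evolved_power d lam a t n) z) \<le> ?B"
            proof (rule norm_evolved_power_le[OF t M _ N(1)])
              fix j assume "j \<in> {1..d}"
              then show "norm (z - lam j) \<le> ?M"
                using r[of j] z norm_triangle_ineq[of "z - z0" "z0 - lam j"] by (simp add: dist_norm norm_minus_commute)
            qed
            then show "norm (\<Prod>x\<in>#?X n. z - x) \<le> ?B" by (simp only: poly_evolved_power[symmetric])
          qed
          have pos: "(\<Prod>x\<in>#Y. max L (norm (z0 - x))) > 0 \<and>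
              ln (\<Prod>x\<in>#Y. max L (norm (z0 - x))) = (\<Sum>x\<in>#Y. ln (max L (norm (z0 - x))))" for Y
            using L by (induction Y) (auto simp: ln_mult)
          have "(\<Sum>x\<in>#?X n. ln (max L (norm (z0 - x)))) \<le> ln ?B"
            using ln_mono[OF pl conjunct1[OF pos]] unfolding conjunct2[OF pos] .
          also have "ln ?B = ln 2 + real ?N * ln ?M + real ?N * (t / (2 * ?M\<^sup>2))"
            using M by (simp add: ln_mult ln_realpow)
          finally have "(\<Sum>x\<in>#?X n. ln (max L (norm (z0 - x)))) / real ?N \<le>
              (ln 2 + real ?N * ln ?M + real ?N * (t / (2 * ?M\<^sup>2))) / real ?N"
            using N by (intro divide_right_mono) auto
          also have "\<dots> = ln 2 / real ?N + ln ?M + t / (2 * ?M\<^sup>2)"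
            using N by (simp add: add_divide_distrib)
          also have "ln 2 / real ?N \<le> ln 2 / real n" using N elim by (intro divide_left_mono) auto
          also have "ln 2 / real n \<le> 1 / L" using elim by simp
          also have "ln ?M = ln L + ln (1 + r / L)"
          proof -
            have "?M = L * (1 + r / L)" using L by (simp add: field_simps)
            then have "ln ?M = ln (L * (1 + r / L))" by simp
            also have "\<dots> = ln L + ln (1 + r / L)" using L r0 by (intro ln_mult_pos add_pos_nonneg) auto
            finally show ?thesis .
          qed
          finally show ?case unfolding size_roots_evolved_power T_def by simp
        qed
      qed
      ultimately show ?thesis by blast
    qed
  qed (use \<mu> in auto)
qed

section \<open>Growth of the line integral and its identification with the evolved powers\<close>

context saddle
begin

definition LI :: "nat \<Rightarrow> complex \<Rightarrow> complex" where
  "LI n \<zeta> = (LINT y|lborel. E n \<zeta> (\<zeta> + \<i> * complex_of_real y))"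

lemma N_at_top: "filterlim N at_top sequentially"
  by (rule filterlim_at_top_mono[OF filterlim_real_sequentially]) (auto intro: always_eventually N_ge)

text \<open>If the growth rates differ by \<open>\<tau>\<close>, the smaller contribution is beaten
  by the larger one even after its loss of \<open>1 / sqrt (N n)\<close>, so the two cannot
  cancel.\<close>

lemma LI_bounds:
  assumes tau: "\<tau> > 0"
  shows "\<forall>\<^sub>F n in sequentially. \<forall>\<zeta>. norm \<zeta> \<le> \<eta> \<and> \<bar>G1 \<zeta> - G2 \<zeta>\<bar> \<ge> \<tau> \<longrightarrow>
     exp (N n * max (G1 \<zeta>) (G2 \<zeta>)) / (10 * sqrt (N n)) \<le> norm (LI n \<zeta>) \<and>
     norm (LI n \<zeta>) \<le> 16 * exp (N n * max (G1 \<zeta>) (G2 \<zeta>))"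
proof -
  interpret R: saddle J a "\<lambda>j. - kap j" \<eta> by (rule reflect)
  have "\<forall>\<^sub>F x::real in at_top. 8 * exp (- (x * \<tau>)) \<le> 1 / 10 / sqrt x" using tau by real_asymp
  then have ev: "\<forall>\<^sub>F n in sequentially. 8 * exp (- (N n * \<tau>)) \<le> 1 / 10 / sqrt (N n)"
    using N_at_top by (rule eventually_compose_filterlim)
  show ?thesis using ev Iup_lower R.Iup_lower eventually_gt_at_top[of 0]
  proof eventually_elim
    case (elim n)
    show ?case
    proof (intro allI impI, elim conjE)
      fix \<zeta> :: complex assume z: "norm \<zeta> \<le> \<eta>" and t: "\<tau> \<le> \<bar>G1 \<zeta> - G2 \<zeta>\<bar>"
      have z': "norm (- \<zeta>) \<le> \<eta>" using z by simp
      let ?A = "Iup n \<zeta>" and ?B = "R.Iup n (- \<zeta>)" and ?s = "(- 1 :: complex) ^ (n * (\<Sum>j\<in>J. a j))"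
      let ?e1 = "exp (N n * G1 \<zeta>)" and ?e2 = "exp (N n * G2 \<zeta>)"
      have LI: "LI n \<zeta> = ?A + ?s * ?B" unfolding LI_def by (rule line_integral[OF z elim(4)])
      have ns: "norm (?s * ?B) = norm ?B" by (simp add: norm_mult norm_power)
      have A: "norm ?A \<le> 8 * ?e1" "?e1 * (1/5 / sqrt (N n)) \<le> norm ?A"
        using Iup_upper[OF z elim(4)] elim(2) z by auto
      have B: "norm ?B \<le> 8 * ?e2" "?e2 * (1/5 / sqrt (N n)) \<le> norm ?B"
        using R.Iup_upper[OF z' elim(4)] elim(3) z' by auto
      have N0: "N n > 0" using N_ge[of n] elim(4) by simp
      have e: "?e1 \<le> exp (N n * max (G1 \<zeta>) (G2 \<zeta>))" "?e2 \<le> exp (N n * max (G1 \<zeta>) (G2 \<zeta>))"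
        using N0 by (auto intro: mult_left_mono)
      have up: "norm (LI n \<zeta>) \<le> 16 * exp (N n * max (G1 \<zeta>) (G2 \<zeta>))"
        using norm_triangle_ineq[of ?A "?s * ?B"] A B e unfolding LI ns by linarith
      have key: "8 * exp (N n * y) \<le> exp (N n * x) * (1/10 / sqrt (N n))" if "x - y \<ge> \<tau>" for x y
      proof -
        have "exp (N n * y) \<le> exp (N n * x) * exp (- (N n * \<tau>))"
          using mult_left_mono[OF that, of "N n"] N0 by (simp add: exp_add[symmetric] algebra_simps)
        then have "8 * exp (N n * y) \<le> exp (N n * x) * (8 * exp (- (N n * \<tau>)))" by simp
        also have "\<dots> \<le> exp (N n * x) * (1/10 / sqrt (N n))" using elim(1) by (intro mult_left_mono) auto
        finally show ?thesis .
      qed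
      have "exp (N n * max (G1 \<zeta>) (G2 \<zeta>)) / (10 * sqrt (N n)) \<le> norm (LI n \<zeta>)"
      proof (cases "G1 \<zeta> \<ge> G2 \<zeta>")
        case True
        then have "8 * ?e2 \<le> ?e1 * (1/10 / sqrt (N n))" using t by (intro key) auto
        then have "?e1 * (1/10 / sqrt (N n)) \<le> norm (LI n \<zeta>)"
          using norm_triangle_ineq2[of ?A "- (?s * ?B)"] A(2) B(1) unfolding LI norm_minus_cancel ns
          by (simp add: algebra_simps)
        then show ?thesis using True by (simp add: max_def)
      next
        case False
        then have "8 * ?e1 \<le> ?e2 * (1/10 / sqrt (N n))" using t by (intro key) auto
        then have "?e2 * (1/10 / sqrt (N n)) \<le> norm (LI n \<zeta>)"
          using norm_triangle_ineq2[of "?s * ?B" "- ?A"] B(2) A(1) unfolding LI norm_minus_cancel ns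
          by (simp add: algebra_simps)
        then show ?thesis using False by (simp add: max_def)
      qed
      with up show "exp (N n * max (G1 \<zeta>) (G2 \<zeta>)) / (10 * sqrt (N n)) \<le> norm (LI n \<zeta>) \<and>
        norm (LI n \<zeta>) \<le> 16 * exp (N n * max (G1 \<zeta>) (G2 \<zeta>))" by blast
    qed
  qed
qed

lemma LI_limit:
  assumes z: "norm \<zeta> \<le> \<eta>" and ne: "G1 \<zeta> \<noteq> G2 \<zeta>"
  shows "(\<lambda>n. ln (norm (LI n \<zeta>)) / N n) \<longlonglongrightarrow> max (G1 \<zeta>) (G2 \<zeta>)"
proof -
  let ?m = "max (G1 \<zeta>) (G2 \<zeta>)"
  have "\<forall>\<^sub>F n in sequentially. exp (N n * ?m) / (10 * sqrt (N n)) \<le> norm (LI n \<zeta>) \<and> norm (LI n \<zeta>) \<le> 16 * exp (N n * ?m)"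
    using LI_bounds[of "\<bar>G1 \<zeta> - G2 \<zeta>\<bar>"] ne z by (auto elim: eventually_mono)
  then have ev: "\<forall>\<^sub>F n in sequentially. ?m - ln (10 * sqrt (N n)) / N n \<le> ln (norm (LI n \<zeta>)) / N n \<and>
      ln (norm (LI n \<zeta>)) / N n \<le> ?m + ln 16 / N n"
    using eventually_gt_at_top[of 0]
  proof eventually_elim
    case (elim n)
    have N0: "N n > 0" using N_ge[of n] elim(2) by simp
    have "0 < exp (N n * ?m) / (10 * sqrt (N n))" using N0 by simp
    then have pos: "norm (LI n \<zeta>) > 0" using elim(1) by linarith
    have "ln (exp (N n * ?m) / (10 * sqrt (N n))) \<le> ln (norm (LI n \<zeta>))"
      using elim(1) pos N0 by (intro ln_mono) auto
    moreover have "ln (exp (N n * ?m) / (10 * sqrt (N n))) = N n * ?m - ln (10 * sqrt (N n))"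
      using N0 by (simp add: ln_div)
    moreover have "ln (norm (LI n \<zeta>)) \<le> ln (16 * exp (N n * ?m))"
      using elim(1) pos by (intro ln_mono) auto
    moreover have "ln (16 * exp (N n * ?m)) = ln 16 + N n * ?m" by (simp add: ln_mult)
    ultimately have "(N n * ?m - ln (10 * sqrt (N n))) / N n \<le> ln (norm (LI n \<zeta>)) / N n"
      "ln (norm (LI n \<zeta>)) / N n \<le> (ln 16 + N n * ?m) / N n"
      using N0 by (auto intro!: divide_right_mono)
    then show ?case using N0 by (simp add: diff_divide_distrib add_divide_distrib add.commute)
  qed
  have lo': "((\<lambda>x::real. m - ln (10 * sqrt x) / x) \<longlongrightarrow> m) at_top" for m by real_asymp
  from filterlim_compose[OF lo' N_at_top] have lo: "(\<lambda>n. ?m - ln (10 * sqrt (N n)) / N n) \<longlonglongrightarrow> ?m" .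
  have up': "((\<lambda>x::real. m + ln 16 / x) \<longlongrightarrow> m) at_top" for m by real_asymp
  from filterlim_compose[OF up' N_at_top] have up: "(\<lambda>n. ?m + ln 16 / N n) \<longlonglongrightarrow> ?m" .
  show ?thesis
    by (rule tendsto_sandwich[OF _ _ lo up]) (use ev in \<open>auto elim: eventually_mono\<close>)
qed

lemma G1_continuous: "continuous_on (ball 0 \<eta>) G1"
proof -
  have "continuous_on (ball 0 \<eta>) F"
    using F_deriv by (intro DERIV_continuous_on[of _ F "\<lambda>\<zeta>. \<zeta> - sp \<zeta>"]) (auto intro: has_field_derivative_at_within)
  then show ?thesis by (intro continuous_on_Re)
qed

lemma G2_continuous: "continuous_on (ball 0 \<eta>) G2"
proof -
  interpret R: saddle J a "\<lambda>j. - kap j" \<eta> by (rule reflect)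
  show ?thesis
    by (rule continuous_on_compose2[OF R.G1_continuous]) (auto intro!: continuous_intros)
qed

end

text \<open>With \<open>N\<close> the degree, the Gaussian average has standard deviation
  \<open>sqrt t / sqrt N\<close>. After scaling by \<open>sqrt t\<close> and substituting
  \<open>y = x / sqrt N\<close>, the density becomes
  \<open>exp (N * (\<zeta> - v)\<^sup>2 / 2)\<close> on the line
  \<open>v = \<zeta> + \<i> * y\<close>.\<close>

lemma poly_evolved_power_LI:
  fixes c :: complex and t :: real
  assumes t: "t > 0" and n: "n > 0"
    and S: "saddle {1..d} a (\<lambda>j. (lam j - c) / of_real (sqrt t)) \<eta>"
  shows "poly (evolved_power d lam a t n) z =
    of_real (sqrt t ^ (n * total_mult d a) * sqrt (real (n * total_mult d a)) / sqrt (2 * pi)) *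
    saddle.LI {1..d} a (\<lambda>j. (lam j - c) / of_real (sqrt t)) n ((z - c) / of_real (sqrt t))"
proof -
  interpret S: saddle "{1..d}" a "\<lambda>j. (lam j - c) / of_real (sqrt t)" \<eta> by (rule S)
  let ?k = "\<lambda>j. (lam j - c) / of_real (sqrt t)"
  define M where "M = n * total_mult d a"
  let ?N = M and ?\<zeta> = "(z - c) / of_real (sqrt t)"
  let ?s = "t / (2 * real (total_mult d a) * real n)"
  have SN: "S.N n = real ?N" unfolding S.N_def total_mult_def M_def ..
  have N0: "real ?N > 0" using S.N_ge[of n] n unfolding SN by linarith
  have s0: "?s \<ge> 0" using t by simp
  have "2 * ?s = t / real ?N" by (simp add: M_def)
  then have rt: "sqrt (2 * ?s) = sqrt t / sqrt ?N" by (simp add: real_sqrt_divide)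
  have st: "complex_of_real (sqrt t) \<noteq> 0" using t by simp
  have integrand: "heat_kernel ?s (base_poly d lam a ^ n) z x =
      of_real (sqrt t ^ ?N / sqrt (2 * pi)) * S.E n ?\<zeta> (?\<zeta> + \<i> * complex_of_real (0 + 1 / sqrt ?N * x))" for x
  proof -
    let ?y = "1 / sqrt ?N * x"
    have "z + \<i> * of_real (sqrt (2 * ?s)) * complex_of_real x - lam j =
        of_real (sqrt t) * (?\<zeta> + \<i> * complex_of_real ?y - ?k j)" for j
      unfolding rt using st by (simp add: field_simps)
    then have "poly (base_poly d lam a ^ n) (z + \<i> * of_real (sqrt (2 * ?s)) * complex_of_real x) =
        (\<Prod>j\<in>{1..d}. of_real (sqrt t) ^ (n * a j)) *
        (\<Prod>j\<in>{1..d}. (?\<zeta> + \<i> * complex_of_real ?y - ?k j) ^ (n * a j))"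
      unfolding poly_base_poly_power by (simp only: power_mult_distrib prod.distrib)
    also have "(\<Prod>j\<in>{1..d}. complex_of_real (sqrt t) ^ (n * a j)) = of_real (sqrt t ^ ?N)"
      by (simp add: M_def total_mult_def sum_distrib_left flip: power_sum)
    finally have 1: "poly (base_poly d lam a ^ n) (z + \<i> * of_real (sqrt (2 * ?s)) * complex_of_real x) =
        of_real (sqrt t ^ ?N) *
        (\<Prod>j\<in>{1..d}. (?\<zeta> + \<i> * complex_of_real ?y - ?k j) ^ (n * a j))" .
    have "real ?N * ?y\<^sup>2 = x\<^sup>2" using N0 by (simp add: power_mult_distrib power_divide)
    then have "std_normal_density x = exp (- (real ?N * ?y\<^sup>2 / 2)) / sqrt (2 * pi)"
      by (simp add: normal_density_def)
    moreover have "(complex_of_real (sqrt (real M)))\<^sup>2 = of_nat M" by (simp flip: of_real_power)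
    then have "complex_of_real (real ?N) * (?\<zeta> - (?\<zeta> + \<i> * complex_of_real ?y))\<^sup>2 / 2 =
        complex_of_real (- (real ?N * ?y\<^sup>2 / 2))"
      using N0 by (simp add: power_mult_distrib power_divide)
    ultimately show ?thesis unfolding 1 S.E_def SN by (simp add: exp_of_real del: of_real_minus)
  qed
  have "poly (evolved_power d lam a t n) z =
      (LINT x|lborel. of_real (sqrt t ^ ?N / sqrt (2 * pi)) * S.E n ?\<zeta> (?\<zeta> + \<i> * complex_of_real (0 + 1 / sqrt ?N * x)))"
    unfolding evolved_power_def heat_flow_integral(2)[OF s0] integrand ..
  also have "\<dots> = of_real (sqrt t ^ ?N / sqrt (2 * pi)) *
      (LINT x|lborel. S.E n ?\<zeta> (?\<zeta> + \<i> * complex_of_real (0 + 1 / sqrt ?N * x)))"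
    by (rule integral_mult_right_zero)
  also have "S.LI n ?\<zeta> = \<bar>1 / sqrt ?N\<bar> *\<^sub>R (LINT x|lborel. S.E n ?\<zeta> (?\<zeta> + \<i> * complex_of_real (0 + 1 / sqrt ?N * x)))"
    unfolding S.LI_def
    by (rule lborel_integral_real_affine) (use N0 in auto)
  then have "(LINT x|lborel. S.E n ?\<zeta> (?\<zeta> + \<i> * complex_of_real (0 + 1 / sqrt ?N * x))) = of_real (sqrt ?N) * S.LI n ?\<zeta>"
    using N0 by (simp add: scaleR_conv_of_real)
  finally show ?thesis unfolding M_def[symmetric] by simp
qed

section \<open>Conformal maps close to a translation\<close>

text \<open>The margin 8 leaves room for nested regions: the curve lies in radius \<open>R\<close>,
  its parameters in \<open>R + 1\<close>, the inverse is used below radius \<open>R + 4\<close>, and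
  the fixed point argument runs in radius \<open>R + 5\<close>. The condition
  \<open>10 * \<delta> < R\<close> keeps the ends of the curve away from the parameters below
  \<open>2 * \<delta>\<close>, which \<open>norm_mono\<close> does not reach.\<close>

locale near_identity =
  fixes \<Phi> :: "complex \<Rightarrow> complex" and c :: complex and R \<delta> :: real
  assumes hol: "\<Phi> holomorphic_on ball c (R + 8)" and R_pos: "R > 0"
    and delta: "0 \<le> \<delta>" "\<delta> \<le> 1/10" "10 * \<delta> < R"
    and close: "\<And>z. z \<in> ball c (R + 8) \<Longrightarrow> norm (\<Phi> z - (z - c)) \<le> \<delta>"
    and slope: "\<And>z. z \<in> ball c (R + 8) \<Longrightarrow> norm (deriv \<Phi> z - 1) \<le> 1/10"
begin

abbreviation D :: "complex set" where "D \<equiv> ball c (R + 8)"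

lemma lipschitz:
  assumes "z \<in> D" "w \<in> D"
  shows "norm ((\<Phi> z - \<Phi> w) - (z - w)) \<le> 1/10 * norm (z - w)"
proof -
  have "norm ((\<Phi> z - z) - (\<Phi> w - w)) \<le> 1/10 * norm (z - w)"
  proof (rule field_differentiable_bound[of "D" "\<lambda>z. \<Phi> z - z" "\<lambda>z. deriv \<Phi> z - 1"])
    fix u assume "u \<in> D"
    then have "(\<Phi> has_field_derivative deriv \<Phi> u) (at u)"
      by (rule holomorphic_derivI[OF hol open_ball])
    from DERIV_diff[OF this DERIV_ident]
    show "((\<lambda>z. \<Phi> z - z) has_field_derivative deriv \<Phi> u - 1) (at u within D)"
      by (rule has_field_derivative_at_within)
  qed (use assms slope in auto)
  then show ?thesis by (simp add: algebra_simps)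
qed

lemma bilipschitz:
  assumes "z \<in> D" "w \<in> D"
  shows "9/10 * norm (z - w) \<le> norm (\<Phi> z - \<Phi> w)" "norm (\<Phi> z - \<Phi> w) \<le> 11/10 * norm (z - w)"
  using lipschitz[OF assms] norm_triangle_ineq2[of "\<Phi> z - \<Phi> w" "z - w"]
    norm_triangle_ineq2[of "z - w" "\<Phi> z - \<Phi> w"] norm_minus_commute[of "\<Phi> z - \<Phi> w" "z - w"] by linarith+

lemma inj: "inj_on \<Phi> (D)"
proof (rule inj_onI)
  fix z w assume "z \<in> D" "w \<in> D" "\<Phi> z = \<Phi> w"
  with bilipschitz(1)[of z w] show "z = w" by simp
qed

text \<open>The map \<open>z \<mapsto> z - (\<Phi> z - s)\<close> contracts because
  \<open>\<Phi>\<close> has slope near 1, and its values stay within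
  \<open>norm s + \<delta>\<close> of \<open>c\<close>.\<close>

lemma ex_preimage:
  assumes s: "norm s < R + 4"
  shows "\<exists>z\<in>D. \<Phi> z = s"
proof -
  let ?T = "\<lambda>z. z - (\<Phi> z - s)" and ?B = "cball c (R + 5)"
  have sub: "z \<in> D" if "z \<in> ?B" for z using that by simp
  have "\<exists>!z\<in>?B. ?T z = z"
  proof (rule Banach_fix[where c = "1/10"])
    show "?T ` ?B \<subseteq> ?B"
    proof safe
      fix z assume "z \<in> ?B"
      have "c - ?T z = (\<Phi> z - (z - c)) - s" by simp
      then have "dist c (?T z) \<le> norm (\<Phi> z - (z - c)) + norm s"
        unfolding dist_norm by (simp only: norm_triangle_ineq4)
      then show "?T z \<in> ?B" using close[OF sub[OF \<open>z \<in> ?B\<close>]] s delta by simp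
    qed
    show "dist (?T z) (?T w) \<le> 1/10 * dist z w" if "z \<in> ?B" "w \<in> ?B" for z w
    proof -
      have "?T z - ?T w = - ((\<Phi> z - \<Phi> w) - (z - w))" by simp
      then have "dist (?T z) (?T w) = norm ((\<Phi> z - \<Phi> w) - (z - w))"
        unfolding dist_norm by (simp only: norm_minus_cancel)
      then show ?thesis using lipschitz[OF sub sub, OF that] by (simp add: dist_norm)
    qed
  qed (use R_pos in \<open>auto simp: complete_eq_closed\<close>)
  then obtain z where "z \<in> ?B" "?T z = z" by blast
  then show ?thesis using sub by (intro bexI[of _ z]) auto
qed

definition \<Psi> :: "complex \<Rightarrow> complex" where
  "\<Psi> s = (THE z. z \<in> D \<and> \<Phi> z = s)"

lemma \<Psi>_\<Phi>: "z \<in> D \<Longrightarrow> \<Psi> (\<Phi> z) = z"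
  unfolding \<Psi>_def using inj by (intro the_equality) (auto dest: inj_onD)

lemma \<Psi>:
  assumes "norm s < R + 4"
  shows "\<Psi> s \<in> D" "\<Phi> (\<Psi> s) = s" "norm (\<Psi> s - c - s) \<le> \<delta>"
proof -
  obtain z where z: "z \<in> D" "\<Phi> z = s" using ex_preimage[OF assms] by blast
  then have "\<Psi> s = z" using \<Psi>_\<Phi> by blast
  then show "\<Psi> s \<in> D" "\<Phi> (\<Psi> s) = s" using z by auto
  then show "norm (\<Psi> s - c - s) \<le> \<delta>" using close[of "\<Psi> s"] by (simp add: norm_minus_commute)
qed

lemma \<Psi>_holomorphic: "\<Psi> holomorphic_on ball 0 (R + 4)" "\<And>s. norm s < R + 4 \<Longrightarrow> deriv \<Psi> s \<noteq> 0"
proof -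
  obtain g where g: "g holomorphic_on \<Phi> ` D"
    "\<And>z. z \<in> D \<Longrightarrow> deriv \<Phi> z * deriv g (\<Phi> z) = 1"
    "\<And>z. z \<in> D \<Longrightarrow> g (\<Phi> z) = z"
    using holomorphic_has_inverse[OF hol open_ball inj] by blast
  have eq: "g s = \<Psi> s" if "s \<in> ball 0 (R + 4)" for s
    using \<Psi>[of s] g(3)[of "\<Psi> s"] that by simp
  have "ball 0 (R + 4) \<subseteq> \<Phi> ` D"
  proof
    fix s :: complex assume "s \<in> ball 0 (R + 4)"
    then show "s \<in> \<Phi> ` D" using ex_preimage[of s] by auto
  qed
  from holomorphic_on_subset[OF g(1) this] eq show "\<Psi> holomorphic_on ball 0 (R + 4)"
    by (rule holomorphic_transform)
  fix s :: complex assume s: "norm s < R + 4"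
  have "\<forall>\<^sub>F x in nhds s. g x = \<Psi> x"
    using eventually_nhds_in_open[of "ball 0 (R + 4)" s] s by (auto elim!: eventually_mono simp: eq)
  then have "deriv \<Psi> s = deriv g s" by (metis deriv_cong_ev)
  then show "deriv \<Psi> s \<noteq> 0" using g(2)[of "\<Psi> s"] \<Psi>[OF s] by auto
qed

lemma \<Psi>_lipschitz:
  assumes "norm s < R + 4" "norm s' < R + 4"
  shows "norm ((\<Psi> s - \<Psi> s') - (s - s')) \<le> 1/9 * norm (s - s')"
proof -
  note p = \<Psi>[OF assms(1)] and p' = \<Psi>[OF assms(2)]
  have "norm ((\<Psi> s - \<Psi> s') - (s - s')) \<le> 1/10 * norm (\<Psi> s - \<Psi> s')"
    using lipschitz[OF p(1) p'(1)] unfolding p(2) p'(2) by (simp add: norm_minus_commute)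
  then show ?thesis using bilipschitz(1)[OF p(1) p'(1)] unfolding p(2) p'(2) by linarith
qed

definition curve :: "complex set" where
  "curve = {z \<in> cball c R. Im (\<Phi> z) = 0}"

text \<open>Points of the disk satisfy \<open>norm (\<Phi> z) \<le> R + \<delta>\<close>, so the
  range up to \<open>R + 1\<close> misses no point of the curve.\<close>

definition params :: "real set" where
  "params = {s \<in> {- (R + 1)..R + 1}. norm (\<Psi> (of_real s) - c) \<le> R}"

lemma params_norm: "s \<in> {- (R + 1)..R + 1} \<Longrightarrow> norm (complex_of_real s) < R + 4"
  unfolding norm_of_real atLeastAtMost_iff by linarith

lemma curve_eq: "curve = (\<lambda>s. \<Psi> (of_real s)) ` params"
proof safe
  fix z assume "z \<in> curve"
  then have z: "norm (z - c) \<le> R" "Im (\<Phi> z) = 0" by (auto simp: curve_def dist_norm norm_minus_commute)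
  then have zb: "z \<in> D" using R_pos by (simp add: dist_norm norm_minus_commute)
  have s: "\<Phi> z = of_real (Re (\<Phi> z))" using z(2) by (simp add: complex_eq_iff)
  have "norm (\<Phi> z) \<le> R + 1"
    using close[OF zb] z(1) delta norm_triangle_ineq[of "\<Phi> z - (z - c)" "z - c"] by simp
  then have "\<bar>Re (\<Phi> z)\<bar> \<le> R + 1" using abs_Re_le_cmod order_trans by blast
  moreover have "\<Psi> (of_real (Re (\<Phi> z))) = z" using \<Psi>_\<Phi>[OF zb] s by simp
  ultimately show "z \<in> (\<lambda>s. \<Psi> (of_real s)) ` params"
    using z(1) by (intro image_eqI[of _ _ "Re (\<Phi> z)"]) (auto simp: params_def abs_le_iff)
next
  fix s assume "s \<in> params"
  then show "\<Psi> (of_real s) \<in> curve"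
    using \<Psi>(2)[OF params_norm[of s]] by (auto simp: params_def curve_def dist_norm norm_minus_commute)
qed

lemma params_inner: "\<bar>s\<bar> \<le> R - \<delta> \<Longrightarrow> s \<in> params"
proof -
  assume s: "\<bar>s\<bar> \<le> R - \<delta>"
  then have i: "s \<in> {- (R + 1)..R + 1}" using delta unfolding atLeastAtMost_iff by linarith
  have "norm (\<Psi> (of_real s) - c) \<le> \<delta> + \<bar>s\<bar>"
    using \<Psi>(3)[OF params_norm[OF i]] norm_triangle_ineq[of "\<Psi> (of_real s) - c - of_real s" "of_real s"] by simp
  then show "s \<in> params" using s i by (simp add: params_def)
qed

lemma params_outer: "s \<in> params \<Longrightarrow> \<bar>s\<bar> \<le> R + \<delta>"
proof -
  assume s: "s \<in> params"
  then have "norm (\<Psi> (of_real s) - c - of_real s) \<le> \<delta>" using \<Psi>(3)[OF params_norm] by (simp add: params_def)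
  then show ?thesis
    using s norm_triangle_ineq4[of "\<Psi> (of_real s) - c" "\<Psi> (of_real s) - c - of_real s"] by (simp add: params_def)
qed

text \<open>Along each half of the curve the distance from \<open>c\<close> does not decrease, so
  the curve cannot return to the disk after leaving it. The difference of squares is
  \<open>(k' - k) \<bullet> (k' + k)\<close>, where the two vectors are close to the real numbers
  \<open>x\<close> and \<open>y\<close> of equal sign; this needs \<open>y\<close> to dominate the
  position error \<open>2 * \<delta>\<close>.\<close>

lemma norm_mono:
  assumes s: "s \<in> {- (R + 1)..R + 1}" "s' \<in> {- (R + 1)..R + 1}"
    and le: "\<bar>s\<bar> \<le> \<bar>s'\<bar>" "s * s' \<ge> 0" "\<bar>s\<bar> \<ge> 2 * \<delta>"
  shows "norm (\<Psi> (of_real s) - c) \<le> norm (\<Psi> (of_real s') - c)"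
proof -
  define k k' where "k = \<Psi> (of_real s) - c" and "k' = \<Psi> (of_real s') - c"
  define x where "x = s' - s"
  define y where "y = s' + s"
  note n = params_norm[OF s(1)] params_norm[OF s(2)]
  have e: "norm (k - of_real s) \<le> \<delta>" "norm (k' - of_real s') \<le> \<delta>"
    using \<Psi>(3)[OF n(1)] \<Psi>(3)[OF n(2)] by (auto simp: k_def k'_def)
  have th: "norm ((k' - k) - of_real x) \<le> 1/9 * \<bar>x\<bar>"
    using \<Psi>_lipschitz[OF n(2,1)] by (simp add: k_def k'_def x_def flip: of_real_diff)
  have sum_eq: "(k' + k) - of_real y = (k' - of_real s') + (k - of_real s)" by (simp add: y_def)
  have ee: "norm ((k' + k) - of_real y) \<le> 2 * \<delta>"
    unfolding sum_eq using norm_triangle_mono[OF e(2,1)] by simp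
  have xy: "x * y \<ge> 0" "\<bar>y\<bar> \<ge> 4 * \<delta>"
  proof -
    have "x * y = s'\<^sup>2 - s\<^sup>2" by (simp add: x_def y_def power2_eq_square algebra_simps)
    then show "x * y \<ge> 0" using le(1) by (simp add: abs_le_square_iff)
    have "\<bar>y\<bar> = \<bar>s'\<bar> + \<bar>s\<bar>" using le(2) by (auto simp: y_def zero_le_mult_iff abs_if)
    then show "\<bar>y\<bar> \<ge> 4 * \<delta>" using le by linarith
  qed
  have "(norm k')\<^sup>2 - (norm k)\<^sup>2 = (k' - k) \<bullet> (k' + k)"
    by (simp add: power2_norm_eq_inner inner_diff_left inner_diff_right inner_add_right inner_commute)
  also have "\<dots> = complex_of_real x \<bullet> complex_of_real y + complex_of_real x \<bullet> ((k' + k) - of_real y)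
      + ((k' - k) - of_real x) \<bullet> (k' + k)"
    by (simp add: inner_diff_left inner_diff_right algebra_simps)
  also have "\<dots> \<ge> \<bar>x\<bar> * \<bar>y\<bar> - \<bar>x\<bar> * (2 * \<delta>) - (1/9 * \<bar>x\<bar>) * (\<bar>y\<bar> + 2 * \<delta>)"
  proof -
    have "complex_of_real x \<bullet> complex_of_real y = \<bar>x\<bar> * \<bar>y\<bar>" using xy(1) by (simp add: inner_complex_def flip: abs_mult)
    moreover have "\<bar>complex_of_real x \<bullet> ((k' + k) - of_real y)\<bar> \<le> \<bar>x\<bar> * (2 * \<delta>)"
      using Cauchy_Schwarz_ineq2[of "complex_of_real x" "(k' + k) - of_real y"] mult_left_mono[OF ee abs_ge_zero[of x]] by simp
    moreover have "\<bar>((k' - k) - of_real x) \<bullet> (k' + k)\<bar> \<le> (1/9 * \<bar>x\<bar>) * (\<bar>y\<bar> + 2 * \<delta>)"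
    proof -
      have "norm (k' + k) \<le> \<bar>y\<bar> + 2 * \<delta>"
        using ee norm_triangle_ineq[of "of_real y" "(k' + k) - of_real y"] by simp
      then have "norm ((k' - k) - of_real x) * norm (k' + k) \<le> (1/9 * \<bar>x\<bar>) * (\<bar>y\<bar> + 2 * \<delta>)"
        using th by (intro mult_mono) auto
      then show ?thesis using Cauchy_Schwarz_ineq2[of "(k' - k) - of_real x" "k' + k"] by linarith
    qed
    ultimately show ?thesis by linarith
  qed
  also have "\<bar>x\<bar> * \<bar>y\<bar> - \<bar>x\<bar> * (2 * \<delta>) - (1/9 * \<bar>x\<bar>) * (\<bar>y\<bar> + 2 * \<delta>) = \<bar>x\<bar> * (8/9 * \<bar>y\<bar> - 20/9 * \<delta>)"
    by (simp add: algebra_simps)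
  \<comment> \<open>By \<open>\<bar>y\<bar> \<ge> 4 * \<delta>\<close> the positive term is at least
    \<open>32/9 * \<delta>\<close>.\<close>
  also have "\<dots> \<ge> 0" using xy(2) delta by (intro mult_nonneg_nonneg) auto
  finally have "(norm k)\<^sup>2 \<le> (norm k')\<^sup>2" by simp
  then show ?thesis unfolding k_def k'_def by (rule power2_le_imp_le) simp
qed

text \<open>The set is starlike about 0, hence connected: parameters up to
  \<open>2 * \<delta>\<close> belong to it anyway, larger ones by \<open>norm_mono\<close>. A
  compact connected set of reals is an interval.\<close>

lemma params_interval: "\<exists>s1 s2. params = {s1..s2} \<and> s1 \<le> - R + \<delta> \<and> - R - \<delta> \<le> s1 \<and> R - \<delta> \<le> s2 \<and> s2 \<le> R + \<delta>"
proof -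
  have star: "u * s \<in> params" if "s \<in> params" "0 \<le> u" "u \<le> 1" for s u
  proof (cases "\<bar>u * s\<bar> \<le> 2 * \<delta>")
    case True
    then show ?thesis using delta by (intro params_inner) linarith
  next
    case False
    have le: "\<bar>u * s\<bar> \<le> \<bar>s\<bar>" using that by (simp add: abs_mult mult_left_le_one_le)
    have s: "s \<in> {- (R + 1)..R + 1}" using that by (simp add: params_def)
    then have us: "u * s \<in> {- (R + 1)..R + 1}" using le unfolding atLeastAtMost_iff by linarith
    have "norm (\<Psi> (of_real (u * s)) - c) \<le> norm (\<Psi> (of_real s) - c)"
      using False le that by (intro norm_mono us s) (auto simp: mult.assoc)
    also have "\<dots> \<le> R" using that by (simp add: params_def)
    finally show ?thesis using us by (simp add: params_def)
  qed
  have comp: "compact params"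
  proof -
    have "continuous_on {- (R + 1)..R + 1} (\<lambda>s. norm (\<Psi> (of_real s) - c))"
      by (intro continuous_intros continuous_on_compose2[OF holomorphic_on_imp_continuous_on[OF \<Psi>_holomorphic(1)]])
         (use params_norm in auto)
    from continuous_closed_preimage[OF this closed_atLeastAtMost closed_atMost[of R]]
    have "closed params" by (simp add: params_def vimage_def Int_def)
    moreover have "bounded params" unfolding params_def by (rule bounded_subset[OF bounded_closed_interval]) auto
    ultimately show ?thesis by (simp add: compact_eq_bounded_closed)
  qed
  have "0 \<in> params" using params_inner[of 0] delta by simp
  have "connected params"
  proof (rule starlike_imp_connected)
    show "starlike params" unfolding starlike_def
    proof (intro bexI ballI subsetI)
      fix x y assume x: "x \<in> params" and "y \<in> closed_segment 0 x"
      then obtain u where "0 \<le> u" "u \<le> 1" "y = u * x" by (auto simp: closed_segment_def)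
      then show "y \<in> params" using star[OF x] by simp
    qed fact
  qed
  then obtain s1 s2 where p: "params = {s1..s2}"
    using comp by (metis connected_compact_interval_1 box_real(2))
  have "R - \<delta> \<in> params" "- R + \<delta> \<in> params" using delta by (auto intro!: params_inner)
  then have i: "s1 \<le> - R + \<delta>" "R - \<delta> \<le> s2" unfolding p by auto
  have "s1 \<in> params" "s2 \<in> params" using i delta unfolding p by auto
  then have "\<bar>s1\<bar> \<le> R + \<delta>" "\<bar>s2\<bar> \<le> R + \<delta>" by (auto dest: params_outer)
  then show ?thesis using p i by (intro exI[of _ s1] exI[of _ s2]) auto
qed

text \<open>The image of a segment under an injective holomorphic map with nonvanishing derivative.
  Its complex derivatives supply the real ones, with powers of \<open>l\<close> from the affine
  reparametrization.\<close>

lemma smooth_curve_curve: "smooth_curve curve"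
proof -
  obtain s1 s2 where p: "params = {s1..s2}" "s1 \<le> - R + \<delta>" "R - \<delta> \<le> s2"
    using params_interval by blast
  define l where "l = s2 - s1"
  have l: "l > 0" using p delta by (simp add: l_def)
  define par where "par x = complex_of_real (s1 + l * x)" for x
  define g where "g n x = of_real (l ^ n) * (deriv ^^ n) \<Psi> (par x)" for n x
  have inp: "s1 + l * x \<in> params" if "x \<in> {0..1}" for x
  proof -
    have "0 \<le> l * x" "l * x \<le> l * 1" using that l by (auto intro!: mult_left_mono)
    then show ?thesis unfolding p by (simp add: l_def)
  qed
  have np: "norm (par x) < R + 4" if "x \<in> {0..1}" for x
    unfolding par_def using inp[OF that] by (intro params_norm) (auto simp: params_def)
  have D: "(g n has_vector_derivative g (Suc n) x) (at x within {0..1})" if x: "x \<in> {0..1}" for n x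
  proof -
    have "(deriv ^^ n) \<Psi> holomorphic_on ball 0 (R + 4)"
      by (rule holomorphic_higher_deriv[OF \<Psi>_holomorphic(1) open_ball])
    from holomorphic_derivI[OF this open_ball, of "par x"]
    have d: "((deriv ^^ n) \<Psi> has_field_derivative (deriv ^^ Suc n) \<Psi> (par x)) (at (par x))"
      using np[OF x] by simp
    have "(par has_vector_derivative of_real l) (at x within {0..1})"
      unfolding par_def[abs_def] by (auto intro!: derivative_eq_intros)
    from field_vector_diff_chain_within[OF this has_field_derivative_at_within[OF d]]
    have "((\<lambda>x. (deriv ^^ n) \<Psi> (par x)) has_vector_derivative (of_real l * (deriv ^^ Suc n) \<Psi> (par x))) (at x within {0..1})"
      by (simp add: o_def)
    from has_vector_derivative_mult_right[OF this, of "of_real (l ^ n)"]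
    show ?thesis unfolding g_def[abs_def] by (simp add: mult.assoc mult.left_commute)
  qed
  have "g 1 x \<noteq> 0" if "x \<in> {0..1}" for x
    using \<Psi>_holomorphic(2)[OF np[OF that]] l by (simp add: g_def)
  moreover have "arc (g 0)" unfolding arc_def path_def
  proof
    show "continuous_on {0..1} (g 0)"
      by (rule continuous_on_vector_derivative[of _ _ "g (Suc 0)"]) (rule D)
    show "inj_on (g 0) {0..1}"
    proof (rule inj_onI)
      fix x y assume xy: "x \<in> {0..1}" "y \<in> {0..1}" "g 0 x = g 0 y"
      then have "\<Phi> (\<Psi> (par x)) = \<Phi> (\<Psi> (par y))" by (simp add: g_def)
      then have "par x = par y" using \<Psi>(2)[OF np] xy by simp
      then show "x = y" using l by (simp add: par_def flip: of_real_add of_real_mult)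
    qed
  qed
  moreover have "path_image (g 0) = curve"
  proof -
    have "(\<lambda>x. s1 + l * x) ` {0..1} = params"
    proof safe
      fix s assume "s \<in> params"
      then show "s \<in> (\<lambda>x. s1 + l * x) ` {0..1}"
        using l unfolding p by (intro image_eqI[of _ _ "(s - s1) / l"]) (auto simp: field_simps l_def)
    qed (rule inp)
    then have "curve = (\<lambda>s. \<Psi> (of_real s)) ` (\<lambda>x. s1 + l * x) ` {0..1}" unfolding curve_eq by simp
    then show ?thesis unfolding path_image_def g_def par_def by (simp add: image_image)
  qed
  ultimately show ?thesis unfolding smooth_curve_def using D by (intro exI[of _ g]) blast
qed

text \<open>One \<open>\<delta>\<close> is the deviation of \<open>\<Psi>\<close> from a
  translation, the other the mismatch between the end parameters and
  \<open>\<plusminus>R\<close>.\<close>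

lemma hausdorff_curve: "hausdorff_distance curve (closed_segment (c - of_real R) (c + of_real R)) \<le> 2 * \<delta>"
proof -
  obtain s1 s2 where p: "params = {s1..s2}" "s1 \<le> - R + \<delta>" "- R - \<delta> \<le> s1" "R - \<delta> \<le> s2" "s2 \<le> R + \<delta>"
    using params_interval by blast
  let ?B = "closed_segment (c - of_real R) (c + of_real R)"
  have B: "?B = (\<lambda>x. c + of_real x) ` {- R..R}"
  proof -
    have "closed_segment (c - of_real R) (c + of_real R) = (\<lambda>x. c + x) ` closed_segment (of_real (- R)) (of_real R)"
      using closed_segment_translation[of c "of_real (- R)" "of_real R"] by simp
    also have "closed_segment (complex_of_real (- R)) (of_real R) = of_real ` closed_segment (- R) R"
      by (rule closed_segment_of_real)
    finally show ?thesis using R_pos by (simp add: image_image closed_segment_eq_real_ivl)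
  qed
  have close: "norm (\<Psi> (of_real s) - (c + of_real x)) \<le> 2 * \<delta>" if "s \<in> params" "\<bar>s - x\<bar> \<le> \<delta>" for s x
  proof -
    have "s \<in> {- (R + 1)..R + 1}" using that by (simp add: params_def)
    note \<Psi>(3)[OF params_norm[OF this]]
    moreover have "norm (complex_of_real (s - x)) \<le> \<delta>" unfolding norm_of_real by (rule that(2))
    ultimately have "norm ((\<Psi> (of_real s) - c - of_real s) + of_real (s - x)) \<le> \<delta> + \<delta>"
      by (rule norm_triangle_mono)
    moreover have "(\<Psi> (of_real s) - c - of_real s) + of_real (s - x) = \<Psi> (of_real s) - (c + of_real x)" by simp
    ultimately show ?thesis by (simp only: mult_2)
  qed
  have 1: "infdist z ?B \<le> 2 * \<delta>" if "z \<in> curve" for z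
  proof -
    obtain s where s: "s \<in> params" "z = \<Psi> (of_real s)" using \<open>z \<in> curve\<close> unfolding curve_eq by blast
    define x where "x = max (- R) (min R s)"
    have "x \<in> {- R..R}" "\<bar>s - x\<bar> \<le> \<delta>"
      using R_pos params_outer[OF s(1)] delta unfolding x_def by (auto simp: abs_if max_def min_def)
    then have "c + of_real x \<in> ?B" "dist z (c + of_real x) \<le> 2 * \<delta>"
      using close[OF s(1)] unfolding B s(2) dist_norm by auto
    then show ?thesis using infdist_le order_trans by blast
  qed
  have 2: "infdist z curve \<le> 2 * \<delta>" if "z \<in> ?B" for z
  proof -
    obtain x where x: "x \<in> {- R..R}" "z = c + of_real x" using \<open>z \<in> ?B\<close> unfolding B by blast
    define s where "s = max s1 (min s2 x)"
    have s12: "s1 \<le> s2" using p delta by linarith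
    then have "s \<in> params" "\<bar>s - x\<bar> \<le> \<delta>"
      using x p delta unfolding s_def by (auto simp: abs_if max_def min_def)
    then have "\<Psi> (of_real s) \<in> curve" "dist z (\<Psi> (of_real s)) \<le> 2 * \<delta>"
      using close[of s x] unfolding curve_eq x(2) by (auto simp: dist_norm norm_minus_commute)
    then show ?thesis using infdist_le order_trans by blast
  qed
  have "curve \<noteq> {}" unfolding curve_eq using params_inner[of 0] delta by auto
  then have "(SUP z\<in>curve. infdist z ?B) \<le> 2 * \<delta>" using 1 by (intro cSUP_least) auto
  moreover have "(SUP z\<in>?B. infdist z curve) \<le> 2 * \<delta>" using 2 by (intro cSUP_least) auto
  ultimately show ?thesis by (simp add: hausdorff_distance_def)
qed

text \<open>The lower half of the final sandwich argument. A real \<open>SUP\<close> says something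
  about its members only for sets bounded above, so boundedness is shown first.\<close>

lemma hausdorff_curve_nonneg: "hausdorff_distance curve (closed_segment (c - of_real R) (c + of_real R)) \<ge> 0"
proof -
  let ?B = "closed_segment (c - of_real R) (c + of_real R)"
  have "bdd_above ((\<lambda>z. infdist z ?B) ` curve)"
  proof -
    have "compact (cball c R)" by simp
    then have "compact ((\<lambda>z. infdist z ?B) ` cball c R)"
      by (intro compact_continuous_image continuous_intros)
    then have "bdd_above ((\<lambda>z. infdist z ?B) ` cball c R)" by (intro bounded_imp_bdd_above compact_imp_bounded)
    then show ?thesis by (rule bdd_above_mono) (auto simp: curve_def)
  qed
  moreover have ne: "\<Psi> 0 \<in> curve" unfolding curve_eq using params_inner[of 0] delta by (intro image_eqI[of _ _ 0]) auto
  ultimately have "infdist (\<Psi> 0) ?B \<le> (SUP z\<in>curve. infdist z ?B)" by (intro cSUP_upper)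
  then show ?thesis using infdist_nonneg[of "\<Psi> 0" ?B] unfolding hausdorff_distance_def by simp
qed

end

section \<open>Support and potential for large times\<close>

text \<open>Through \<open>saddle\<close> with \<open>\<eta> = M / sqrt t\<close>, the number
  \<open>M\<close> bounds the distances of all \<open>lam j\<close> from \<open>c\<close>; it is
  also the radius in which points \<open>z\<close> are treated. The bounds \<open>small\<close> are
  those that \<open>near_identity\<close> demands for
  \<open>\<delta> = 16 * M\<^sup>2 / sqrt t\<close>.\<close>

locale large_time =
  S: saddle "{1..d}" a "\<lambda>j. (lam j - c) / of_real (sqrt t)" "M / sqrt t" +
  L: root_limit \<mu> "\<lambda>n. proots (evolved_power d lam a t n)"
  for d :: nat and a :: "nat \<Rightarrow> nat" and lam :: "nat \<Rightarrow> complex" and c :: complex and t M R :: real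
    and \<mu> :: "complex measure" +
  assumes d: "d \<ge> 1" and inj_lam: "inj_on lam {1..d}" and a: "\<And>j. j \<in> {1..d} \<Longrightarrow> a j \<ge> 1" and t: "t > 0"
    and R: "R > 0" and M: "M \<ge> R + 8" and c: "c = center_of_mass d lam a"
    and small: "16 * M\<^sup>2 / sqrt t \<le> 1/10" "160 * M\<^sup>2 / sqrt t < R"
begin

abbreviation rt :: complex where "rt \<equiv> of_real (sqrt t)"
abbreviation kap :: "nat \<Rightarrow> complex" where "kap \<equiv> \<lambda>j. (lam j - c) / rt"
abbreviation zeta :: "complex \<Rightarrow> complex" where "zeta z \<equiv> (z - c) / rt"

sublocale Rf: saddle "{1..d}" a "\<lambda>j. - kap j" "M / sqrt t"
  by (rule S.reflect)

text \<open>The derivative of \<open>S.F\<close> is about \<open>- \<i>\<close> near 0. The factor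
  \<open>\<i> * rt / 2\<close> brings the derivative of \<open>\<Phi>\<close> close to 1 and makes
  its imaginary part a multiple of the phase difference.\<close>

definition \<Phi> :: "complex \<Rightarrow> complex" where
  "\<Phi> z = \<i> * rt / 2 * (S.F (zeta z) - Rf.F (- zeta z))"

text \<open>The value that the potential turns out to have; \<open>ln (sqrt t)\<close> undoes the
  scaling.\<close>

definition V :: "complex \<Rightarrow> real" where
  "V z = ln (sqrt t) + max (S.G1 (zeta z)) (S.G2 (zeta z))"

lemma rt_nz: "rt \<noteq> 0" using t by simp

lemma alpha_pos: "total_mult d a > 0"
  using S.apos unfolding total_mult_def .

lemma norm_zeta: "norm (zeta z) = norm (z - c) / sqrt t"
  using t by (simp add: norm_divide)

lemma zeta_less: "z \<in> ball c M \<Longrightarrow> norm (zeta z) < M / sqrt t"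
  unfolding norm_zeta using t by (intro divide_strict_right_mono) (auto simp: dist_norm norm_minus_commute)

lemma centered: "(\<Sum>j\<in>{1..d}. S.w j * kap j) = 0"
proof -
  have al: "complex_of_nat (total_mult d a) \<noteq> 0" using alpha_pos by simp
  have "(\<Sum>j\<in>{1..d}. S.w j * kap j) = (\<Sum>j\<in>{1..d}. of_nat (a j) * (lam j - c)) / (of_nat (total_mult d a) * rt)"
    unfolding S.w_def total_mult_def sum_divide_distrib by (intro sum.cong) auto
  also have "(\<Sum>j\<in>{1..d}. of_nat (a j) * (lam j - c)) =
      (\<Sum>j\<in>{1..d}. of_nat (a j) * lam j) - of_nat (total_mult d a) * c"
    by (simp add: right_diff_distrib sum_subtractf total_mult_def flip: sum_distrib_right)
  also have "\<dots> = 0" using al by (simp add: c center_of_mass_def)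
  finally show ?thesis by simp
qed

lemma zeta_deriv: "(zeta has_field_derivative (1 / rt)) (at z)"
proof -
  have "((\<lambda>z. z - c) has_field_derivative (1 - 0)) (at z)" by (rule DERIV_diff[OF DERIV_ident DERIV_const])
  from DERIV_cdivide[OF this, of rt] show ?thesis by simp
qed

lemma \<Phi>_deriv:
  assumes "z \<in> ball c M"
  shows "(\<Phi> has_field_derivative (- \<i> / 2 * (S.sp (zeta z) + Rf.sp (- zeta z)))) (at z)"
proof -
  have z: "norm (zeta z) < M / sqrt t" "norm (- zeta z) < M / sqrt t" using zeta_less[OF assms] by auto
  note D = zeta_deriv[of z]
  from DERIV_chain2[OF S.F_deriv[OF z(1)] D] DERIV_chain2[OF Rf.F_deriv[OF z(2)] DERIV_minus[OF D]]
  have "((\<lambda>z. S.F (zeta z) - Rf.F (- zeta z)) has_field_derivative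
      ((zeta z - S.sp (zeta z)) * (1 / rt) - (- zeta z - Rf.sp (- zeta z)) * - (1 / rt))) (at z)"
    by (rule DERIV_diff)
  from DERIV_cmult[OF this, of "\<i> * rt / 2"]
  have "(\<Phi> has_field_derivative (\<i> * rt / 2 *
      ((zeta z - S.sp (zeta z)) * (1 / rt) - (- zeta z - Rf.sp (- zeta z)) * - (1 / rt)))) (at z)"
    unfolding \<Phi>_def .
  moreover have "\<i> * rt / 2 * ((x - y) * (1 / rt) - (- x - y') * - (1 / rt)) = - \<i> / 2 * (y + y')" for x y y'
    using rt_nz by (simp add: field_simps)
  ultimately show ?thesis by (simp only:)
qed

lemma Im_\<Phi>: "Im (\<Phi> z) = sqrt t / 2 * (S.G1 (zeta z) - S.G2 (zeta z))"
  by (simp add: \<Phi>_def)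

lemma \<Phi>_slope:
  assumes "z \<in> ball c M"
  shows "norm (deriv \<Phi> z - 1) \<le> 2 * (M / sqrt t)"
proof -
  have z: "norm (zeta z) \<le> M / sqrt t" "norm (- zeta z) \<le> M / sqrt t"
    using less_imp_le[OF zeta_less[OF assms]] by auto
  have "deriv \<Phi> z - 1 = - \<i> / 2 * ((S.sp (zeta z) - \<i>) + (Rf.sp (- zeta z) - \<i>))"
    unfolding DERIV_imp_deriv[OF \<Phi>_deriv[OF assms]] by (simp add: field_simps)
  then have "norm (deriv \<Phi> z - 1) = norm ((S.sp (zeta z) - \<i>) + (Rf.sp (- zeta z) - \<i>)) / 2"
    by (simp only: norm_mult norm_divide norm_minus_cancel) simp
  also have "\<dots> \<le> (2 * (M / sqrt t) + 2 * (M / sqrt t)) / 2"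
    using norm_triangle_mono[OF S.sp_close[OF z(1)] Rf.sp_close[OF z(2)]] by simp
  finally show ?thesis by simp
qed

lemma M_pos: "M > 0" using M R by simp

text \<open>Both critical values at the center agree with the model value up to
  \<open>14 * (M / sqrt t)\<^sup>2\<close>, thanks to centering; the factor
  \<open>sqrt t / 2\<close> costs one power of \<open>sqrt t\<close>.\<close>

lemma \<Phi>_center: "norm (\<Phi> c) \<le> 14 * M\<^sup>2 / sqrt t"
proof -
  have "(\<Sum>j\<in>{1..d}. S.w j * (- kap j)) = 0"
    using centered by (simp add: sum_negf)
  then have 2: "norm (Rf.F 0 - (Ln \<i> - 1/2)) \<le> 14 * (M / sqrt t)\<^sup>2" by (rule Rf.F_0)
  have 1: "norm (S.F 0 - (Ln \<i> - 1/2)) \<le> 14 * (M / sqrt t)\<^sup>2" by (rule S.F_0[OF centered])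
  have "norm (S.F 0 - Rf.F 0) \<le> 28 * (M / sqrt t)\<^sup>2"
    using norm_triangle_ineq4[of "S.F 0 - (Ln \<i> - 1/2)" "Rf.F 0 - (Ln \<i> - 1/2)"] 1 2 by (simp del: Ln_ii)
  then have "sqrt t / 2 * norm (S.F 0 - Rf.F 0) \<le> sqrt t / 2 * (28 * (M / sqrt t)\<^sup>2)"
    using t by (intro mult_left_mono) auto
  also have "\<dots> = 14 * M\<^sup>2 / sqrt t" using t by (simp add: power_divide power2_eq_square field_simps)
  finally show ?thesis using t by (simp add: \<Phi>_def norm_mult)
qed

text \<open>The constant is 14 from the center plus 2 from integrating the slope over a distance of
  at most \<open>M\<close>.\<close>

lemma \<Phi>_close:
  assumes z: "z \<in> ball c M"
  shows "norm (\<Phi> z - (z - c)) \<le> 16 * M\<^sup>2 / sqrt t"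
proof -
  have cb: "c \<in> ball c M" using M_pos by simp
  have "norm ((\<Phi> z - z) - (\<Phi> c - c)) \<le> 2 * (M / sqrt t) * norm (z - c)"
  proof (rule field_differentiable_bound[of "ball c M" "\<lambda>z. \<Phi> z - z" "\<lambda>z. deriv \<Phi> z - 1"])
    fix u assume u: "u \<in> ball c M"
    from DERIV_diff[OF \<Phi>_deriv[OF u] DERIV_ident] DERIV_imp_deriv[OF \<Phi>_deriv[OF u]]
    have "((\<lambda>z. \<Phi> z - z) has_field_derivative deriv \<Phi> u - 1) (at u)" by simp
    then show "((\<lambda>z. \<Phi> z - z) has_field_derivative deriv \<Phi> u - 1) (at u within ball c M)"
      by (rule has_field_derivative_at_within)
    show "norm (deriv \<Phi> u - 1) \<le> 2 * (M / sqrt t)" by (rule \<Phi>_slope[OF u])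
  qed (use z cb in auto)
  also have "\<dots> \<le> 2 * (M / sqrt t) * M"
    using z M_pos t by (intro mult_left_mono) (auto simp: dist_norm norm_minus_commute)
  also have "\<dots> = 2 * M\<^sup>2 / sqrt t" by (simp add: power2_eq_square)
  finally have "norm ((\<Phi> z - z) - (\<Phi> c - c)) \<le> 2 * M\<^sup>2 / sqrt t" .
  from norm_triangle_mono[OF this \<Phi>_center]
  have "norm ((\<Phi> z - z) - (\<Phi> c - c) + \<Phi> c) \<le> 2 * M\<^sup>2 / sqrt t + 14 * M\<^sup>2 / sqrt t" .
  moreover have "(\<Phi> z - z) - (\<Phi> c - c) + \<Phi> c = \<Phi> z - (z - c)" by simp
  moreover have "2 * M\<^sup>2 / sqrt t + 14 * M\<^sup>2 / sqrt t = 16 * M\<^sup>2 / sqrt t" by (simp add: field_simps)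
  ultimately show ?thesis by (simp only:)
qed

sublocale G: near_identity \<Phi> c R "16 * M\<^sup>2 / sqrt t"
proof
  have sub: "z \<in> ball c M" if "z \<in> ball c (R + 8)" for z using that M by simp
  show "\<Phi> holomorphic_on ball c (R + 8)"
    unfolding holomorphic_on_open[OF open_ball] using \<Phi>_deriv[OF sub] by blast
  show "norm (\<Phi> z - (z - c)) \<le> 16 * M\<^sup>2 / sqrt t" if "z \<in> ball c (R + 8)" for z
    by (rule \<Phi>_close[OF sub[OF that]])
  show "norm (deriv \<Phi> z - 1) \<le> 1/10" if "z \<in> ball c (R + 8)" for z
    using \<Phi>_slope[OF sub[OF that]] S.eta_small by linarith
qed (use R t small in auto)

lemma phase_eq:
  assumes "\<forall>j\<in>{1..d}. v \<noteq> kap j"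
  shows "phase d lam a t z (c + rt * v) = ln (sqrt t) + S.ph (zeta z) v"
proof -
  have "(\<Sum>j\<in>{1..d}. real (a j) * ln (norm (c + rt * v - lam j))) / real (total_mult d a) =
      (\<Sum>j\<in>{1..d}. S.w j * (ln (sqrt t) + ln (norm (v - kap j))))"
    unfolding sum_divide_distrib
  proof (rule sum.cong[OF refl])
    fix j assume j: "j \<in> {1..d}"
    have "c + rt * v - lam j = rt * (v - kap j)" using rt_nz by (simp add: field_simps)
    then have "norm (c + rt * v - lam j) = sqrt t * norm (v - kap j)" using t by (simp add: norm_mult)
    moreover have "ln (sqrt t * norm (v - kap j)) = ln (sqrt t) + ln (norm (v - kap j))"
      using t assms j by (intro ln_mult_pos) auto
    ultimately show "real (a j) * ln (norm (c + rt * v - lam j)) / real (total_mult d a) =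
        S.w j * (ln (sqrt t) + ln (norm (v - kap j)))"
      unfolding S.w_def total_mult_def by simp
  qed
  also have "\<dots> = ln (sqrt t) + (\<Sum>j\<in>{1..d}. S.w j * ln (norm (v - kap j)))"
    unfolding distrib_left sum.distrib sum_distrib_right[symmetric] S.sum_w by simp
  moreover have "(z - (c + rt * v))\<^sup>2 / of_real (2 * t) = (zeta z - v)\<^sup>2 / 2"
  proof -
    have "z - (c + rt * v) = rt * (zeta z - v)" using rt_nz by (simp add: field_simps)
    moreover have "rt\<^sup>2 = of_real t" using t by (simp flip: of_real_power)
    ultimately show ?thesis using t by (simp add: power_mult_distrib)
  qed
  ultimately show ?thesis unfolding phase_def S.ph_def by (simp only: Re_divide_numeral)
qed

lemma saddle_eq:
  "u \<in># saddle_points d lam a t z \<longleftrightarrow> u \<in> (\<lambda>v. c + rt * v) ` {v. (\<forall>j\<in>{1..d}. v \<noteq> kap j) \<and> S.S v = zeta z}"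
proof -
  have root: "poly (saddle_poly d lam a t z) u = 0 \<longleftrightarrow> u \<notin> lam ` {1..d} \<and>
      u + of_real (t / real (total_mult d a)) * (\<Sum>j\<in>{1..d}. of_nat (a j) / (u - lam j)) = z" for u
    using inj_lam a d t by (rule saddle_poly_root_iff)
  have "lam 1 \<in> lam ` {1..d}" using d by (intro imageI) simp
  then have "poly (saddle_poly d lam a t z) (lam 1) \<noteq> 0" using root[of "lam 1"] by blast
  then have nz: "saddle_poly d lam a t z \<noteq> 0" by auto
  have "(u \<in># saddle_points d lam a t z) = (poly (saddle_poly d lam a t z) u = 0)"
    unfolding saddle_points_def using nz by simp
  also have "\<dots> = (u \<in> (\<lambda>v. c + rt * v) ` {v. (\<forall>j\<in>{1..d}. v \<noteq> kap j) \<and> S.S v = zeta z})"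
  proof -
    define v where "v = (u - c) / rt"
    have u: "u = c + rt * v" using rt_nz by (simp add: v_def)
    have A: "u \<notin> lam ` {1..d} \<longleftrightarrow> (\<forall>j\<in>{1..d}. v \<noteq> kap j)"
      using rt_nz unfolding v_def by auto
    have B: "u + of_real (t / real (total_mult d a)) * (\<Sum>j\<in>{1..d}. of_nat (a j) / (u - lam j)) = c + rt * S.S v"
    proof -
      have "of_real (t / real (total_mult d a)) * (\<Sum>j\<in>{1..d}. of_nat (a j) / (u - lam j)) =
          (\<Sum>j\<in>{1..d}. rt * (S.w j / (v - kap j)))"
        unfolding sum_distrib_left
      proof (rule sum.cong[OF refl])
        fix j
        have 1: "u - lam j = rt * (v - kap j)" using rt_nz by (simp add: u field_simps)
        have "rt * rt = of_real t" using t by (simp flip: of_real_mult)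
        then have "of_real t / (rt * x) = rt / x" for x using rt_nz by (metis mult_divide_mult_cancel_left)
        then have "of_nat (a j) / of_nat (total_mult d a) * (of_real t / (rt * (v - kap j))) =
            of_nat (a j) / of_nat (total_mult d a) * (rt / (v - kap j))" by (simp only:)
        then show "of_real (t / real (total_mult d a)) * (of_nat (a j) / (u - lam j)) = rt * (S.w j / (v - kap j))"
          unfolding 1 S.w_def total_mult_def[symmetric] by (simp add: mult_ac)
      qed
      then show ?thesis unfolding S.S_def by (simp add: u distrib_left sum_distrib_left)
    qed
    have C: "c + rt * S.S v = z \<longleftrightarrow> S.S v = zeta z" using rt_nz by (auto simp: field_simps)
    have D: "u \<in> (\<lambda>v. c + rt * v) ` X \<longleftrightarrow> v \<in> X" for X
    proof
      assume "u \<in> (\<lambda>v. c + rt * v) ` X"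
      then obtain x where "x \<in> X" "u = c + rt * x" by blast
      moreover from this have "v = x" unfolding v_def using rt_nz by simp
      ultimately show "v \<in> X" by simp
    qed (use u in blast)
    show ?thesis unfolding root[of u] A B C D by simp
  qed
  finally show ?thesis .
qed

lemma Max_phase:
  assumes "z \<in> ball c M"
  shows "Max (set_mset (image_mset (phase d lam a t z) (saddle_points d lam a t z))) = V z"
proof -
  let ?X = "{v. (\<forall>j\<in>{1..d}. v \<noteq> kap j) \<and> S.S v = zeta z}"
  have set: "set_mset (saddle_points d lam a t z) = (\<lambda>v. c + rt * v) ` ?X" using saddle_eq by blast
  have i: "inj (\<lambda>v. c + rt * v)" using rt_nz by (auto intro!: injI)
  have f: "finite ((\<lambda>v. c + rt * v) ` ?X)" unfolding set[symmetric] by simp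
  have fin: "finite ?X" by (rule finite_imageD[OF f inj_on_subset[OF i subset_UNIV]])
  have zl: "norm (zeta z) \<le> M / sqrt t" using zeta_less[OF assms] by simp
  have mx: "Max (S.ph (zeta z) ` ?X) = max (S.G1 (zeta z)) (S.G2 (zeta z))"
    by (rule S.Max_ph[OF zl fin refl])
  have ne: "?X \<noteq> {}"
  proof -
    have "S.sp (zeta z) \<in> ?X" using S.sp[OF zl] S.near_i(3)[OF S.sp(1)[OF zl]] by auto
    then show ?thesis by blast
  qed
  have "phase d lam a t z ` (\<lambda>v. c + rt * v) ` ?X = (\<lambda>v. ln (sqrt t) + S.ph (zeta z) v) ` ?X"
    unfolding image_image by (rule image_cong[OF refl], rule phase_eq) simp
  then have eq: "set_mset (image_mset (phase d lam a t z) (saddle_points d lam a t z)) =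
      (\<lambda>x. ln (sqrt t) + x) ` S.ph (zeta z) ` ?X"
    unfolding set_image_mset set by (simp add: image_image)
  have "ln (sqrt t) + Max (S.ph (zeta z) ` ?X) = Max ((\<lambda>x. ln (sqrt t) + x) ` S.ph (zeta z) ` ?X)"
    by (rule mono_Max_commute) (use fin ne in \<open>auto simp: mono_def\<close>)
  then show ?thesis unfolding eq V_def mx by simp
qed

end

section \<open>Potential and support of the limit measure\<close>

lemma ln_norm_prod_mset:
  fixes X :: "complex multiset"
  assumes "\<And>x. x \<in># X \<Longrightarrow> x \<noteq> z"
  shows "ln (norm (\<Prod>x\<in>#X. z - x)) = (\<Sum>x\<in>#X. ln (norm (z - x)))"
proof -
  have "ln (norm (\<Prod>x\<in>#X. z - x)) = (\<Sum>x\<in>#X. ln (norm (z - x))) \<and> (\<Prod>x\<in>#X. z - x) \<noteq> 0"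
    using assms
  proof (induction X)
    case (add x X)
    then have "z - x \<noteq> 0" by fastforce
    then show ?case using add by (simp add: norm_mult ln_mult)
  qed simp
  then show ?thesis ..
qed

context large_time
begin

abbreviation evolved :: "nat \<Rightarrow> complex poly" where "evolved n \<equiv> evolved_power d lam a t n"
abbreviation roots :: "nat \<Rightarrow> complex multiset" where "roots n \<equiv> proots (evolved n)"

lemma poly_LI:
  "n > 0 \<Longrightarrow> poly (evolved n) z =
    of_real (sqrt t ^ (n * total_mult d a) * sqrt (real (n * total_mult d a)) / sqrt (2 * pi)) * S.LI n (zeta z)"
  by (rule poly_evolved_power_LI[OF t _ S.saddle_axioms])

text \<open>On a small ball the phase difference is bounded below, so the uniform lower bound in
  \<open>LI_bounds\<close> excludes roots for large \<open>n\<close> and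
  \<open>potential_root_free\<close> applies. Of the prefactors in \<open>poly_LI\<close> only
  \<open>ln (sqrt t)\<close> survives in the limit.\<close>

lemma off_curve:
  assumes z: "z \<in> ball c M" and im: "Im (\<Phi> z) \<noteq> 0"
  obtains r where "r > 0" "AE \<xi> in \<mu>. \<xi> \<notin> ball z r"
    "integrable \<mu> (lnd z)" "L.pot z = V z"
proof -
  define b where "b = \<bar>Im (\<Phi> z)\<bar> / 2"
  have b: "b > 0" using im by (simp add: b_def)
  have "continuous (at z) \<Phi>" by (rule DERIV_isCont[OF \<Phi>_deriv[OF z]])
  then obtain r0 where r0: "r0 > 0" "\<And>w. dist w z < r0 \<Longrightarrow> dist (\<Phi> w) (\<Phi> z) < b"
    using b unfolding continuous_at_eps_delta by blast
  obtain r1 where r1: "r1 > 0" "ball z r1 \<subseteq> ball c M" using z open_ball openE by blast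
  define r where "r = min r0 r1"
  have r: "r > 0" using r0 r1 by (simp add: r_def)
  have gap: "w \<in> ball c M \<and> \<bar>S.G1 (zeta w) - S.G2 (zeta w)\<bar> \<ge> 2 / sqrt t * b" if "w \<in> ball z r" for w
  proof
    show wM: "w \<in> ball c M" using that r1 by (auto simp: r_def)
    have "dist w z < r0" using that by (simp add: r_def dist_commute)
    from r0(2)[OF this] have "\<bar>Im (\<Phi> w - \<Phi> z)\<bar> < b"
      using abs_Im_le_cmod[of "\<Phi> w - \<Phi> z"] unfolding dist_norm by linarith
    then have "b \<le> \<bar>Im (\<Phi> w)\<bar>" unfolding b_def minus_complex.sel by linarith
    also have "\<dots> = sqrt t / 2 * \<bar>S.G1 (zeta w) - S.G2 (zeta w)\<bar>"
      unfolding Im_\<Phi> abs_mult using t by simp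
    finally show "\<bar>S.G1 (zeta w) - S.G2 (zeta w)\<bar> \<ge> 2 / sqrt t * b"
      using t by (simp add: field_simps)
  qed
  have tau: "2 / sqrt t * b > 0" using b t by simp
  have free: "\<forall>\<^sub>F n in sequentially. \<forall>x\<in>#roots n. x \<notin> ball z r"
    using S.LI_bounds[OF tau] eventually_gt_at_top[of 0]
  proof eventually_elim
    case (elim n)
    show ?case
    proof (intro ballI notI)
      fix x assume x: "x \<in># roots n" and xr: "x \<in> ball z r"
      have N0: "S.N n > 0" using S.N_ge[of n] elim(2) by simp
      have "norm (zeta x) \<le> M / sqrt t" using gap[OF xr] zeta_less by (simp add: less_imp_le)
      then have "exp (S.N n * max (S.G1 (zeta x)) (S.G2 (zeta x))) / (10 * sqrt (S.N n)) \<le> norm (S.LI n (zeta x))"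
        using elim(1) gap[OF xr] by blast
      moreover have "0 < exp (S.N n * max (S.G1 (zeta x)) (S.G2 (zeta x))) / (10 * sqrt (S.N n))" using N0 by simp
      ultimately have "S.LI n (zeta x) \<noteq> 0" by auto
      then have "poly (evolved n) x \<noteq> 0"
        unfolding poly_LI[OF elim(2)] using t elim(2) alpha_pos by simp
      then show False using x evolved_power_nonzero by simp
    qed
  qed
  have zr: "z \<in> ball z r" using r by simp
  have zl: "norm (zeta z) \<le> M / sqrt t" using zeta_less[OF z] by simp
  have ne: "S.G1 (zeta z) \<noteq> S.G2 (zeta z)" using im unfolding Im_\<Phi> by auto
  have "(\<lambda>n. (\<Sum>x\<in>#roots n. ln (norm (z - x))) / size (roots n)) \<longlonglongrightarrow> V z"
  proof (rule Lim_transform_eventually)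
    have lim: "((\<lambda>x::real. k + ln (sqrt x / sqrt (2 * pi)) / x) \<longlongrightarrow> k) at_top" for k by real_asymp
    from filterlim_compose[OF lim S.N_at_top]
    have "(\<lambda>n. ln (sqrt t) + ln (sqrt (S.N n) / sqrt (2 * pi)) / S.N n) \<longlonglongrightarrow> ln (sqrt t)" .
    from tendsto_add[OF this S.LI_limit[OF zl ne]]
    show "(\<lambda>n. ln (sqrt t) + ln (sqrt (S.N n) / sqrt (2 * pi)) / S.N n + ln (norm (S.LI n (zeta z))) / S.N n) \<longlonglongrightarrow> V z"
      unfolding V_def .
    show "\<forall>\<^sub>F n in sequentially. ln (sqrt t) + ln (sqrt (S.N n) / sqrt (2 * pi)) / S.N n + ln (norm (S.LI n (zeta z))) / S.N n =
        (\<Sum>x\<in>#roots n. ln (norm (z - x))) / size (roots n)"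
      using free eventually_gt_at_top[of 0]
    proof eventually_elim
      case (elim n)
      let ?p = "evolved n"
      define K where "K = n * total_mult d a"
      have SN: "S.N n = real K" unfolding S.N_def total_mult_def K_def ..
      have K0: "real K > 0" using S.N_ge[of n] elim(2) unfolding SN by linarith
      have zx: "x \<noteq> z" if "x \<in># proots ?p" for x using elim(1) that zr by auto
      have "poly ?p z \<noteq> 0"
        using zx[of z] evolved_power_nonzero[of d lam a t n] by auto
      then have LI0: "S.LI n (zeta z) \<noteq> 0" unfolding poly_LI[OF elim(2)] by auto
      have "(\<Sum>x\<in>#proots ?p. ln (norm (z - x))) = ln (norm (poly ?p z))"
        unfolding poly_evolved_power by (rule ln_norm_prod_mset[symmetric]) (rule zx)
      also have "norm (poly ?p z) = sqrt t ^ K * (sqrt (real K) / sqrt (2 * pi)) * norm (S.LI n (zeta z))"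
        unfolding poly_LI[OF elim(2)] K_def[symmetric] norm_mult norm_of_real using t by simp
      also have "ln \<dots> = ln (sqrt t ^ K) + ln (sqrt (real K) / sqrt (2 * pi)) + ln (norm (S.LI n (zeta z)))"
      proof -
        have "sqrt t ^ K > 0" "sqrt (real K) / sqrt (2 * pi) > 0" "norm (S.LI n (zeta z)) > 0"
          using t K0 LI0 by auto
        then show ?thesis by (simp only: ln_mult_pos mult_pos_pos)
      qed
      also have "ln (sqrt t ^ K) = real K * ln (sqrt t)" by (rule ln_realpow)
      finally show ?case
        unfolding size_roots_evolved_power K_def[symmetric] SN using K0 by (simp add: add_divide_distrib)
    qed
  qed
  note pot = L.potential_root_free[OF r free this]
  show ?thesis by (rule that[OF r L.root_free_null[OF r free] pot])
qed

lemma potential_off_curve: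
  assumes "z \<in> ball c M" "Im (\<Phi> z) \<noteq> 0"
  shows "AE \<xi> in \<mu>. \<xi> \<noteq> z" "integrable \<mu> (lnd z)" "L.pot z = V z"
proof -
  obtain r where r: "r > 0" "AE \<xi> in \<mu>. \<xi> \<notin> ball z r" "integrable \<mu> (lnd z)" "L.pot z = V z"
    by (rule off_curve[OF assms])
  show "AE \<xi> in \<mu>. \<xi> \<noteq> z" using r(2) by eventually_elim (use r(1) in auto)
  show "integrable \<mu> (lnd z)" "L.pot z = V z" by (rule r)+
qed

lemma support_in_curve:
  assumes "z \<in> measure_support \<mu>" "z \<in> ball c M"
  shows "Im (\<Phi> z) = 0"
proof (rule ccontr)
  assume "Im (\<Phi> z) \<noteq> 0"
  then obtain r where r: "r > 0" "AE \<xi> in \<mu>. \<xi> \<notin> ball z r" using off_curve[OF assms(2)] by blast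
  have "ball z r \<in> sets \<mu>" using L.sets_eq by simp
  then have "emeasure \<mu> (ball z r) = 0"
    using r(2) by (subst (asm) AE_iff_measurable[of "ball z r"]) (auto simp: L.space_eq)
  then show False using assms(1) r(1) unfolding measure_support_def
    by (auto dest!: spec[of _ "ball z r"])
qed

lemma AE_curve: "AE \<xi> in \<mu>. \<xi> \<notin> ball c M \<or> Im (\<Phi> \<xi>) = 0"
  using L.AE_support by eventually_elim (use support_in_curve in blast)

lemma V_continuous: "continuous_on (ball c M) V"
  unfolding V_def
proof (rule continuous_on_add[OF continuous_on_const continuous_on_max])
  have c: "continuous_on (ball c M) zeta" by (intro continuous_intros) (use rt_nz in simp)
  show "continuous_on (ball c M) (\<lambda>z. S.G1 (zeta z))"
    by (rule continuous_on_compose2[OF S.G1_continuous c]) (use zeta_less in auto)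
  show "continuous_on (ball c M) (\<lambda>z. S.G2 (zeta z))"
    by (rule continuous_on_compose2[OF S.G2_continuous c]) (use zeta_less in auto)
qed

text \<open>A point on the curve is approached by points whose images under \<open>\<Phi>\<close>
  lie straight above its own. Nearby, the support is mapped into the real axis, so moving up never
  brings the image closer to it; this yields the comparison of distances that the passage to the
  limit needs.\<close>

lemma potential:
  assumes z: "z \<in> ball c (R + 1)"
  shows "AE \<xi> in \<mu>. \<xi> \<noteq> z" "integrable \<mu> (lnd z)" "L.pot z = V z"
proof -
  have zM: "z \<in> ball c M" and z8: "z \<in> ball c (R + 8)" using z M by auto
  have "(AE \<xi> in \<mu>. \<xi> \<noteq> z) \<and> integrable \<mu> (lnd z) \<and> L.pot z = V z"
  proof (cases "Im (\<Phi> z) = 0")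
    case False
    with zM show ?thesis using potential_off_curve by blast
  next
    case True
    define s where "s m = \<Phi> z + \<i> * of_real (1 / real (Suc m))" for m
    define v where "v m = G.\<Psi> (s m)" for m
    have Pz: "norm (\<Phi> z) < R + 2"
      using \<Phi>_close[OF zM] z small norm_triangle_ineq[of "\<Phi> z - (z - c)" "z - c"]
      by (simp add: dist_norm norm_minus_commute)
    have i1: "norm (\<i> * complex_of_real (1 / real (Suc m))) \<le> 1" for m
      unfolding norm_mult norm_of_real by simp
    have sn: "norm (s m) < R + 4" for m
      unfolding s_def using norm_triangle_ineq[of "\<Phi> z" "\<i> * of_real (1 / real (Suc m))"] Pz i1[of m] by linarith
    have v8: "v m \<in> ball c (R + 8)" and Phv: "\<Phi> (v m) = s m" for m
      unfolding v_def using G.\<Psi>[OF sn] by auto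
    then have vM: "v m \<in> ball c M" for m using M by (meson ball_subset_cball subset_ball subsetD)
    have imv: "Im (\<Phi> (v m)) = 1 / real (Suc m)" for m unfolding Phv s_def using True by simp
    have imv0: "Im (\<Phi> (v m)) \<noteq> 0" for m unfolding imv by simp
    note off = potential_off_curve[OF vM imv0]
    have "(\<lambda>m. 1 / real (Suc m)) \<longlonglongrightarrow> 0" by (rule LIMSEQ_Suc[OF lim_1_over_n])
    then have "(\<lambda>m. s m) \<longlonglongrightarrow> \<Phi> z + \<i> * of_real 0" unfolding s_def by (intro tendsto_intros)
    then have "(\<lambda>m. s m) \<longlonglongrightarrow> \<Phi> z" by simp
    moreover have "isCont G.\<Psi> (\<Phi> z)"
      using holomorphic_on_imp_continuous_on[OF G.\<Psi>_holomorphic(1)] Pz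
      by (simp add: continuous_on_eq_continuous_at)
    ultimately have "v \<longlonglongrightarrow> G.\<Psi> (\<Phi> z)" unfolding v_def[abs_def] by (rule isCont_tendsto_compose[rotated])
    then have vlim: "v \<longlonglongrightarrow> z" by (simp add: G.\<Psi>_\<Phi>[OF z8])
    have "isCont V z" using V_continuous zM by (simp add: continuous_on_eq_continuous_at)
    from isCont_tendsto_compose[OF this vlim]
    have lim: "(\<lambda>m. L.pot (v m)) \<longlonglongrightarrow> V z" by (simp add: off(3))
    have ne: "v m \<noteq> z" for m using imv0[of m] True by auto
    \<comment> \<open>In the disk the two Lipschitz constants give the ratio 9/11; outside,
      distances from \<open>z\<close> are at least 7 while \<open>v m\<close> is within 2 of
      \<open>z\<close>.\<close>
    have sep: "AE \<xi> in \<mu>. norm (v m - \<xi>) \<ge> 1/2 * norm (z - \<xi>)" for m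
      using AE_curve
    proof eventually_elim
      case (elim \<xi>)
      have vz: "norm (v m - z) \<le> 2"
        using G.bilipschitz(1)[OF v8[of m] z8] i1[of m] unfolding Phv by (simp add: s_def)
      show ?case
      proof (cases "\<xi> \<in> ball c (R + 8)")
        case True
        have \<xi>M: "\<xi> \<in> ball c M" using True M by auto
        have "9/10 * norm (z - \<xi>) \<le> norm (\<Phi> z - \<Phi> \<xi>)" by (rule G.bilipschitz(1)[OF z8 True])
        also have "\<dots> \<le> norm (\<Phi> (v m) - \<Phi> \<xi>)"
        proof -
          have "Im (\<Phi> \<xi>) = 0" using elim \<xi>M by blast
          then have "\<bar>Im (\<Phi> z - \<Phi> \<xi>)\<bar> \<le> \<bar>Im (\<Phi> (v m) - \<Phi> \<xi>)\<bar>" "Re (\<Phi> z - \<Phi> \<xi>) = Re (\<Phi> (v m) - \<Phi> \<xi>)"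
            using \<open>Im (\<Phi> z) = 0\<close> unfolding Phv s_def by auto
          then show ?thesis unfolding cmod_def by (simp add: abs_le_square_iff)
        qed
        also have "\<dots> \<le> 11/10 * norm (v m - \<xi>)" by (rule G.bilipschitz(2)[OF v8 True])
        finally show ?thesis using norm_ge_zero[of "z - \<xi>"] by linarith
      next
        case False
        then have "norm (c - \<xi>) \<ge> R + 8" by (simp add: dist_norm)
        then have "norm (z - \<xi>) \<ge> 7"
          using norm_triangle_ineq[of "c - z" "z - \<xi>"] z by (simp add: dist_norm)
        then show ?thesis
          using vz norm_triangle_ineq[of "z - v m" "v m - \<xi>"] by (simp add: norm_minus_commute)
      qed
    qed
    have half: "(1/2 :: real) > 0" by simp
    show ?thesis using L.potential_limit[OF vlim ne half sep off(1,2) lim] by blast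
  qed
  then show "AE \<xi> in \<mu>. \<xi> \<noteq> z" "integrable \<mu> (lnd z)" "L.pot z = V z"
    by auto
qed

lemma log_potential_V:
  assumes "z \<in> cball c R"
  shows "log_potential \<mu> z = ereal (Max (set_mset (image_mset (phase d lam a t z) (saddle_points d lam a t z))))"
proof -
  have z: "z \<in> ball c (R + 1)" "z \<in> ball c M" using assms M by auto
  show ?thesis
    unfolding Max_phase[OF z(2)] log_potential_eq[OF L.sets_eq potential(1,2)[OF z(1)]] potential(3)[OF z(1)] ..
qed

text \<open>On the curve the potential has a kink in the transversal direction, hence it is not
  harmonic there.\<close>

lemma curve_in_support:
  assumes z: "z \<in> cball c R" and im: "Im (\<Phi> z) = 0"
  shows "z \<in> measure_support \<mu>"
proof (rule ccontr)
  assume ns: "z \<notin> measure_support \<mu>"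
  have zM: "z \<in> ball c M" and z8: "z \<in> ball c (R + 8)" using z M by auto
  have b1: "w \<in> ball c (R + 1)" if "w \<in> ball z 1" for w
    using that z dist_triangle[of c w z] by simp
  have pot: "integrable \<mu> (lnd w) \<and> L.pot w = V w"
    if "w \<in> ball z 1" for w
    using potential(2,3)[OF b1[OF that]] by simp
  obtain C r where r: "r > 0" and C: "\<And>h. norm h < r \<Longrightarrow> \<bar>V (z + h) + V (z - h) - 2 * V z\<bar> \<le> C * (norm h)\<^sup>2"
    by (rule L.potential_second_difference[OF ns zero_less_one, where V = V], erule pot, rule that)
  \<comment> \<open>By \<open>max x y = (x + y) / 2 + \<bar>x - y\<bar> / 2\<close>,
    \<open>V\<close> is a constant plus the real part of the holomorphic \<open>Q\<close> plus a
    multiple of \<open>\<bar>Im \<Phi>\<bar>\<close>, which carries the kink.\<close>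
  define Q where "Q w = (S.F (zeta w) + Rf.F (- zeta w)) / 2" for w
  have Vabs: "V w = ln (sqrt t) + Re (Q w) + \<bar>Im (\<Phi> w)\<bar> / sqrt t" for w
  proof -
    have "\<bar>Im (\<Phi> w)\<bar> / sqrt t = \<bar>S.G1 (zeta w) - S.G2 (zeta w)\<bar> / 2"
      unfolding Im_\<Phi> abs_mult using t by simp
    moreover have "max x y = (x + y) / 2 + \<bar>x - y\<bar> / 2" for x y :: real by (simp add: max_def abs_if field_simps)
    ultimately show ?thesis by (simp add: V_def Q_def add_divide_distrib)
  qed
  have zl: "norm (zeta z) < M / sqrt t" "norm (- zeta z) < M / sqrt t" using zeta_less[OF zM] by auto
  note D = zeta_deriv[of z]
  from DERIV_cdivide[OF DERIV_add[OF DERIV_chain2[OF S.F_deriv[OF zl(1)] D] DERIV_chain2[OF Rf.F_deriv[OF zl(2)] DERIV_minus[OF D]]], of 2]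
  have "\<exists>Q'. (Q has_field_derivative Q') (at z)" unfolding Q_def[abs_def] by (rule exI)
  then obtain Q' where "(Q has_field_derivative Q') (at z)" by blast
  then have "(Q has_derivative (*) Q') (at z)" by (simp add: has_field_derivative_def)
  then obtain e where e: "e > 0" "\<And>w. norm (w - z) < e \<Longrightarrow> norm (Q w - Q z - Q' * (w - z)) \<le> 1 / (4 * sqrt t) * norm (w - z)"
    using t unfolding has_derivative_at_alt by (metis divide_pos_pos mult_pos_pos real_sqrt_gt_zero zero_less_numeral zero_less_one)
  \<comment> \<open>Chosen so that the kink, at least \<open>9/5 * y / sqrt t\<close>, beats the
    differentiability error of \<open>Q\<close> and \<open>C * y\<^sup>2\<close>, each at most
    \<open>y / (2 * sqrt t)\<close>.\<close>
  define y where "y = min (1/2) (min (e / 2) (min (r / 2) (1 / (2 * sqrt t * (\<bar>C\<bar> + 1)))))"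
  have y: "y > 0" "y < 1" "y < e" "y < r" "y \<le> 1 / (2 * sqrt t * (\<bar>C\<bar> + 1))"
    using e(1) r t by (auto simp: y_def)
  define h where "h = \<i> * complex_of_real y"
  have nh: "norm h = y" using y(1) by (simp add: h_def norm_mult)
  have q: "norm (Q (z + h) + Q (z - h) - 2 * Q z) \<le> 1 / (2 * sqrt t) * y"
  proof -
    have "norm (Q (z + h) - Q z - Q' * h) \<le> 1 / (4 * sqrt t) * y" "norm (Q (z - h) - Q z - Q' * - h) \<le> 1 / (4 * sqrt t) * y"
      using e(2)[of "z + h"] e(2)[of "z - h"] nh y(3) by auto
    from norm_triangle_mono[OF this]
    have "norm ((Q (z + h) - Q z - Q' * h) + (Q (z - h) - Q z - Q' * - h)) \<le> 1 / (4 * sqrt t) * y + 1 / (4 * sqrt t) * y" .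
    moreover have "(Q (z + h) - Q z - Q' * h) + (Q (z - h) - Q z - Q' * - h) = Q (z + h) + Q (z - h) - 2 * Q z" by simp
    ultimately show ?thesis by simp
  qed
  have q': "Re (Q (z + h)) + Re (Q (z - h)) - 2 * Re (Q z) \<ge> - (1 / (2 * sqrt t) * y)"
    using abs_Re_le_cmod[of "Q (z + h) + Q (z - h) - 2 * Q z"] q by simp
  have kink: "\<bar>Im (\<Phi> (z + k))\<bar> \<ge> 9/10 * y" if k: "k = h \<or> k = - h" for k
  proof -
    have nk: "norm k = y" "\<bar>Im k\<bar> = y" using k nh y(1) by (auto simp: h_def)
    have "z + k \<in> ball z 1" using nk y by (simp add: dist_norm)
    then have "z + k \<in> ball c (R + 8)" using b1[of "z + k"] by simp
    from G.lipschitz[OF this z8] have "norm ((\<Phi> (z + k) - \<Phi> z) - k) \<le> 1/10 * y" by (simp add: nk)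
    then have "\<bar>Im ((\<Phi> (z + k) - \<Phi> z) - k)\<bar> \<le> 1/10 * y" using abs_Im_le_cmod order_trans by blast
    then show ?thesis using nk(2) im unfolding minus_complex.sel by linarith
  qed
  have "V (z + h) + V (z - h) - 2 * V z =
      (Re (Q (z + h)) + Re (Q (z - h)) - 2 * Re (Q z)) + (\<bar>Im (\<Phi> (z + h))\<bar> + \<bar>Im (\<Phi> (z - h))\<bar>) / sqrt t"
    unfolding Vabs im by (simp add: add_divide_distrib)
  moreover have "(9/10 * y + 9/10 * y) / sqrt t \<le> (\<bar>Im (\<Phi> (z + h))\<bar> + \<bar>Im (\<Phi> (z - h))\<bar>) / sqrt t"
    using kink[of h] kink[of "- h"] t by (intro divide_right_mono add_mono) auto
  moreover have "\<bar>V (z + h) + V (z - h) - 2 * V z\<bar> \<le> C * y\<^sup>2" using C[of h] y(4) nh by simp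
  ultimately have "(9/10 * y + 9/10 * y) / sqrt t - 1 / (2 * sqrt t) * y \<le> C * y\<^sup>2" using q' by linarith
  also have "C * y\<^sup>2 \<le> (\<bar>C\<bar> + 1) * y * y" using y(1) unfolding power2_eq_square mult.assoc by (intro mult_right_mono) auto
  also have "\<dots> \<le> (\<bar>C\<bar> + 1) * (1 / (2 * sqrt t * (\<bar>C\<bar> + 1))) * y" using y by (intro mult_right_mono mult_left_mono) auto
  also have "\<dots> = y / (2 * sqrt t)" by simp
  finally have "(9/10 * y + 9/10 * y) / sqrt t \<le> y / sqrt t" by (simp add: field_simps)
  then show False using y(1) t by (simp add: divide_right_mono field_simps)
qed

lemma support_eq: "measure_support \<mu> \<inter> cball c R = G.curve"
proof -
  have "z \<in> ball c M" if "z \<in> cball c R" for z using that M by simp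
  then show ?thesis using support_in_curve curve_in_support unfolding G.curve_def by blast
qed

end

theorem theorem2p7:
  fixes d :: nat and lam :: "nat \<Rightarrow> complex" and a :: "nat \<Rightarrow> nat"
    and \<mu> :: "real \<Rightarrow> complex measure" and R :: real
  assumes "d \<ge> 1"
    and "inj_on lam {1..d}"
    and "\<And>j. j \<in> {1..d} \<Longrightarrow> a j \<ge> 1"
    and "\<And>t. t > 0 \<Longrightarrow> prob_space (\<mu> t)"
    and "\<And>t. t > 0 \<Longrightarrow> sets (\<mu> t) = sets borel"
    and "\<And>t. t > 0 \<Longrightarrow> compact (measure_support (\<mu> t))"
    and "\<And>t. t > 0 \<Longrightarrow> weakly_converges (zero_measure d lam a t) (\<mu> t)"
    and "R > 0"
  defines "c \<equiv> center_of_mass d lam a"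
  defines "K \<equiv> cball c R"
  shows "(\<forall>\<^sub>F t in at_top.
            (\<forall>z\<in>K. log_potential (\<mu> t) z =
               ereal (Max (set_mset (image_mset (phase d lam a t z) (saddle_points d lam a t z))))) \<and>
            smooth_curve (measure_support (\<mu> t) \<inter> K))
       \<and> (\<exists>p q. Im p = Im q \<and> c \<in> open_segment p q \<and>
            ((\<lambda>t. hausdorff_distance (measure_support (\<mu> t) \<inter> K) (closed_segment p q)) \<longlongrightarrow> 0) at_top)"
proof -
  \<comment> \<open>Covers both the disk with its margin and all \<open>lam j\<close>, so that a
    single \<open>\<eta> = M / sqrt t\<close> serves for the scaled roots and the scaled
    points.\<close>
  define M where "M = max (R + 8) (Max ((\<lambda>j. norm (lam j - c)) ` {1..d}))"
  have MR: "M \<ge> R + 8" and M0: "M > 0" using assms(8) by (auto simp: M_def)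
  have Ml: "norm (lam j - c) \<le> M" if "j \<in> {1..d}" for j
    unfolding M_def using that by (intro max.coboundedI2 Max_ge) auto
  have lt: "\<forall>\<^sub>F t in at_top. large_time d a lam c t M R (\<mu> t)"
  proof -
    have lim: "((\<lambda>t. x / sqrt t) \<longlongrightarrow> 0) at_top" for x by real_asymp
    have "\<forall>\<^sub>F t in at_top. M / sqrt t < 1 / 10000000" "\<forall>\<^sub>F t in at_top. 16 * M\<^sup>2 / sqrt t < 1/10"
      "\<forall>\<^sub>F t in at_top. 160 * M\<^sup>2 / sqrt t < R"
      by (rule order_tendstoD(2)[OF lim]; use assms(8) in simp)+
    then show ?thesis using eventually_gt_at_top[of 0]
    proof eventually_elim
      case (elim t)
      have "a 1 \<le> (\<Sum>j\<in>{1..d}. a j)" using assms(1) by (intro member_le_sum) auto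
      then have apos: "(\<Sum>j\<in>{1..d}. a j) > 0" using assms(1) assms(3)[of 1] by simp
      have "saddle {1..d} a (\<lambda>j. (lam j - c) / of_real (sqrt t)) (M / sqrt t)"
      proof
        show "norm ((lam j - c) / of_real (sqrt t)) \<le> M / sqrt t" if "j \<in> {1..d}" for j
          using Ml[OF that] elim by (simp add: norm_divide divide_right_mono)
      qed (use apos elim M0 in auto)
      moreover have "root_limit (\<mu> t) (\<lambda>n. proots (evolved_power d lam a t n))"
        using elim assms by (intro root_limit_evolved) auto
      moreover have "large_time_axioms d a lam c t M R"
        unfolding large_time_axioms_def using elim assms MR by (auto simp: c_def)
      ultimately show ?case by (rule large_time.intro)
    qed
  qed
  have 1: "\<forall>\<^sub>F t in at_top. (\<forall>z\<in>K. log_potential (\<mu> t) z =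
        ereal (Max (set_mset (image_mset (phase d lam a t z) (saddle_points d lam a t z))))) \<and>
      smooth_curve (measure_support (\<mu> t) \<inter> K)"
    using lt
  proof eventually_elim
    case (elim t)
    interpret large_time d a lam c t M R "\<mu> t" by (rule elim)
    show ?case unfolding K_def support_eq using log_potential_V G.smooth_curve_curve by blast
  qed
  let ?p = "c - of_real R" and ?q = "c + of_real R"
  have "c \<in> open_segment ?p ?q"
    using assms(8) by (auto simp: in_segment intro!: exI[of _ "1/2"] simp: scaleR_conv_of_real algebra_simps complex_eq_iff)
  moreover have "((\<lambda>t. hausdorff_distance (measure_support (\<mu> t) \<inter> K) (closed_segment ?p ?q)) \<longlongrightarrow> 0) at_top"
  proof (rule real_tendsto_sandwich[OF _ _ tendsto_const])
    show "\<forall>\<^sub>F t in at_top. 0 \<le> hausdorff_distance (measure_support (\<mu> t) \<inter> K) (closed_segment ?p ?q)"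
      using lt
    proof eventually_elim
      case (elim t)
      interpret large_time d a lam c t M R "\<mu> t" by (rule elim)
      show ?case unfolding K_def support_eq by (rule G.hausdorff_curve_nonneg)
    qed
    show "\<forall>\<^sub>F t in at_top. hausdorff_distance (measure_support (\<mu> t) \<inter> K) (closed_segment ?p ?q) \<le> 2 * (16 * M\<^sup>2 / sqrt t)"
      using lt
    proof eventually_elim
      case (elim t)
      interpret large_time d a lam c t M R "\<mu> t" by (rule elim)
      show ?case unfolding K_def support_eq by (rule G.hausdorff_curve)
    qed
    show "((\<lambda>t. 2 * (16 * M\<^sup>2 / sqrt t)) \<longlongrightarrow> 0) at_top" by real_asymp
  qed
  ultimately show ?thesis using 1 by (intro conjI exI[of _ ?p] exI[of _ ?q]) auto
qed

end
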